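(* Let $p\ge 1$ be an arbitrary (finite) constant. There is an algorithm with the following guarantee. Let $m\le n$, let $A\in\mathbb{R}^{n\times m}$, let $1\le k\le\min(m,n)$, put $\delta=\mathrm{opt}_{k,p}(A)$, and let $U\in\mathbb{R}^{n\times r}$ and $V\in\mathbb{R}^{r\times m}$ with $r=O(k\log m)$ be such that $|A-UV|_p=O(k\delta)$. Then, given $A$, $k$, $U$ and $V$, the algorithm runs in time $(mn)^{O(1)}$ and outputs $W\in\mathbb{R}^{n\times k}$ and $Z\in\mathbb{R}^{k\times m}$ such that $$|A-WZ|_p=(k\log m)^{O(p)}\,\delta .$$
   Context: For a matrix $M$, $|M|_p=\left(\sum_{i,j}|M_{i,j}|^p\right)^{1/p}$ is the entrywise $\ell_p$ norm. The quantity $\mathrm{opt}_{k,p}(A)$ is the minimum of $|A-U'V'|_p$ over all $U'\in\mathbb{R}^{n\times k}$, $V'\in\mathbb{R}^{k\times m}$. The hypotheses $r=O(k\log m)$ and $|A-UV|_p=O(k\delta)$ mean $r\le Ck\log m$ and $|A-UV|_p\le Ck\delta$ for a fixed constant $C$; the constants hidden in the conclusion may depend on $C$, and since $p$ is a constant the running-time exponent may depend on $p$. As usual in asymptotic notation, the quantity $k\log m$ is read as being at least $2$. By convention, convex programs such as $\ell_p$ regression are regarded as solvable in polynomial time. *)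

theory Defs
  imports Complex_Main "Jordan_Normal_Form.Matrix"
begin

definition lp_norm :: "real \<Rightarrow> real mat \<Rightarrow> real" where
  "lp_norm p M = (\<Sum>i<dim_row M. \<Sum>j<dim_col M. \<bar>M $$ (i, j)\<bar> powr p) powr (1 / p)"

text \<open>
  The infimum is attained, since the matrices of rank at most \<open>k\<close> form a closed set.
\<close>

definition opt :: "nat \<Rightarrow> real \<Rightarrow> real mat \<Rightarrow> real" where
  "opt k p A = Inf {lp_norm p (A - U * V) | U V.
     U \<in> carrier_mat (dim_row A) k \<and> V \<in> carrier_mat k (dim_col A)}"

text \<open>
  An algorithm is a program for a real random access machine extended by an instruction for
  \<open>\<ell>\<^sub>p\<close> regression. The memory consists of arrays of natural numbers, used for
  indices and control, and of two-dimensional arrays of real numbers, all named by numbers.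
  Programs are finite and fixed before the input is seen. Their only constants are integers, and
  there is no passage from real values to indices (no rounding). Indices can only be added and
  subtracted (truncated at zero), not multiplied, so that unit cost is a fair charge even though
  they are unbounded.
\<close>

datatype iexp =
    INum nat
  | IGet nat iexp
  | IAdd iexp iexp
  | ISub iexp iexp

datatype rexp =
    RNum int
  | RGet nat iexp iexp
  | RAdd rexp rexp
  | RSub rexp rexp
  | RMul rexp rexp
  | RDiv rexp rexp

datatype bexp =
    ILess iexp iexp
  | RLess rexp rexp
  | BNot bexp
  | BAnd bexp bexp

datatype com =
    Skip
  | IAssign nat iexp iexp
  | RAssign nat iexp iexp rexp
  | Seq com com
  | If bexp com com
  | While bexp com
  | Regress nat nat nat nat iexp iexp iexp

record store =
  ints :: "nat \<Rightarrow> nat \<Rightarrow> nat"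
  reals :: "nat \<Rightarrow> nat \<Rightarrow> nat \<Rightarrow> real"

primrec ival :: "iexp \<Rightarrow> store \<Rightarrow> nat" where
  "ival (INum n) s = n"
| "ival (IGet x e) s = ints s x (ival e s)"
| "ival (IAdd e f) s = ival e s + ival f s"
| "ival (ISub e f) s = ival e s - ival f s"

primrec rval :: "rexp \<Rightarrow> store \<Rightarrow> real" where
  "rval (RNum z) s = of_int z"
| "rval (RGet x e f) s = reals s x (ival e s) (ival f s)"
| "rval (RAdd a b) s = rval a s + rval b s"
| "rval (RSub a b) s = rval a s - rval b s"
| "rval (RMul a b) s = rval a s * rval b s"
| "rval (RDiv a b) s = rval a s / rval b s"

primrec bval :: "bexp \<Rightarrow> store \<Rightarrow> bool" where
  "bval (ILess e f) s \<longleftrightarrow> ival e s < ival f s"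
| "bval (RLess a b) s \<longleftrightarrow> rval a s < rval b s"
| "bval (BNot b) s \<longleftrightarrow> \<not> bval b s"
| "bval (BAnd b c) s \<longleftrightarrow> bval b s \<and> bval c s"

definition set_int :: "nat \<Rightarrow> nat \<Rightarrow> nat \<Rightarrow> store \<Rightarrow> store" where
  "set_int x i v s = s\<lparr>ints := (ints s)(x := (ints s x)(i := v))\<rparr>"

definition set_real :: "nat \<Rightarrow> nat \<Rightarrow> nat \<Rightarrow> real \<Rightarrow> store \<Rightarrow> store" where
  "set_real x i j v s = s\<lparr>reals := (reals s)(x := (reals s x)(i := (reals s x i)(j := v)))\<rparr>"

definition get_mat :: "store \<Rightarrow> nat \<Rightarrow> nat \<Rightarrow> nat \<Rightarrow> real mat" where
  "get_mat s x a b = mat a b (\<lambda>(i, j). reals s x i j)"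

definition set_mat :: "nat \<Rightarrow> real mat \<Rightarrow> store \<Rightarrow> store" where
  "set_mat x M s = s\<lparr>reals := (reals s)(x := (\<lambda>i j.
     if i < dim_row M \<and> j < dim_col M then M $$ (i, j) else reals s x i j))\<rparr>"

text \<open>
  A solver for \<open>\<ell>\<^sub>p\<close> regression maps \<open>B\<close> and \<open>D\<close> to some minimiser \<open>X\<close>
  of \<open>|B X - D|\<^sub>p\<close> together with the optimal value; a minimiser always exists.
  Minimisers need not be unique, so a program has to be correct for every solver.
\<close>

type_synonym solver = "real mat \<Rightarrow> real mat \<Rightarrow> real mat \<times> real"

definition lp_regression_solver :: "real \<Rightarrow> solver \<Rightarrow> bool" where
  "lp_regression_solver p S \<longleftrightarrow>
     (\<forall>a c l. \<forall>B \<in> carrier_mat a c. \<forall>D \<in> carrier_mat a l.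
        fst (S B D) \<in> carrier_mat c l \<and>
        snd (S B D) = lp_norm p (B * fst (S B D) - D) \<and>
        (\<forall>X \<in> carrier_mat c l. snd (S B D) \<le> lp_norm p (B * X - D)))"

text \<open>
  \<open>exec S P s t s'\<close>: started in \<open>s\<close>, the program \<open>P\<close> terminates in
  \<open>s'\<close> after time \<open>t\<close>. A regression is charged the size of the instance and its solution;
  as these sizes are bounded by \<open>t\<close>, charging any other fixed polynomial of them would change
  \<open>t\<close> only polynomially.
  In \<open>Regress x v b d ea ec el\<close> the arrays \<open>b\<close> and \<open>d\<close> hold the instance,
  of dimensions \<open>a \<times> c\<close> and \<open>a \<times> l\<close>, the minimiser is written to array
  \<open>x\<close> and the optimal value to the entry \<open>(0, 0)\<close> of array \<open>v\<close>.
\<close>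

inductive exec :: "solver \<Rightarrow> com \<Rightarrow> store \<Rightarrow> nat \<Rightarrow> store \<Rightarrow> bool" for S :: solver where
  Skip: "exec S Skip s 1 s"
| IAssign: "exec S (IAssign x e f) s 1 (set_int x (ival e s) (ival f s) s)"
| RAssign: "exec S (RAssign x e f a) s 1 (set_real x (ival e s) (ival f s) (rval a s) s)"
| Seq: "exec S P s t s' \<Longrightarrow> exec S Q s' t' s'' \<Longrightarrow> exec S (Seq P Q) s (t + t') s''"
| IfTrue: "bval b s \<Longrightarrow> exec S P s t s' \<Longrightarrow> exec S (If b P Q) s (1 + t) s'"
| IfFalse: "\<not> bval b s \<Longrightarrow> exec S Q s t s' \<Longrightarrow> exec S (If b P Q) s (1 + t) s'"
| WhileFalse: "\<not> bval b s \<Longrightarrow> exec S (While b P) s 1 s"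
| WhileTrue: "bval b s \<Longrightarrow> exec S P s t s' \<Longrightarrow> exec S (While b P) s' t' s'' \<Longrightarrow>
    exec S (While b P) s (1 + t + t') s''"
| Regress: "a = ival ea s \<Longrightarrow> c = ival ec s \<Longrightarrow> l = ival el s \<Longrightarrow>
    (X, val) = S (get_mat s b a c) (get_mat s d a l) \<Longrightarrow>
    exec S (Regress x v b d ea ec el) s (1 + a * c + a * l + c * l)
      (set_real v 0 0 val (set_mat x X s))"

inductive_cases exec_SkipE: "exec S Skip s t s'"
  and exec_IAssignE: "exec S (IAssign x e f) s t s'"
  and exec_RAssignE: "exec S (RAssign x e f a) s t s'"
  and exec_SeqE: "exec S (Seq P Q) s t s'"
  and exec_IfE: "exec S (If b P Q) s t s'"
  and exec_WhileE: "exec S (While b P) s t s'"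
  and exec_RegressE: "exec S (Regress x v b d ea ec el) s t s'"

lemma exec_deterministic:
  "exec S P s t s' \<Longrightarrow> exec S P s t2 s2 \<Longrightarrow> t2 = t \<and> s2 = s'"
proof (induction arbitrary: t2 s2 rule: exec.induct)
  case (Skip s)
  then show ?case by (rule exec_SkipE) simp
next
  case (IAssign x e f s)
  then show ?case by (rule exec_IAssignE) simp
next
  case (RAssign x e f a s)
  then show ?case by (rule exec_RAssignE) simp
next
  case (Seq P s t s' Q t' s'')
  from Seq.prems obtain u u' v where
    "exec S P s u v" "exec S Q v u' s2" "t2 = u + u'"
    by (rule exec_SeqE)
  then show ?case using Seq.IH(1)[of u v] Seq.IH(2)[of u' s2] by simp
next
  case (IfTrue b s P t s' Q)
  from IfTrue.prems obtain u where "exec S P s u s2" "t2 = 1 + u"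
    by (rule exec_IfE) (use IfTrue.hyps in simp_all)
  then show ?case using IfTrue.IH[of u s2] by simp
next
  case (IfFalse b s Q t s' P)
  from IfFalse.prems obtain u where "exec S Q s u s2" "t2 = 1 + u"
    by (rule exec_IfE) (use IfFalse.hyps in simp_all)
  then show ?case using IfFalse.IH[of u s2] by simp
next
  case (WhileFalse b s P)
  from WhileFalse.prems show ?case
    by (rule exec_WhileE) (use WhileFalse.hyps in simp_all)
next
  case (WhileTrue b s P t s' t' s'')
  from WhileTrue.prems obtain u u' v where
    "exec S P s u v" "exec S (While b P) v u' s2" "t2 = 1 + u + u'"
    by (rule exec_WhileE) (use WhileTrue.hyps in simp_all)
  then show ?case using WhileTrue.IH(1)[of u v] WhileTrue.IH(2)[of u' s2] by simp
next
  case (Regress a ea s c ec l el X val b d x v)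
  from Regress.prems obtain X' val' where
    t2: "t2 = Suc (a * c + a * l + c * l)"
    and s2: "s2 = set_real v 0 0 val' (set_mat x X' s)"
    and *: "(X', val') = S (get_mat s b a c) (get_mat s d a l)"
    unfolding Regress.hyps(1-3) by (rule exec_RegressE)
  have "(X', val') = (X, val)"
    by (rule trans[OF * Regress.hyps(4)[symmetric]])
  then have "X' = X" "val' = val" by simp_all
  then show ?case unfolding t2 s2 by simp
qed

definition input_store ::
  "nat \<Rightarrow> nat \<Rightarrow> nat \<Rightarrow> nat \<Rightarrow> real mat \<Rightarrow> real mat \<Rightarrow> real mat \<Rightarrow> store" where
  "input_store n m r k A U V =
     set_int 0 0 n (set_int 0 1 m (set_int 0 2 r (set_int 0 3 k
       (set_mat 0 A (set_mat 1 U (set_mat 2 V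
         \<lparr>ints = (\<lambda>_ _. 0), reals = (\<lambda>_ _ _. 0)\<rparr>))))))"

text \<open>The factor \<open>k log m\<close> of the asymptotic bounds, read as being at least 2.\<close>

definition klog :: "nat \<Rightarrow> nat \<Rightarrow> real" where
  "klog k m = max 2 (real k * ln (real m))"

end

theory Submission
  imports Defs "Jordan_Normal_Form.Determinant" "HOL-Analysis.Convex"
begin

text \<open>
  The algorithm only uses the column span of \<open>U\<close>.

  \<^item> First the columns of \<open>U\<close> are made well-conditioned: as long as some column is more than
    twice as long as its distance from the span of the other ones, it is replaced by the residual of
    its regression on them. Each replacement halves the product of the column norms. The columns
    change by a shear of determinant 1, so by the Leibniz formula this product cannot fall below
    its initial value by more than the factor that measures the initial conditioning. Making the
    basis triangularly conditioned beforehand bounds that factor by \<open>(3\<^sup>r r)\<^sup>r\<close>, so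
    polynomially many sweeps suffice, whatever the input.

  \<^item> Let \<open>X\<close> minimise \<open>|U X - A|\<close>, with \<open>U\<close> normalised. By the Hahn-Banach
    theorem there are functionals of norm at most 2 that are dual to the columns of \<open>U\<close>; applied
    to a rank \<open>k\<close> approximation of \<open>A\<close> they turn it into a rank \<open>k\<close> approximation of
    \<open>X\<close> that is separated row by row. Hence every subspace of \<open>\<real>\<^sup>r\<close> of dimension above
    \<open>k\<close> contains a vector \<open>y\<close> with maximal entry 1 for which \<open>|y X|\<close> is small, and
    such a vector is found by \<open>r\<close> regressions, one for each possible position of that entry.

  \<^item> Projecting away \<open>r - k\<close> successively orthogonal directions of this kind leaves an orthogonal
    projection \<open>P\<close> of trace \<open>k\<close> with \<open>U P X\<close> close to \<open>A\<close>. Peeling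
    rank one projections off \<open>P\<close> factors \<open>U P\<close> through \<open>\<real>\<^sup>k\<close>; the trace counts the
    factors. A last regression gives \<open>Z\<close>.
\<close>

section \<open>The entrywise norm and extension of functionals\<close>

text \<open>The obstacle is that neither the number of steps nor the approximation factor may depend
  on the conditioning of the input, while the machine has only field operations and comparisons.
  Hence p-norms are available only as optimal values of regressions, and orthonormal bases, which
  would need square roots, are replaced by projection matrices. Volume alone would bound the sweeps
  by the initial conditioning, hence the triangular pass before them. Asking for some entry of a
  direction to be 1 is an affine condition once its position is fixed, whereas a unit norm would not
  be convex. The loss comes from a factor 2 for the functionals, a factor r for summing over the
  entries of a direction, and a factor r for the rank one correction. Over r - k deflations the
  error becomes \<eta> + (r - k) 2 r^2 (\<eta> + \<delta>), where \<eta> bounds the error of the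
  given approximation; this is (k log m)^4 \<delta> up to a constant, with an exponent that does not
  grow with p. Vectors and matrices are total functions read below their dimensions, like the arrays
  of the machine, so programs and estimates share one representation.\<close>

definition vnorm :: "real \<Rightarrow> 'a set \<Rightarrow> ('a \<Rightarrow> real) \<Rightarrow> real" where
  "vnorm p I f = (\<Sum>i\<in>I. \<bar>f i\<bar> powr p) powr (1 / p)"

text \<open>At a zero argument this reduces to \<open>t powr p\<close> \<le> \<open>t\<close> for t
  in [0, 1]; elsewhere it is the convexity of \<open>powr\<close> on the positive reals.\<close>

lemma powr_convex_nonneg:
  fixes a b l p :: real
  assumes p: "p \<ge> 1" and "a \<ge> 0" "b \<ge> 0" "0 \<le> l" "l \<le> 1"
  shows "(l * a + (1 - l) * b) powr p \<le> l * a powr p + (1 - l) * b powr p"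
proof -
  have shrink: "(t * x) powr p \<le> t * x powr p" if "0 \<le> t" "t \<le> 1" "x \<ge> 0" for t x :: real
  proof (cases "t = 0")
    case False
    then have "t powr p \<le> t powr 1"
      using that p by (intro powr_mono') auto
    then show ?thesis
      using that False by (simp add: powr_mult mult_right_mono)
  qed (use p in simp)
  show ?thesis
  proof (cases "a = 0 \<or> b = 0")
    case True
    then show ?thesis using shrink[of l a] shrink[of "1 - l" b] assms by auto
  next
    case False
    then show ?thesis
      using convex_onD[OF powr_convex[OF p], of "1 - l" a b] assms by auto
  qed
qed

lemma vnorm_nonneg [simp]: "0 \<le> vnorm p I f"
  by (simp add: vnorm_def)

lemma vnorm_cong: "(\<And>i. i \<in> I \<Longrightarrow> \<bar>f i\<bar> = \<bar>g i\<bar>) \<Longrightarrow> vnorm p I f = vnorm p I g"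
  by (simp add: vnorm_def cong: sum.cong)

lemma vnorm_minus: "vnorm p I (\<lambda>i. - f i) = vnorm p I f"
  by (rule vnorm_cong) simp

context
  fixes p :: real
  assumes p: "1 \<le> p"
begin

lemma vnorm_powr: "vnorm p I f powr p = (\<Sum>i\<in>I. \<bar>f i\<bar> powr p)"
  using p by (simp add: vnorm_def powr_powr sum_nonneg)

lemma vnorm_leI:
  assumes "(\<Sum>i\<in>I. \<bar>f i\<bar> powr p) \<le> c powr p" "0 \<le> c"
  shows "vnorm p I f \<le> c"
proof -
  have "vnorm p I f \<le> (c powr p) powr (1 / p)"
    unfolding vnorm_def using assms p by (intro powr_mono2) (auto simp: sum_nonneg)
  then show ?thesis using assms p by (simp add: powr_powr)
qed

lemma vnorm_cmult: "vnorm p I (\<lambda>i. c * f i) = \<bar>c\<bar> * vnorm p I f"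
proof -
  have "(\<Sum>i\<in>I. \<bar>c * f i\<bar> powr p) = \<bar>c\<bar> powr p * (\<Sum>i\<in>I. \<bar>f i\<bar> powr p)"
    by (simp add: abs_mult powr_mult sum_distrib_left)
  then show ?thesis
    using p by (simp add: vnorm_def powr_mult sum_nonneg powr_powr)
qed

lemma vnorm_mono:
  assumes "\<And>i. i \<in> I \<Longrightarrow> \<bar>f i\<bar> \<le> \<bar>g i\<bar>"
  shows "vnorm p I f \<le> vnorm p I g"
  using p assms by (auto simp: vnorm_powr intro!: vnorm_leI sum_mono powr_mono2)

lemma vnorm_zero [simp]: "vnorm p I (\<lambda>i. 0) = 0"
  using p by (simp add: vnorm_def)

lemma abs_le_vnorm:
  assumes "finite I" "i \<in> I"
  shows "\<bar>f i\<bar> \<le> vnorm p I f"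
proof -
  have "\<bar>f i\<bar> powr p \<le> vnorm p I f powr p"
    unfolding vnorm_powr using assms by (intro member_le_sum) auto
  then show ?thesis
    using powr_less_mono2[of p "vnorm p I f" "\<bar>f i\<bar>"] p by fastforce
qed

lemma vnorm_eq_0D: "vnorm p I f = 0 \<Longrightarrow> finite I \<Longrightarrow> i \<in> I \<Longrightarrow> f i = 0"
  using abs_le_vnorm[of I i f] by simp

text \<open>Minkowski's inequality: |f i| + |g i| is \<open>F + G\<close> times the convex
  combination, with weight \<open>F / (F + G)\<close>, of the entries normalised by \<open>F\<close>
  and \<open>G\<close>, whose p-th powers sum to 1. Zero norms and infinite index sets, where sums
  are 0, are treated apart.\<close>

lemma vnorm_triangle: "vnorm p I (\<lambda>i. f i + g i) \<le> vnorm p I f + vnorm p I g"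
proof (cases "finite I \<and> vnorm p I f \<noteq> 0 \<and> vnorm p I g \<noteq> 0")
  case False
  then consider "infinite I" | "finite I" "vnorm p I f = 0" | "finite I" "vnorm p I g = 0"
    by blast
  then show ?thesis
  proof cases
    case 1
    then show ?thesis using p by (simp add: vnorm_def)
  next
    case 2
    then have "vnorm p I (\<lambda>i. f i + g i) = vnorm p I g"
      using vnorm_eq_0D[of I f] by (intro vnorm_cong) simp
    then show ?thesis by simp
  next
    case 3
    then have "vnorm p I (\<lambda>i. f i + g i) = vnorm p I f"
      using vnorm_eq_0D[of I g] by (intro vnorm_cong) simp
    then show ?thesis by simp
  qed
next
  case True
  define F G where "F = vnorm p I f" and "G = vnorm p I g"
  have pos: "F > 0" "G > 0"
    using True vnorm_nonneg[of p I f] vnorm_nonneg[of p I g] by (simp_all add: F_def G_def less_le)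
  define l where "l = F / (F + G)"
  have l: "0 \<le> l" "l \<le> 1" and l1: "1 - l = G / (F + G)"
    using pos by (auto simp: l_def field_simps)
  have 1: "(\<Sum>i\<in>I. (\<bar>f i\<bar> / F) powr p) = 1" "(\<Sum>i\<in>I. (\<bar>g i\<bar> / G) powr p) = 1"
    using vnorm_powr[of I f, symmetric] vnorm_powr[of I g, symmetric] pos
    by (simp_all add: powr_divide sum_divide_distrib[symmetric] F_def[symmetric] G_def[symmetric])
  have "\<bar>f i + g i\<bar> powr p \<le> (F + G) powr p * (l * (\<bar>f i\<bar> / F) powr p + (1 - l) * (\<bar>g i\<bar> / G) powr p)"
    for i
  proof -
    have "\<bar>f i + g i\<bar> powr p \<le> (\<bar>f i\<bar> + \<bar>g i\<bar>) powr p"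
      using p by (intro powr_mono2) auto
    also have "\<bar>f i\<bar> + \<bar>g i\<bar> = (F + G) * (l * (\<bar>f i\<bar> / F) + (1 - l) * (\<bar>g i\<bar> / G))"
    proof -
      have "l * (\<bar>f i\<bar> / F) = \<bar>f i\<bar> / (F + G)" "(1 - l) * (\<bar>g i\<bar> / G) = \<bar>g i\<bar> / (F + G)"
        unfolding l1 using pos by (simp_all add: l_def)
      then show ?thesis using pos by (simp add: add_divide_distrib[symmetric])
    qed
    also have "\<dots> powr p = (F + G) powr p * (l * (\<bar>f i\<bar> / F) + (1 - l) * (\<bar>g i\<bar> / G)) powr p"
      using pos l by (simp add: powr_mult)
    also have "\<dots> \<le> (F + G) powr p * (l * (\<bar>f i\<bar> / F) powr p + (1 - l) * (\<bar>g i\<bar> / G) powr p)"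
      using pos l p by (intro mult_left_mono powr_convex_nonneg) auto
    finally show ?thesis .
  qed
  then have "(\<Sum>i\<in>I. \<bar>f i + g i\<bar> powr p)
      \<le> (\<Sum>i\<in>I. (F + G) powr p * (l * (\<bar>f i\<bar> / F) powr p + (1 - l) * (\<bar>g i\<bar> / G) powr p))"
    by (rule sum_mono)
  also have "\<dots> = (F + G) powr p"
    by (simp add: sum_distrib_left[symmetric] sum.distrib 1)
  finally show ?thesis
    using pos by (intro vnorm_leI) (auto simp: F_def G_def)
qed

lemma vnorm_triangle_diff: "vnorm p I (\<lambda>i. f i - g i) \<le> vnorm p I f + vnorm p I g"
  using vnorm_triangle[of I f "\<lambda>i. - g i"] by (simp add: vnorm_minus)

lemma vnorm_sum: "vnorm p I (\<lambda>i. \<Sum>l\<in>L. f l i) \<le> (\<Sum>l\<in>L. vnorm p I (f l))"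
proof (induction L rule: infinite_finite_induct)
  case (insert x L)
  then show ?case
    using vnorm_triangle[of I "f x" "\<lambda>i. \<Sum>l\<in>L. f l i"] by simp
qed auto

text \<open>A functional acts on the columns of an error matrix one by one; this splitting turns its
  columnwise bounds into a bound for a whole row of values.\<close>

lemma vnorm_pair: "vnorm p (I \<times> J) (\<lambda>(i, j). F i j) = vnorm p J (\<lambda>j. vnorm p I (\<lambda>i. F i j))"
proof -
  have "(\<Sum>x\<in>I \<times> J. \<bar>case x of (i, j) \<Rightarrow> F i j\<bar> powr p) = (\<Sum>i\<in>I. \<Sum>j\<in>J. \<bar>F i j\<bar> powr p)"
    unfolding sum.cartesian_product by (rule sum.cong) auto
  also have "\<dots> = (\<Sum>j\<in>J. \<Sum>i\<in>I. \<bar>F i j\<bar> powr p)"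
    by (rule sum.swap)
  finally show ?thesis
    unfolding vnorm_def[of p J] vnorm_def[of p "I \<times> J"] by (simp add: vnorm_powr)
qed

lemma vnorm_outer: "vnorm p (I \<times> J) (\<lambda>(i, j). f i * g j) = vnorm p I f * vnorm p J g"
proof -
  have "vnorm p I (\<lambda>i. f i * g j) = \<bar>g j\<bar> * vnorm p I f" for j
    using vnorm_cmult[of I "g j" f] by (simp add: mult.commute)
  then have "vnorm p (I \<times> J) (\<lambda>(i, j). f i * g j) = vnorm p J (\<lambda>j. vnorm p I f * \<bar>g j\<bar>)"
    by (simp add: vnorm_pair mult.commute)
  also have "\<dots> = vnorm p I f * vnorm p J (\<lambda>j. \<bar>g j\<bar>)"
    by (simp add: vnorm_cmult)
  also have "vnorm p J (\<lambda>j. \<bar>g j\<bar>) = vnorm p J g"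
    by (rule vnorm_cong) simp
  finally show ?thesis .
qed

end

lemma lp_norm_eq_vnorm:
  assumes "M \<in> carrier_mat a b"
  shows "lp_norm p M = vnorm p ({..<a} \<times> {..<b}) (\<lambda>(i, j). M $$ (i, j))"
  using assms by (auto simp: lp_norm_def vnorm_def sum.cartesian_product intro!: arg_cong2[where f = "(powr)"] sum.cong)

section \<open>Sublinear functionals and a Hahn-Banach theorem in finite dimension\<close>

definition sublin :: "(('a \<Rightarrow> real) \<Rightarrow> real) \<Rightarrow> bool" where
  "sublin q \<longleftrightarrow> (\<forall>x y. q (\<lambda>i. x i + y i) \<le> q x + q y) \<and> (\<forall>c\<ge>0. \<forall>x. q (\<lambda>i. c * x i) = c * q x)"

lemma sublin_add: "sublin q \<Longrightarrow> q (\<lambda>i. x i + y i) \<le> q x + q y"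
  and sublin_cmult: "sublin q \<Longrightarrow> 0 \<le> c \<Longrightarrow> q (\<lambda>i. c * x i) = c * q x"
  by (auto simp: sublin_def)

lemma sublin_zero: "sublin q \<Longrightarrow> q (\<lambda>i. 0) = 0"
  using sublin_cmult[of q 0 "\<lambda>i. 0"] by simp

lemma sublin_neg: "sublin q \<Longrightarrow> - q x \<le> q (\<lambda>i. - x i)"
  using sublin_add[of q x "\<lambda>i. - x i"] sublin_zero[of q] by simp

lemma sublin_sum:
  assumes "sublin q"
  shows "finite L \<Longrightarrow> q (\<lambda>i. \<Sum>l\<in>L. f l i) \<le> (\<Sum>l\<in>L. q (f l))"
proof (induction L rule: finite_induct)
  case (insert x L)
  then show ?case
    using sublin_add[OF assms, of "f x" "\<lambda>i. \<Sum>l\<in>L. f l i"] by simp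
qed (simp add: sublin_zero assms)

text \<open>Take \<open>q' x\<close> to be the infimum of \<open>q (x + t e) - t q e\<close> over t
  \<ge> 0. It is finite, being at least \<open>- q (- x)\<close>; t = 0 gives \<open>q'\<close>
  \<le> \<open>q\<close>, and t = 1 gives the value at -e. Bounding that value by \<open>q e\<close>
  instead of \<open>q' e\<close> also forces \<open>q' e = q e\<close>.\<close>

lemma sublin_linearise1:
  assumes q: "sublin q"
  shows "\<exists>q'. sublin q' \<and> (\<forall>x. q' x \<le> q x) \<and> q' (\<lambda>i. - e i) \<le> - q e"
proof -
  define h where "h x t = q (\<lambda>i. x i + t * e i) - t * q e" for x and t :: real
  define q' where "q' x = Inf (h x ` {0..})" for x
  have lb: "- q (\<lambda>i. - x i) \<le> h x t" if "t \<ge> 0" for x t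
  proof -
    have "q (\<lambda>i. t * e i) \<le> q (\<lambda>i. x i + t * e i) + q (\<lambda>i. - x i)"
      using sublin_add[OF q, of "\<lambda>i. x i + t * e i" "\<lambda>i. - x i"] by simp
    then show ?thesis using sublin_cmult[OF q that, of e] by (simp add: h_def)
  qed
  have bdd: "bdd_below (h x ` {0..})" for x
    using lb by (intro bdd_belowI[of _ "- q (\<lambda>i. - x i)"]) auto
  have le: "q' x \<le> h x t" if "t \<ge> 0" for x t
    unfolding q'_def using that by (intro cInf_lower bdd) auto
  have ge: "z \<le> q' x" if "\<And>t. t \<ge> 0 \<Longrightarrow> z \<le> h x t" for x z
    unfolding q'_def using that by (intro cInf_greatest) auto
  have "q' (\<lambda>i. x i + y i) \<le> q' x + q' y" for x y
  proof -
    have "q' (\<lambda>i. x i + y i) \<le> h x s + h y t" if "s \<ge> 0" "t \<ge> 0" for s t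
    proof -
      have "q (\<lambda>i. (x i + s * e i) + (y i + t * e i)) \<le> q (\<lambda>i. x i + s * e i) + q (\<lambda>i. y i + t * e i)"
        by (rule sublin_add[OF q])
      also have "(\<lambda>i. (x i + s * e i) + (y i + t * e i)) = (\<lambda>i. (x i + y i) + (s + t) * e i)"
        by (simp add: algebra_simps)
      finally have "h (\<lambda>i. x i + y i) (s + t) \<le> h x s + h y t"
        by (simp add: h_def algebra_simps)
      then show ?thesis using le[of "s + t" "\<lambda>i. x i + y i"] that by simp
    qed
    then have "q' (\<lambda>i. x i + y i) - h x s \<le> q' y" if "s \<ge> 0" for s
      using that by (intro ge) (auto simp: algebra_simps)
    then have "q' (\<lambda>i. x i + y i) - q' y \<le> q' x"
      by (intro ge) (auto simp: algebra_simps)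
    then show ?thesis by simp
  qed
  moreover have "q' (\<lambda>i. c * x i) = c * q' x" if "c \<ge> 0" for c x
  proof (cases "c = 0")
    case True
    have "q' (\<lambda>i. 0) \<le> h (\<lambda>i. 0) 0" by (rule le) simp
    then have "q' (\<lambda>i. 0) \<le> 0" by (simp add: h_def sublin_zero[OF q])
    moreover have "0 \<le> q' (\<lambda>i. 0)"
      using lb[of _ "\<lambda>i. 0"] by (intro ge) (auto simp: sublin_zero[OF q])
    ultimately show ?thesis using True by simp
  next
    case False
    with that have c: "c > 0" by simp
    have hc: "h (\<lambda>i. c * x i) (c * t) = c * h x t" for x t
      using sublin_cmult[OF q that, of "\<lambda>i. x i + t * e i"] by (simp add: h_def algebra_simps)
    have "c * q' x \<le> h (\<lambda>i. c * x i) t" if "t \<ge> 0" for t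
      using le[of "t / c" x] hc[of x "t / c"] c that by (simp add: field_simps)
    then have "c * q' x \<le> q' (\<lambda>i. c * x i)" by (rule ge)
    moreover have "q' (\<lambda>i. c * x i) / c \<le> q' x"
      using le[of "c * t" "\<lambda>i. c * x i" for t] hc c by (intro ge) (simp add: field_simps)
    ultimately show ?thesis using c by (simp add: field_simps)
  qed
  moreover have "q' x \<le> q x" for x
    using le[of 0 x] by (simp add: h_def)
  moreover have "q' (\<lambda>i. - e i) \<le> - q e"
    using le[of 1 "\<lambda>i. - e i"] by (simp add: h_def sublin_zero[OF q])
  ultimately show ?thesis unfolding sublin_def by blast
qed

text \<open>Directions can be treated one after the other: oddness along e survives the passage to a
  smaller sublinear functional, which lowers the value at -e and raises the bound.\<close>

lemma sublin_linearise:
  assumes "sublin q"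
  shows "\<exists>q'. sublin q' \<and> (\<forall>x. q' x \<le> q x) \<and> (\<forall>e\<in>set es. q' (\<lambda>i. - e i) \<le> - q' e)"
  using assms
proof (induction es arbitrary: q)
  case Nil
  then show ?case by auto
next
  case (Cons e es)
  obtain q1 where q1: "sublin q1" "\<And>x. q1 x \<le> q x" "q1 (\<lambda>i. - e i) \<le> - q e"
    using sublin_linearise1[OF Cons.prems] by blast
  obtain q2 where q2: "sublin q2" "\<And>x. q2 x \<le> q1 x" "\<forall>e\<in>set es. q2 (\<lambda>i. - e i) \<le> - q2 e"
    using Cons.IH[OF q1(1)] by blast
  have "q2 (\<lambda>i. - e i) \<le> - q2 e"
    using q1(2)[of e] q1(3) q2(2)[of e] q2(2)[of "\<lambda>i. - e i"] by linarith
  then show ?case using q1 q2 by (intro exI[of _ q2]) (auto intro: order_trans)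
qed

text \<open>Linearising along u first fixes the value there, and later decreases at -u only help. A
  sublinear functional that is odd along the n unit vectors is linear on their span, so finitely
  many linearisations suffice.\<close>

theorem hahn_banach_finite:
  fixes q :: "(nat \<Rightarrow> real) \<Rightarrow> real"
  assumes q: "sublin q" and u: "\<And>i. i \<ge> n \<Longrightarrow> u i = 0"
  shows "\<exists>\<phi>. (\<forall>x. (\<forall>i\<ge>n. x i = 0) \<longrightarrow> (\<Sum>i<n. \<phi> i * x i) \<le> q x) \<and> (\<Sum>i<n. \<phi> i * u i) \<ge> q u"
proof -
  define e :: "nat \<Rightarrow> nat \<Rightarrow> real" where "e a i = (if i = a then 1 else 0)" for a i
  obtain q0 where q0: "sublin q0" "\<And>x. q0 x \<le> q x" "q0 (\<lambda>i. - u i) \<le> - q u"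
    using sublin_linearise1[OF q] by blast
  obtain q1 where q1: "sublin q1" "\<And>x. q1 x \<le> q0 x"
      "\<forall>e\<in>set (map e [0..<n]). q1 (\<lambda>i. - e i) \<le> - q1 e"
    using sublin_linearise[OF q0(1)] by blast
  have neg: "q1 (\<lambda>i. - e a i) = - q1 (e a)" if "a < n" for a
  proof -
    have "e a \<in> set (map e [0..<n])" using that by simp
    then show ?thesis using bspec[OF q1(3)] sublin_neg[OF q1(1), of "e a"] by fastforce
  qed
  have cm: "q1 (\<lambda>i. c * e a i) = c * q1 (e a)" if "a < n" for a c
  proof (cases "c \<ge> 0")
    case False
    then have "q1 (\<lambda>i. (- c) * (- e a i)) = (- c) * q1 (\<lambda>i. - e a i)"
      by (intro sublin_cmult[OF q1(1)]) simp
    then show ?thesis using neg[OF that] by simp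
  qed (use sublin_cmult[OF q1(1)] in simp)
  \<comment> \<open>Subadditivity bounds \<open>q1 x\<close> by the linear form from above; applied
    to -x it gives the direction needed here.\<close>
  have main: "(\<Sum>i<n. q1 (e i) * x i) \<le> q1 x" if x: "\<forall>i\<ge>n. x i = 0" for x
  proof -
    have "(\<Sum>l<n. - x l * e l i) = - x i" for i
    proof (cases "i < n")
      case True
      then have "(\<Sum>l<n. - x l * e l i) = (\<Sum>l<n. if l = i then - x l else 0)"
        by (intro sum.cong) (auto simp: e_def)
      then show ?thesis using True by simp
    next
      case False
      then show ?thesis using x by (auto simp: e_def intro!: sum.neutral)
    qed
    then have "q1 (\<lambda>i. - x i) = q1 (\<lambda>i. \<Sum>l<n. - x l * e l i)" by simp
    also have "\<dots> \<le> (\<Sum>l<n. q1 (\<lambda>i. - x l * e l i))"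
      by (rule sublin_sum[OF q1(1)]) simp
    also have "\<dots> = - (\<Sum>l<n. q1 (e l) * x l)"
      using cm[of _ "- x _"] by (simp add: sum_negf[symmetric] mult.commute)
    finally show ?thesis using sublin_neg[OF q1(1), of x] by linarith
  qed
  have "(\<Sum>i<n. q1 (e i) * - u i) \<le> q1 (\<lambda>i. - u i)"
    by (rule main) (simp add: u)
  then have "(\<Sum>i<n. q1 (e i) * u i) \<ge> q u"
    using q1(2)[of "\<lambda>i. - u i"] q0(3) by (simp add: sum_negf)
  then show ?thesis using main q1(2) q0(2)
    by (intro exI[of _ "\<lambda>i. q1 (e i)"]) (blast intro: order_trans)
qed

section \<open>Well-conditioned columns\<close>

definition resid :: "nat \<Rightarrow> nat \<Rightarrow> (nat \<Rightarrow> nat \<Rightarrow> real) \<Rightarrow> (nat \<Rightarrow> real) \<Rightarrow> nat \<Rightarrow> real" where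
  "resid c i U x a = U a i - (\<Sum>j\<in>{..<c} - {i}. x j * U a j)"

abbreviation colnorm :: "real \<Rightarrow> nat \<Rightarrow> (nat \<Rightarrow> nat \<Rightarrow> real) \<Rightarrow> nat \<Rightarrow> real" where
  "colnorm p n U i \<equiv> vnorm p {..<n} (\<lambda>a. U a i)"

text \<open>
  The factor 2 is the slack that makes every replacement of a column halve its norm; for \<open>c = i\<close>
  only the preceding columns count.
\<close>

definition separated :: "real \<Rightarrow> nat \<Rightarrow> nat \<Rightarrow> nat \<Rightarrow> (nat \<Rightarrow> nat \<Rightarrow> real) \<Rightarrow> bool" where
  "separated p n c i U \<longleftrightarrow> (\<forall>x. colnorm p n U i \<le> 2 * vnorm p {..<n} (resid c i U x))"

text \<open>A relation, not a function, because the residual depends on which minimiser the solver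
  returns.\<close>

definition shrunk :: "real \<Rightarrow> nat \<Rightarrow> nat \<Rightarrow> nat \<Rightarrow> (nat \<Rightarrow> nat \<Rightarrow> real) \<Rightarrow> (nat \<Rightarrow> nat \<Rightarrow> real) \<Rightarrow> bool" where
  "shrunk p n c i U U' \<longleftrightarrow> (U' = U \<and> separated p n c i U) \<or>
     (\<exists>x. U' = (\<lambda>a j. if a < n \<and> j = i then resid c i U x a else U a j) \<and>
        separated p n c i U' \<and> 2 * colnorm p n U' i < colnorm p n U i)"

text \<open>Preserving this inclusion keeps the given approximation expressible in every later
  basis, so regression on that basis is at least as good.\<close>

definition cols_in_span :: "nat \<Rightarrow> nat \<Rightarrow> (nat \<Rightarrow> nat \<Rightarrow> real) \<Rightarrow> (nat \<Rightarrow> nat \<Rightarrow> real) \<Rightarrow> bool" where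
  "cols_in_span n r A U \<longleftrightarrow> (\<forall>x. \<exists>z. \<forall>a<n. (\<Sum>j<r. A a j * x j) = (\<Sum>j<r. U a j * z j))"

lemma cols_in_span_refl: "cols_in_span n r A A"
  unfolding cols_in_span_def by blast

lemma cols_in_span_trans: "cols_in_span n r A B \<Longrightarrow> cols_in_span n r B C \<Longrightarrow> cols_in_span n r A C"
  unfolding cols_in_span_def by metis

lemma resid_split:
  assumes "i < r" "c \<le> r"
  shows "resid c i U x a = U a i - (\<Sum>j<r. (if j < c \<and> j \<noteq> i then x j else 0) * U a j)"
proof -
  have "(\<Sum>j<r. (if j < c \<and> j \<noteq> i then x j else 0) * U a j) = (\<Sum>j\<in>{..<c} - {i}. x j * U a j)"
    using assms by (intro sum.mono_neutral_cong_right) auto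
  then show ?thesis by (simp add: resid_def)
qed

lemma shrunk_cols_in_span:
  assumes "shrunk p n c i U U'" "i < r" "c \<le> r"
  shows "cols_in_span n r U U'"
  using assms(1) unfolding shrunk_def
proof (elim disjE exE conjE)
  fix x assume U': "U' = (\<lambda>a j. if a < n \<and> j = i then resid c i U x a else U a j)"
  \<comment> \<open>The subtracted coefficients, extended by 0 to all columns including i; adding
    them back recovers the old column.\<close>
  define x' where "x' j = (if j < c \<and> j \<noteq> i then x j else 0)" for j
  show ?thesis
    unfolding cols_in_span_def
  proof (intro allI exI impI)
    fix y and a assume "a < n"
    have "(\<Sum>j<r. U a j * y j) = (\<Sum>j<r. U' a j * y j) + (U a i - resid c i U x a) * y i"
    proof -
      have "(\<Sum>j<r. U a j * y j) - (\<Sum>j<r. U' a j * y j) = (\<Sum>j<r. if j = i then (U a i - resid c i U x a) * y i else 0)"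
        unfolding sum_subtractf[symmetric] using \<open>a < n\<close> by (intro sum.cong) (auto simp: U' algebra_simps)
      then show ?thesis using assms by simp
    qed
    also have "(U a i - resid c i U x a) * y i = (\<Sum>j<r. U' a j * (x' j * y i))"
    proof -
      have "(U a i - resid c i U x a) * y i = (\<Sum>j<r. x' j * U a j) * y i"
        unfolding resid_split[OF assms(2,3)] by (simp add: x'_def)
      also have "\<dots> = (\<Sum>j<r. U' a j * (x' j * y i))"
        unfolding sum_distrib_right by (rule sum.cong) (auto simp: U' x'_def)
      finally show ?thesis .
    qed
    finally show "(\<Sum>j<r. U a j * y j) = (\<Sum>j<r. U' a j * (y j + x' j * y i))"
      by (simp add: algebra_simps sum.distrib)
  qed
qed (simp add: cols_in_span_refl)

lemma separated_cong:
  assumes "\<And>a j. a < n \<Longrightarrow> j < c \<or> j = i \<Longrightarrow> U' a j = U a j"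
  shows "separated p n c i U' = separated p n c i U"
proof -
  have "colnorm p n U' i = colnorm p n U i"
    using assms by (intro vnorm_cong) auto
  moreover have "vnorm p {..<n} (resid c i U' x) = vnorm p {..<n} (resid c i U x)" for x
  proof (rule vnorm_cong)
    fix a assume "a \<in> {..<n}"
    then have "resid c i U' x a = resid c i U x a"
      unfolding resid_def using assms by (intro arg_cong2[where f = "(-)"] sum.cong) auto
    then show "\<bar>resid c i U' x a\<bar> = \<bar>resid c i U x a\<bar>" by simp
  qed
  ultimately show ?thesis by (simp add: separated_def)
qed

text \<open>The condition at i' involves only the columns up to i', so a pass from left to right
  never spoils what it has achieved, and a single pass suffices.\<close>

lemma shrunk_triangular:
  assumes "shrunk p n i i U U'" "\<And>i'. i' < i \<Longrightarrow> separated p n i' i' U" "i' \<le> i"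
  shows "separated p n i' i' U'"
proof (cases "i' = i")
  case True
  then show ?thesis using assms(1) by (auto simp: shrunk_def)
next
  case False
  then have "separated p n i' i' U' = separated p n i' i' U"
    using assms(1,3) by (intro separated_cong) (auto simp: shrunk_def)
  then show ?thesis using assms(2,3) False by simp
qed

context
  fixes p :: real
  assumes p: "1 \<le> p"
begin

text \<open>Divided by \<open>x i\<close>, the combination is a residual of column i. The index set
  covers both uses: all columns for c = r, a prefix for c = i.\<close>

lemma separated_coeff_bound:
  assumes "separated p n c i U"
  shows "\<bar>x i\<bar> * colnorm p n U i \<le> 2 * vnorm p {..<n} (\<lambda>a. \<Sum>j\<in>insert i {..<c}. x j * U a j)"
proof (cases "x i = 0")
  case False
  have "\<bar>x i\<bar> * colnorm p n U i \<le> \<bar>x i\<bar> * (2 * vnorm p {..<n} (resid c i U (\<lambda>j. - x j / x i)))"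
    using assms unfolding separated_def by (intro mult_left_mono) auto
  also have "\<dots> = 2 * vnorm p {..<n} (\<lambda>a. x i * resid c i U (\<lambda>j. - x j / x i) a)"
    by (simp add: vnorm_cmult[OF p])
  also have "(\<lambda>a. x i * resid c i U (\<lambda>j. - x j / x i) a) = (\<lambda>a. \<Sum>j\<in>insert i {..<c}. x j * U a j)"
    (is "?l = ?r")
  proof
    fix a
    have "?r a = x i * U a i + (\<Sum>j\<in>{..<c} - {i}. x j * U a j)"
      by (subst sum.insert_remove) auto
    then show "?l a = ?r a"
      using False by (simp add: resid_def algebra_simps sum_negf sum_distrib_left)
  qed
  finally show ?thesis .
qed simp

text \<open>By the bound on the last coefficient, removing the last column of a prefix at most
  triples the norm of the combination, so descending from r columns to \<open>Suc i\<close> costs a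
  power of 3.\<close>

lemma triangular_coeff_bound:
  assumes "\<And>i. i < r \<Longrightarrow> separated p n i i U" "i < r"
  shows "\<bar>x i\<bar> * colnorm p n U i \<le> 3 ^ r * vnorm p {..<n} (\<lambda>a. \<Sum>j<r. x j * U a j)"
proof -
  define S where "S c = vnorm p {..<n} (\<lambda>a. \<Sum>j<c. x j * U a j)" for c
  have coeff: "\<bar>x i\<bar> * colnorm p n U i \<le> 2 * S (Suc i)" if "i < r" for i
    using separated_coeff_bound[OF assms(1)[OF that], of x] by (simp add: S_def lessThan_Suc)
  have step: "S i \<le> 3 * S (Suc i)" if "i < r" for i
  proof -
    have "S i = vnorm p {..<n} (\<lambda>a. (\<Sum>j<Suc i. x j * U a j) - x i * U a i)"
      by (simp add: S_def)
    also have "\<dots> \<le> S (Suc i) + vnorm p {..<n} (\<lambda>a. x i * U a i)"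
      unfolding S_def by (rule vnorm_triangle_diff[OF p])
    also have "\<dots> \<le> 3 * S (Suc i)"
      using coeff[OF that] by (simp add: vnorm_cmult[OF p])
    finally show ?thesis .
  qed
  have "S (r - d) \<le> 3 ^ d * S r" if "d \<le> r" for d
    using that
  proof (induction d)
    case (Suc d)
    then have "S (r - Suc d) \<le> 3 * S (r - d)"
      using step[of "r - Suc d"] by (simp add: Suc_diff_Suc)
    then show ?case using Suc by simp
  qed simp
  from this[of "r - Suc i"] have "S (Suc i) \<le> 3 ^ (r - Suc i) * S r"
    using assms(2) by simp
  then have "2 * S (Suc i) \<le> 2 * (3 ^ (r - Suc i) * S r)"
    by (rule mult_left_mono) simp
  also have "\<dots> \<le> 3 * (3 ^ (r - Suc i) * S r)"
    by (rule mult_right_mono) (auto simp: S_def)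
  finally have "\<bar>x i\<bar> * colnorm p n U i \<le> 3 ^ Suc (r - Suc i) * S r"
    using coeff[OF assms(2)] by simp
  also have "\<dots> \<le> 3 ^ r * S r"
    using assms(2) by (intro mult_right_mono power_increasing) (auto simp: S_def)
  finally show ?thesis by (simp add: S_def)
qed

text \<open>The distance to the span of the other columns is sublinear. A linear form below it
  vanishes on that span, and one that attains it at column i has there, by separation, a value
  \<open>D\<close> of at least half the norm of the column. Division by \<open>D\<close> gives the
  dual functional.\<close>

lemma dual_functional:
  assumes separated: "separated p n r i U" and nz: "colnorm p n U i \<noteq> 0" and i: "i < r"
  shows "\<exists>\<phi>. (\<forall>j<r. (\<Sum>a<n. \<phi> a * U a j) = (if j = i then 1 else 0)) \<and>
     (\<forall>f. \<bar>\<Sum>a<n. \<phi> a * f a\<bar> * colnorm p n U i \<le> 2 * vnorm p {..<n} f)"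
proof -
  define J where "J = {..<r} - {i}"
  define d where "d f x = vnorm p {..<n} (\<lambda>a. f a - (\<Sum>j\<in>J. x j * U a j))" for f :: "nat \<Rightarrow> real" and x
  define q where "q f = Inf (range (d f))" for f
  have le: "q f \<le> d f x" for f x
    unfolding q_def by (intro cInf_lower bdd_belowI[of _ 0]) (auto simp: d_def)
  have ge: "z \<le> q f" if "\<And>x. z \<le> d f x" for z f
    unfolding q_def using that by (intro cInf_greatest) auto
  have "q (\<lambda>a. f a + g a) \<le> q f + q g" for f g
  proof -
    have "q (\<lambda>a. f a + g a) \<le> d f x + d g y" for x y
    proof -
      have "d (\<lambda>a. f a + g a) (\<lambda>j. x j + y j) \<le> d f x + d g y"
        using vnorm_triangle[OF p, of "{..<n}" "\<lambda>a. f a - (\<Sum>j\<in>J. x j * U a j)" "\<lambda>a. g a - (\<Sum>j\<in>J. y j * U a j)"]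
        by (simp add: d_def algebra_simps sum.distrib)
      then show ?thesis using le[of "\<lambda>a. f a + g a" "\<lambda>j. x j + y j"] by simp
    qed
    then have "q (\<lambda>a. f a + g a) - d f x \<le> q g" for x
      by (intro ge) (simp add: algebra_simps)
    then have "q (\<lambda>a. f a + g a) - q g \<le> q f"
      by (intro ge) (simp add: algebra_simps)
    then show ?thesis by simp
  qed
  moreover have "q (\<lambda>a. c * f a) = c * q f" if "c \<ge> 0" for c f
  proof -
    have dc: "d (\<lambda>a. c * f a) (\<lambda>j. c * x j) = c * d f x" for x
      using vnorm_cmult[OF p, of "{..<n}" c "\<lambda>a. f a - (\<Sum>j\<in>J. x j * U a j)"] that
      by (simp add: d_def algebra_simps sum_distrib_left)
    show ?thesis
    proof (cases "c = 0")
      case True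
      have "q (\<lambda>a. 0) \<le> 0" using le[of "\<lambda>a. 0" "\<lambda>j. 0"] by (simp add: d_def vnorm_zero[OF p])
      moreover have "0 \<le> q (\<lambda>a. 0)" by (rule ge) (simp add: d_def)
      ultimately show ?thesis using True by simp
    next
      case False
      with that have c: "c > 0" by simp
      have "c * q f \<le> q (\<lambda>a. c * f a)"
      proof (rule ge)
        fix x
        show "c * q f \<le> d (\<lambda>a. c * f a) x"
          using le[of f "\<lambda>j. x j / c"] dc[of "\<lambda>j. x j / c"] c by (simp add: field_simps)
      qed
      moreover have "q (\<lambda>a. c * f a) / c \<le> q f"
      proof (rule ge)
        fix x
        show "q (\<lambda>a. c * f a) / c \<le> d f x"
          using le[of "\<lambda>a. c * f a" "\<lambda>j. c * x j"] c by (simp add: dc field_simps)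
      qed
      ultimately show ?thesis using c by (simp add: field_simps)
    qed
  qed
  ultimately have sub: "sublin q" by (simp add: sublin_def)
  \<comment> \<open>Hahn-Banach is stated for functions supported below n; the distance does not see
    the entries beyond.\<close>
  define u where "u j a = (if a < n then U a j else 0)" for j a
  obtain \<phi> where \<phi>: "\<And>x. (\<forall>i\<ge>n. x i = 0) \<Longrightarrow> (\<Sum>a<n. \<phi> a * x a) \<le> q x"
      "(\<Sum>a<n. \<phi> a * u i a) \<ge> q (u i)"
    using hahn_banach_finite[OF sub, of n "u i"] by (auto simp: u_def)
  define D where "D = (\<Sum>a<n. \<phi> a * U a i)"
  have bound: "(\<Sum>a<n. \<phi> a * f a) \<le> d f x" for f x
  proof -
    define f' where "f' a = (if a < n then f a else 0)" for a
    have "(\<Sum>a<n. \<phi> a * f a) = (\<Sum>a<n. \<phi> a * f' a)"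
      by (intro sum.cong) (auto simp: f'_def)
    also have "\<dots> \<le> q f'" by (rule \<phi>(1)) (simp add: f'_def)
    also have "\<dots> \<le> d f' x" by (rule le)
    also have "\<dots> = d f x" unfolding d_def by (intro vnorm_cong) (auto simp: f'_def)
    finally show ?thesis .
  qed
  have bound0: "(\<Sum>a<n. \<phi> a * f a) \<le> vnorm p {..<n} f" for f
    using bound[of f "\<lambda>j. 0"] by (simp add: d_def)
  have abs_bound: "\<bar>\<Sum>a<n. \<phi> a * f a\<bar> \<le> vnorm p {..<n} f" for f
    using bound0[of f] bound0[of "\<lambda>a. - f a"] by (simp add: sum_negf vnorm_minus)
  have D: "2 * D \<ge> colnorm p n U i"
  proof -
    have "colnorm p n U i / 2 \<le> q (u i)"
    proof (rule ge)
      fix x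
      have "vnorm p {..<n} (resid r i U x) = d (u i) x"
        unfolding d_def by (rule vnorm_cong) (auto simp: resid_def J_def u_def)
      then show "colnorm p n U i / 2 \<le> d (u i) x"
        using separated[unfolded separated_def, rule_format, of x] by simp
    qed
    also have "q (u i) \<le> D"
      using \<phi>(2) by (simp add: D_def u_def)
    finally show ?thesis by simp
  qed
  have Dpos: "D > 0"
    using D nz vnorm_nonneg[of p "{..<n}" "\<lambda>a. U a i"] by linarith
  have orth: "(\<Sum>a<n. \<phi> a * U a j) = 0" if "j < r" "j \<noteq> i" for j
  proof -
    have *: "(\<Sum>l\<in>J. (if l = j then c else 0) * U a l) = c * U a j" for c a
    proof -
      have "(\<Sum>l\<in>J. (if l = j then c else 0) * U a l) = (\<Sum>l\<in>J. if l = j then c * U a l else 0)"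
        by (rule sum.cong) auto
      then show ?thesis using that by (simp add: J_def)
    qed
    \<comment> \<open>Column j and its negative both have distance 0, which bounds the form from
      both sides.\<close>
    have "d (\<lambda>a. c * U a j) (\<lambda>l. if l = j then c else 0) = 0" for c
      unfolding d_def * by (simp add: vnorm_zero[OF p])
    from bound[of "\<lambda>a. U a j" "\<lambda>l. if l = j then 1 else 0"] this[of 1]
      bound[of "\<lambda>a. - U a j" "\<lambda>l. if l = j then -1 else 0"] this[of "-1"]
    show ?thesis by (simp add: sum_negf)
  qed
  show ?thesis
  proof (intro exI[of _ "\<lambda>a. \<phi> a / D"] conjI allI impI)
    fix j assume "j < r"
    then show "(\<Sum>a<n. \<phi> a / D * U a j) = (if j = i then 1 else 0)"
      using orth[of j] Dpos by (auto simp: sum_divide_distrib[symmetric] D_def)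
  next
    fix f
    have "\<bar>\<Sum>a<n. \<phi> a / D * f a\<bar> * colnorm p n U i = \<bar>\<Sum>a<n. \<phi> a * f a\<bar> * (colnorm p n U i / D)"
      using Dpos by (simp add: sum_divide_distrib[symmetric])
    also have "\<dots> \<le> vnorm p {..<n} f * 2"
    proof (rule mult_mono[OF abs_bound])
      show "colnorm p n U i / D \<le> 2" using D Dpos by (simp add: field_simps)
    qed (use Dpos in auto)
    finally show "\<bar>\<Sum>a<n. \<phi> a / D * f a\<bar> * colnorm p n U i \<le> 2 * vnorm p {..<n} f"
      by simp
  qed
qed

end

section \<open>Determinants, and the volume argument that bounds the number of sweeps\<close>

lemma abs_det_le_prod_col_sums:
  fixes A :: "real mat"
  assumes A: "A \<in> carrier_mat r r"
  shows "\<bar>det A\<bar> \<le> (\<Prod>i<r. \<Sum>j<r. \<bar>A $$ (j, i)\<bar>)"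
proof -
  let ?P = "{q. q permutes {0..<r}}"
  let ?f = "\<lambda>q. \<Prod>i<r. \<bar>A $$ (q i, i)\<bar>"
  have "\<bar>det A\<bar> \<le> (\<Sum>q\<in>?P. \<bar>signof q * (\<Prod>i<r. A $$ (q i, i))\<bar>)"
    unfolding det_col[OF A] by (rule sum_abs)
  also have "\<dots> = (\<Sum>q\<in>?P. ?f q)"
    by (intro sum.cong) (auto simp: abs_mult abs_prod sign_def)
  \<comment> \<open>Restriction makes the permutations extensional functions. It is injective
    because a permutation is the identity outside its set.\<close>
  also have "\<dots> = (\<Sum>g\<in>(\<lambda>q. restrict q {..<r}) ` ?P. ?f g)"
  proof (subst sum.reindex)
    show "inj_on (\<lambda>q. restrict q {..<r}) ?P"
    proof (rule inj_onI, rule ext)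
      fix q q' x assume q: "q \<in> ?P" "q' \<in> ?P" and "restrict q {..<r} = restrict q' {..<r}"
      then have "restrict q {..<r} x = restrict q' {..<r} x" by simp
      then show "q x = q' x"
        using q by (cases "x < r") (auto simp: permutes_def)
    qed
  qed (auto intro!: sum.cong prod.cong)
  \<comment> \<open>Enlarging the sum from permutations to all self-maps makes it factor into column
    sums.\<close>
  also have "\<dots> \<le> (\<Sum>g\<in>{..<r} \<rightarrow>\<^sub>E {..<r}. ?f g)"
  proof (rule sum_mono2)
    show "(\<lambda>q. restrict q {..<r}) ` ?P \<subseteq> {..<r} \<rightarrow>\<^sub>E {..<r}"
    proof
      fix g assume "g \<in> (\<lambda>q. restrict q {..<r}) ` ?P"
      then obtain q where "q permutes {0..<r}" and g: "g = restrict q {..<r}" by auto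
      then have "q i < r" if "i < r" for i using permutes_in_image[of q "{0..<r}" i] that by simp
      then show "g \<in> {..<r} \<rightarrow>\<^sub>E {..<r}" unfolding g by auto
    qed
  qed (auto intro: finite_PiE prod_nonneg)
  also have "\<dots> = (\<Prod>i<r. \<Sum>j<r. \<bar>A $$ (j, i)\<bar>)"
    by (subst prod_sum_PiE) auto
  finally show ?thesis .
qed

text \<open>A chain of \<open>addcol\<close> operations, one per induction step; the step c = i
  subtracts nothing.\<close>

lemma det_shear:
  fixes T :: "nat \<Rightarrow> nat \<Rightarrow> real"
  assumes i: "i < r" and c: "c \<le> r"
  shows "det (mat r r (\<lambda>(j, k). if k = i then T j i - (\<Sum>l\<in>{..<c} - {i}. x l * T j l) else T j k))
       = det (mat r r (\<lambda>(j, k). T j k))"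
  using c
proof (induction c)
  case 0
  have "mat r r (\<lambda>(j, k). if k = i then T j i - (\<Sum>l\<in>{..<0} - {i}. x l * T j l) else T j k)
      = mat r r (\<lambda>(j, k). T j k)"
    by (rule eq_matI) auto
  then show ?case by simp
next
  case (Suc c)
  let ?M = "\<lambda>c. mat r r (\<lambda>(j, k). if k = i then T j i - (\<Sum>l\<in>{..<c} - {i}. x l * T j l) else T j k)"
  have "?M (Suc c) = (if c = i then ?M c else addcol (- x c) i c (?M c))"
  proof (cases "c = i")
    case True
    then have "{..<Suc c} - {i} = {..<c} - {i}" by auto
    then show ?thesis using True by (simp only: simp_thms if_True)
  next
    case False
    then have *: "{..<Suc c} - {i} = insert c ({..<c} - {i})" by auto
    have "(\<Sum>l\<in>{..<Suc c} - {i}. x l * T j l) = x c * T j c + (\<Sum>l\<in>{..<c} - {i}. x l * T j l)" for j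
      unfolding * by (subst sum.insert) auto
    then show ?thesis
      using False Suc.prems i by (intro eq_matI) (auto simp: mat_addcol_def)
  qed
  moreover have "det (addcol (- x c) i c (?M c)) = det (?M c)" if "c \<noteq> i"
    using that Suc.prems by (intro det_addcol[where n = r]) auto
  ultimately show ?case using Suc by (cases "c = i") auto
qed

text \<open>Columns that vanish in \<open>U0\<close> would annihilate the product, so they are left
  out. The index set depends on \<open>U0\<close> only and stays fixed while \<open>U\<close>
  changes.\<close>

definition vol :: "real \<Rightarrow> nat \<Rightarrow> nat \<Rightarrow> (nat \<Rightarrow> nat \<Rightarrow> real) \<Rightarrow> (nat \<Rightarrow> nat \<Rightarrow> real) \<Rightarrow> real" where
  "vol p n r U0 U = (\<Prod>i | i < r \<and> colnorm p n U0 i \<noteq> 0. colnorm p n U i)"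

text \<open>\<open>T\<close> holds the coordinates of the current columns in the initial ones.
  Coordinates along zero columns are not determined by the vectors; prescribing those of the
  identity matrix makes the determinant meaningful for a rank-deficient basis too.\<close>

definition sheared :: "real \<Rightarrow> nat \<Rightarrow> nat \<Rightarrow> (nat \<Rightarrow> nat \<Rightarrow> real) \<Rightarrow> (nat \<Rightarrow> nat \<Rightarrow> real) \<Rightarrow> bool" where
  "sheared p n r U0 U \<longleftrightarrow> (\<exists>T. det (mat r r (\<lambda>(j, k). T j k)) = 1 \<and>
     (\<forall>a<n. \<forall>i<r. U a i = (\<Sum>j<r. U0 a j * T j i)) \<and>
     (\<forall>i<r. \<forall>j<r. colnorm p n U0 i = 0 \<or> colnorm p n U0 j = 0 \<longrightarrow> T j i = (if i = j then 1 else 0)))"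

text \<open>
  After \<open>t\<close> full sweeps and \<open>i\<close> columns of the current one, either nothing is left to
  do, or this sweep has already halved the volume, or it has found no column to replace so far.
\<close>

definition sweep_inv :: "real \<Rightarrow> nat \<Rightarrow> nat \<Rightarrow> (nat \<Rightarrow> nat \<Rightarrow> real) \<Rightarrow> nat \<Rightarrow> nat \<Rightarrow> (nat \<Rightarrow> nat \<Rightarrow> real) \<Rightarrow> bool" where
  "sweep_inv p n r U0 t i U \<longleftrightarrow> sheared p n r U0 U \<and>
     ((\<forall>j<r. separated p n r j U) \<or> 2 ^ Suc t * vol p n r U0 U \<le> vol p n r U0 U0 \<or>
      (\<forall>j<i. separated p n r j U) \<and> 2 ^ t * vol p n r U0 U \<le> vol p n r U0 U0)"

lemma sheared_refl: "sheared p n r U U"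
proof -
  have "mat r r (\<lambda>(j, k). if j = k then 1 else 0) = (1\<^sub>m r :: real mat)"
    by (rule eq_matI) auto
  then show ?thesis
    unfolding sheared_def
    by (intro exI[of _ "\<lambda>j k. if j = k then 1 else 0"]) (auto simp: if_distrib cong: if_cong)
qed

context
  fixes p :: real
  assumes p: "1 \<le> p"
begin

lemma sheared_zero_col:
  assumes "sheared p n r U0 U" "l < r" "colnorm p n U0 l = 0" "a < n"
  shows "U a l = 0"
proof -
  obtain T where T: "\<forall>a<n. \<forall>i<r. U a i = (\<Sum>j<r. U0 a j * T j i)"
    "\<forall>i<r. \<forall>j<r. colnorm p n U0 i = 0 \<or> colnorm p n U0 j = 0 \<longrightarrow> T j i = (if i = j then 1 else 0)"
    using assms(1) unfolding sheared_def by blast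
  have "U0 a l = 0"
    using vnorm_eq_0D[OF p assms(3)] assms(4) by simp
  then have "(\<Sum>j<r. U0 a j * T j l) = 0"
    using T(2) assms(2,3) by (intro sum.neutral) auto
  then show ?thesis using T(1) assms by simp
qed

lemma sheared_step:
  assumes sh: "sheared p n r U0 U" and i: "i < r" and nz: "colnorm p n U0 i \<noteq> 0"
  shows "sheared p n r U0 (\<lambda>a j. if a < n \<and> j = i then resid r i U x a else U a j)"
proof -
  obtain T where T: "det (mat r r (\<lambda>(j, k). T j k)) = 1"
    "\<forall>a<n. \<forall>i<r. U a i = (\<Sum>j<r. U0 a j * T j i)"
    "\<forall>i<r. \<forall>j<r. colnorm p n U0 i = 0 \<or> colnorm p n U0 j = 0 \<longrightarrow> T j i = (if i = j then 1 else 0)"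
    using sh unfolding sheared_def by blast
  \<comment> \<open>Zero columns do not affect the residual, but their coefficients would enter
    \<open>T\<close>; dropping them keeps the prescribed identity part.\<close>
  define x' where "x' l = (if colnorm p n U0 l = 0 then 0 else x l)" for l
  define T' where "T' j k = (if k = i then T j i - (\<Sum>l\<in>{..<r} - {i}. x' l * T j l) else T j k)" for j k
  have resid: "resid r i U x a = (\<Sum>j<r. U0 a j * T' j i)" if "a < n" for a
  proof -
    have "resid r i U x a = U a i - (\<Sum>l\<in>{..<r} - {i}. x' l * U a l)"
      unfolding resid_def
      by (intro arg_cong2[where f = "(-)"] sum.cong) (auto simp: x'_def sheared_zero_col[OF sh] that)
    also have "(\<Sum>l\<in>{..<r} - {i}. x' l * U a l) = (\<Sum>l\<in>{..<r} - {i}. \<Sum>j<r. U0 a j * (x' l * T j l))"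
      using T(2) that by (intro sum.cong) (auto simp: sum_distrib_left mult_ac)
    also have "\<dots> = (\<Sum>j<r. U0 a j * (\<Sum>l\<in>{..<r} - {i}. x' l * T j l))"
      by (subst sum.swap) (simp add: sum_distrib_left)
    finally show ?thesis
      using T(2) that i by (simp add: T'_def algebra_simps sum_subtractf)
  qed
  show ?thesis
    unfolding sheared_def
  proof (intro exI[of _ T'] conjI allI impI)
    show "det (mat r r (\<lambda>(j, k). T' j k)) = 1"
      using det_shear[OF i order_refl, of T x'] T(1) by (simp add: T'_def)
  next
    fix a k assume "a < n" "k < r"
    then show "(if a < n \<and> k = i then resid r i U x a else U a k) = (\<Sum>j<r. U0 a j * T' j k)"
      using T(2) resid by (auto simp: T'_def)
  next
    fix k j assume k: "k < r" and j: "j < r" and zero: "colnorm p n U0 k = 0 \<or> colnorm p n U0 j = 0"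
    show "T' j k = (if k = j then 1 else 0)"
    proof (cases "k = i")
      case True
      then have z: "colnorm p n U0 j = 0" using zero nz by simp
      have "(\<Sum>l\<in>{..<r} - {i}. x' l * T j l) = 0"
        using T(3) z j by (intro sum.neutral) (auto simp: x'_def)
      then show ?thesis using T(3) z j k True by (simp add: T'_def)
    qed (use T(3) zero j k in \<open>auto simp: T'_def\<close>)
  qed
qed

lemma vol_pos: "0 < vol p n r U0 U0"
  unfolding vol_def using vnorm_nonneg[of p "{..<n}"] by (intro prod_pos) (auto simp: less_le)

text \<open>Weighting row j of \<open>T\<close> by the norm of the j-th initial column turns the
  determinant from 1 into the initial volume. By the triangular bound each weighted entry of column
  i is at most \<open>3 ^ r\<close> times the norm of the current column i, so the product of column
  sums is the right-hand side. Zero columns get weight 1.\<close>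

lemma vol_lower_bound:
  assumes tri: "\<And>i. i < r \<Longrightarrow> separated p n i i U0" and sh: "sheared p n r U0 U"
  shows "vol p n r U0 U0 \<le> (real r * 3 ^ r) ^ r * vol p n r U0 U"
proof -
  obtain T where T: "det (mat r r (\<lambda>(j, k). T j k)) = 1"
    "\<forall>a<n. \<forall>i<r. U a i = (\<Sum>j<r. U0 a j * T j i)"
    "\<forall>i<r. \<forall>j<r. colnorm p n U0 i = 0 \<or> colnorm p n U0 j = 0 \<longrightarrow> T j i = (if i = j then 1 else 0)"
    using sh unfolding sheared_def by blast
  define Z where "Z i \<longleftrightarrow> colnorm p n U0 i = 0" for i
  define w where "w j = (if Z j then 1 else colnorm p n U0 j)" for j
  define K where "K = real r * 3 ^ r"
  have split: "(\<Prod>i<r. if Z i then g i else h i) = (\<Prod>i | i < r \<and> Z i. g i) * (\<Prod>i | i < r \<and> \<not> Z i. h i)" for g h :: "nat \<Rightarrow> real"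
    by (subst prod.If_cases) (auto simp: Int_def Collect_conj_eq[symmetric] intro!: arg_cong2[where f = "(*)"] prod.cong)
  have "(\<Prod>j<r. w j) = vol p n r U0 U0"
    unfolding w_def split by (simp add: vol_def Z_def)
  moreover have "det (mat r r (\<lambda>(j, k). w j * T j k)) = (\<Prod>j<r. w j)"
  proof -
    have "det (mat r r (\<lambda>(j, k). w j * T j k)) = (\<Prod>j<r. w j) * det (mat r r (\<lambda>(j, k). T j k))"
      by (simp add: det_def sum_distrib_left prod.distrib lessThan_atLeast0 mult_ac)
    then show ?thesis using T(1) by simp
  qed
  ultimately have "vol p n r U0 U0 = \<bar>det (mat r r (\<lambda>(j, k). w j * T j k))\<bar>"
    using vol_pos[of n r U0] by simp
  also have "\<dots> \<le> (\<Prod>i<r. \<Sum>j<r. \<bar>w j * T j i\<bar>)"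
    using abs_det_le_prod_col_sums[of "mat r r (\<lambda>(j, k). w j * T j k)" r] by simp
  also have "\<dots> \<le> (\<Prod>i<r. if Z i then K else K * colnorm p n U i)"
  proof (rule prod_mono, intro conjI)
    fix i assume "i \<in> {..<r}"
    then have i: "i < r" by simp
    show "0 \<le> (\<Sum>j<r. \<bar>w j * T j i\<bar>)" by (simp add: sum_nonneg)
    show "(\<Sum>j<r. \<bar>w j * T j i\<bar>) \<le> (if Z i then K else K * colnorm p n U i)"
    proof (cases "Z i")
      case True
      have "(\<Sum>j<r. \<bar>w j * T j i\<bar>) = (\<Sum>j<r. if j = i then 1 else 0)"
        using T(3) i True by (intro sum.cong) (auto simp: Z_def w_def)
      also have "\<dots> = 1" using i by simp
      also have "1 \<le> K"
        unfolding K_def using i by (simp add: mult_ge1_I)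
      finally show ?thesis using True by simp
    next
      case False
      have "\<bar>w j * T j i\<bar> \<le> 3 ^ r * colnorm p n U i" if j: "j < r" for j
      proof (cases "Z j")
        case True
        then have "T j i = 0" using T(3) i j False by (auto simp: Z_def)
        then show ?thesis by simp
      next
        case False
        then have "\<bar>w j * T j i\<bar> = \<bar>T j i\<bar> * colnorm p n U0 j"
          by (simp add: w_def abs_mult)
        also have "\<dots> \<le> 3 ^ r * vnorm p {..<n} (\<lambda>a. \<Sum>l<r. T l i * U0 a l)"
          by (rule triangular_coeff_bound[OF p tri j])
        also have "vnorm p {..<n} (\<lambda>a. \<Sum>l<r. T l i * U0 a l) = colnorm p n U i"
          using T(2) i by (intro vnorm_cong) (simp add: mult.commute)
        finally show ?thesis .
      qed
      then have "(\<Sum>j<r. \<bar>w j * T j i\<bar>) \<le> (\<Sum>j<r. 3 ^ r * colnorm p n U i)"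
        by (intro sum_mono) auto
      then show ?thesis using False by (simp add: K_def)
    qed
  qed
  also have "\<dots> = (\<Prod>i<r. K * (if Z i then 1 else colnorm p n U i))"
    by (intro prod.cong) auto
  also have "\<dots> = K ^ r * (\<Prod>i<r. if Z i then 1 else colnorm p n U i)"
    by (simp add: prod.distrib)
  also have "\<dots> = K ^ r * vol p n r U0 U"
    unfolding split by (simp add: vol_def Z_def)
  finally show ?thesis by (simp add: K_def)
qed

lemma vol_halves:
  assumes "i < r" "colnorm p n U0 i \<noteq> 0" "2 * colnorm p n U' i \<le> colnorm p n U i"
    and "\<And>j. j \<noteq> i \<Longrightarrow> colnorm p n U' j = colnorm p n U j"
  shows "2 * vol p n r U0 U' \<le> vol p n r U0 U"
proof -
  let ?J = "{i. i < r \<and> colnorm p n U0 i \<noteq> 0}"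
  have *: "vol p n r U0 V = colnorm p n V i * (\<Prod>j\<in>?J - {i}. colnorm p n V j)" for V
    unfolding vol_def using assms(1,2) by (subst prod.remove[of _ i]) auto
  have "(\<Prod>j\<in>?J - {i}. colnorm p n U' j) = (\<Prod>j\<in>?J - {i}. colnorm p n U j)"
    using assms(4) by (intro prod.cong) auto
  then show ?thesis
    unfolding * using mult_right_mono[OF assms(3), of "\<Prod>j\<in>?J - {i}. colnorm p n U j"]
    by (simp add: prod_nonneg mult.assoc)
qed

lemma sweep_inv_start: "sweep_inv p n r U0 0 0 U0"
  by (simp add: sweep_inv_def sheared_refl)

lemma sweep_inv_next: "sweep_inv p n r U0 t r U \<Longrightarrow> sweep_inv p n r U0 (Suc t) 0 U"
  unfolding sweep_inv_def by auto

lemma sweep_inv_step: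
  assumes inv: "sweep_inv p n r U0 t i U" and i: "i < r" and U': "shrunk p n r i U U'"
  shows "sweep_inv p n r U0 t (Suc i) U'"
  using U' unfolding shrunk_def
proof (elim disjE exE conjE)
  assume "U' = U" "separated p n r i U"
  then show ?thesis using inv unfolding sweep_inv_def by (auto simp: less_Suc_eq)
next
  fix x
  assume U': "U' = (\<lambda>a j. if a < n \<and> j = i then resid r i U x a else U a j)"
    and separated: "separated p n r i U'" and less: "2 * colnorm p n U' i < colnorm p n U i"
  have sh: "sheared p n r U0 U" using inv by (simp add: sweep_inv_def)
  \<comment> \<open>A zero column cannot shrink strictly, so each replacement concerns a factor of
    the volume.\<close>
  have nz: "colnorm p n U0 i \<noteq> 0"
  proof
    assume "colnorm p n U0 i = 0"
    then have "colnorm p n U i = vnorm p {..<n} (\<lambda>a. 0)"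
      using sheared_zero_col[OF sh i] by (intro vnorm_cong) simp
    then show False using less vnorm_nonneg[of p "{..<n}" "\<lambda>a. U' a i"] by (simp add: vnorm_zero[OF p])
  qed
  have half: "2 * vol p n r U0 U' \<le> vol p n r U0 U"
  proof (rule vol_halves[where i = i])
    show "2 * colnorm p n U' i \<le> colnorm p n U i" using less by simp
  qed (auto simp: U' i nz intro!: vnorm_cong)
  have "vnorm p {..<n} (resid r i U x) = colnorm p n U' i"
    by (rule vnorm_cong) (simp add: U')
  \<comment> \<open>A replacement rules out that all columns were separated, so the volume bound for
    t sweeps is available, and halving raises it to \<open>Suc t\<close>.\<close>
  then have "\<not> separated p n r i U"
    using less unfolding separated_def by (metis not_less)
  then have le: "2 ^ t * vol p n r U0 U \<le> vol p n r U0 U0"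
  proof -
    have "vol p n r U0 U \<ge> 0" by (simp add: vol_def prod_nonneg)
    then have "2 ^ t * vol p n r U0 U \<le> 2 ^ Suc t * vol p n r U0 U"
      by (intro mult_right_mono) auto
    moreover have "2 ^ Suc t * vol p n r U0 U \<le> vol p n r U0 U0 \<or> 2 ^ t * vol p n r U0 U \<le> vol p n r U0 U0"
      using inv i \<open>\<not> separated p n r i U\<close> unfolding sweep_inv_def by blast
    ultimately show ?thesis by linarith
  qed
  have "2 ^ Suc t * vol p n r U0 U' \<le> 2 ^ t * vol p n r U0 U"
    using mult_left_mono[OF half, of "2 ^ t"] by (simp add: mult_ac)
  then have "2 ^ Suc t * vol p n r U0 U' \<le> vol p n r U0 U0"
    using le by linarith
  then show ?thesis
    using sheared_step[OF sh i nz, of x] unfolding sweep_inv_def U' by blast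
qed

text \<open>An unseparated column means that the volume was halved t times, whence
  \<open>2 ^ t\<close> is at most \<open>(r * 3 ^ r) ^ r\<close>. Estimating r by
  \<open>2 ^ r\<close> and 3 by 4 bounds this by \<open>2 ^ (3 * r * r)\<close>.\<close>

lemma sweep_inv_final:
  assumes tri: "\<And>i. i < r \<Longrightarrow> separated p n i i U0" and inv: "sweep_inv p n r U0 t 0 U"
    and t: "3 * r * r < t" and i: "i < r"
  shows "separated p n r i U"
proof (rule ccontr)
  assume "\<not> separated p n r i U"
  then have le: "2 ^ t * vol p n r U0 U \<le> vol p n r U0 U0"
  proof -
    have "vol p n r U0 U \<ge> 0" by (simp add: vol_def prod_nonneg)
    then have "2 ^ t * vol p n r U0 U \<le> 2 ^ Suc t * vol p n r U0 U"
      by (intro mult_right_mono) auto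
    moreover have "2 ^ Suc t * vol p n r U0 U \<le> vol p n r U0 U0 \<or> 2 ^ t * vol p n r U0 U \<le> vol p n r U0 U0"
      using inv i \<open>\<not> separated p n r i U\<close> unfolding sweep_inv_def by blast
    ultimately show ?thesis by linarith
  qed
  also have "\<dots> \<le> (real r * 3 ^ r) ^ r * vol p n r U0 U"
    using inv by (intro vol_lower_bound tri) (auto simp: sweep_inv_def)
  finally have *: "2 ^ t * vol p n r U0 U \<le> (real r * 3 ^ r) ^ r * vol p n r U0 U" .
  have "vol p n r U0 U > 0"
  proof (rule ccontr)
    assume "\<not> 0 < vol p n r U0 U"
    then have "vol p n r U0 U = 0" by (simp add: vol_def prod_nonneg order_antisym)
    then show False
      using vol_lower_bound[of r n U0 U, OF tri] inv vol_pos[of n r U0] by (simp add: sweep_inv_def)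
  qed
  then have "2 ^ t \<le> (real r * 3 ^ r) ^ r" using * by simp
  also have "\<dots> \<le> (2 ^ r * 4 ^ r) ^ r"
    by (intro power_mono mult_mono) (auto intro: power_mono less_imp_le)
  also have "\<dots> = (2 :: real) ^ (3 * r * r)"
  proof -
    have "(2 ^ r * 4 ^ r :: real) = 8 ^ r" by (simp add: power_mult_distrib[symmetric])
    also have "\<dots> = 2 ^ (3 * r)" by (simp add: power_mult)
    finally show ?thesis by (simp add: power_mult)
  qed
  finally have "t \<le> 3 * r * r" by (simp add: power_increasing_iff)
  then show False using t by simp
qed

end

section \<open>Thin directions and deflation\<close>

definition nsq :: "nat \<Rightarrow> (nat \<Rightarrow> real) \<Rightarrow> real" where
  "nsq r y = (\<Sum>i<r. y i * y i)"

text \<open>Dividing by the squared norm replaces the normalisation of y, which would take a square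
  root.\<close>

definition deflate :: "nat \<Rightarrow> (nat \<Rightarrow> nat \<Rightarrow> real) \<Rightarrow> (nat \<Rightarrow> real) \<Rightarrow> nat \<Rightarrow> nat \<Rightarrow> real" where
  "deflate r P y i j = P i j - y i * y j / nsq r y"

definition proj :: "nat \<Rightarrow> (nat \<Rightarrow> nat \<Rightarrow> real) \<Rightarrow> bool" where
  "proj r P \<longleftrightarrow> (\<forall>i<r. \<forall>j<r. P i j = P j i) \<and> (\<forall>i<r. \<forall>j<r. (\<Sum>h<r. P i h * P h j) = P i j)"

definition in_range :: "nat \<Rightarrow> (nat \<Rightarrow> nat \<Rightarrow> real) \<Rightarrow> (nat \<Rightarrow> real) \<Rightarrow> bool" where
  "in_range r P y \<longleftrightarrow> (\<forall>i<r. (\<Sum>j<r. P i j * y j) = y i)"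

text \<open>Stands in for the dimension of the range of a projection: each deflation lowers it by
  exactly 1.\<close>

definition trace :: "nat \<Rightarrow> (nat \<Rightarrow> nat \<Rightarrow> real) \<Rightarrow> real" where
  "trace r P = (\<Sum>i<r. P i i)"

lemma nsq_nonneg: "0 \<le> nsq r y"
  by (simp add: nsq_def sum_nonneg)

lemma sq_le_nsq: "i < r \<Longrightarrow> y i * y i \<le> nsq r y"
  unfolding nsq_def by (rule member_le_sum) auto

lemma nsq_eq_0D: "nsq r y = 0 \<Longrightarrow> i < r \<Longrightarrow> y i = 0"
  using sq_le_nsq[of i r y] by (auto simp: mult_le_0_iff)

lemma trace_deflate: "nsq r y \<noteq> 0 \<Longrightarrow> trace r (deflate r P y) = trace r P - 1"
  by (simp add: trace_def deflate_def sum_subtractf sum_divide_distrib[symmetric] nsq_def[symmetric])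

lemma deflate_apply: "(\<Sum>j<r. deflate r P y i j * z j) = (\<Sum>j<r. P i j * z j) - y i * (\<Sum>j<r. y j * z j) / nsq r y"
proof -
  have "(\<Sum>j<r. y i * y j / nsq r y * z j) = y i * (\<Sum>j<r. y j * z j) / nsq r y"
    unfolding sum_distrib_left sum_divide_distrib by (intro sum.cong) auto
  then show ?thesis by (simp add: deflate_def left_diff_distrib sum_subtractf)
qed

lemma proj_sym: "proj r P \<Longrightarrow> i < r \<Longrightarrow> j < r \<Longrightarrow> P i j = P j i"
  and proj_idem: "proj r P \<Longrightarrow> i < r \<Longrightarrow> j < r \<Longrightarrow> (\<Sum>h<r. P i h * P h j) = P i j"
  unfolding proj_def by blast+

lemma proj_cong:
  assumes "proj r P" "\<And>i j. i < r \<Longrightarrow> j < r \<Longrightarrow> P' i j = P i j"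
  shows "proj r P'"
  unfolding proj_def
proof (intro conjI allI impI)
  fix i j assume ij: "i < r" "j < r"
  show "P' i j = P' j i" using proj_sym[OF assms(1) ij] assms(2) ij by simp
  have "(\<Sum>h<r. P' i h * P' h j) = (\<Sum>h<r. P i h * P h j)"
    using assms(2) ij by (intro sum.cong) auto
  then show "(\<Sum>h<r. P' i h * P' h j) = P' i j" using proj_idem[OF assms(1) ij] assms(2) ij by simp
qed

lemma in_rangeD: "in_range r P y \<Longrightarrow> i < r \<Longrightarrow> (\<Sum>j<r. P i j * y j) = y i"
  by (auto simp: in_range_def)

lemma proj_col_in_range: "proj r P \<Longrightarrow> i < r \<Longrightarrow> in_range r P (\<lambda>j. P j i)"
  by (auto simp: in_range_def proj_idem)

lemma in_range_scale: "in_range r P y \<Longrightarrow> in_range r P (\<lambda>j. y j / c)"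
  by (simp add: in_range_def sum_divide_distrib[symmetric])

lemma in_range_add: "in_range r P y \<Longrightarrow> in_range r P z \<Longrightarrow> in_range r P (\<lambda>j. y j + z j)"
  by (simp add: in_range_def distrib_left sum.distrib)

lemma proj_self_adjoint:
  assumes "proj r P"
  shows "(\<Sum>i<r. (\<Sum>j<r. P i j * y j) * z i) = (\<Sum>j<r. y j * (\<Sum>i<r. P j i * z i))"
proof -
  have "(\<Sum>i<r. (\<Sum>j<r. P i j * y j) * z i) = (\<Sum>j<r. \<Sum>i<r. P i j * y j * z i)"
    unfolding sum_distrib_right by (rule sum.swap)
  also have "\<dots> = (\<Sum>j<r. y j * (\<Sum>i<r. P j i * z i))"
    unfolding sum_distrib_left using proj_sym[OF assms] by (intro sum.cong) (auto simp: mult_ac)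
  finally show ?thesis .
qed

lemma proj_deflate:
  assumes P: "proj r P" and y: "in_range r P y" and nz: "nsq r y \<noteq> 0"
  shows "proj r (deflate r P y)"
  unfolding proj_def
proof (intro conjI allI impI)
  fix i j assume ij: "i < r" "j < r"
  show "deflate r P y i j = deflate r P y j i"
    using proj_sym[OF P ij] by (simp add: deflate_def mult.commute)
  have yP: "(\<Sum>h<r. y h * P h j) = y j"
  proof -
    have "(\<Sum>h<r. y h * P h j) = (\<Sum>h<r. P j h * y h)"
      using proj_sym[OF P] ij by (intro sum.cong) (auto simp: mult.commute)
    then show ?thesis using in_rangeD[OF y] ij by simp
  qed
  have "(\<Sum>h<r. deflate r P y i h * deflate r P y h j)
      = (\<Sum>h<r. deflate r P y i h * P h j) - (\<Sum>h<r. deflate r P y i h * y h) * y j / nsq r y"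
    by (simp add: deflate_def[of r P y _ j] right_diff_distrib sum_subtractf sum_divide_distrib sum_distrib_left sum_distrib_right mult_ac)
  also have "(\<Sum>h<r. deflate r P y i h * y h) = 0"
    unfolding deflate_apply using in_rangeD[OF y] ij nz by (simp add: nsq_def)
  also have "(\<Sum>h<r. deflate r P y i h * P h j) = deflate r P y i j"
    unfolding deflate_apply using proj_idem[OF P] ij yP by (simp add: deflate_def)
  finally show "(\<Sum>h<r. deflate r P y i h * deflate r P y h j) = deflate r P y i j" by simp
qed

text \<open>Pair z = Qz, with Q the deflated projection, with y: the term <y, P z> = <P y, z> and
  the correction both equal <y, z>, so this product is 0, and then Qz = P z.\<close>

lemma in_range_deflate:
  assumes P: "proj r P" and y: "in_range r P y" and nz: "nsq r y \<noteq> 0"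
    and z: "in_range r (deflate r P y) z"
  shows "in_range r P z" "(\<Sum>i<r. y i * z i) = 0"
proof -
  let ?s = "\<Sum>i<r. y i * z i"
  have "?s = (\<Sum>i<r. y i * (\<Sum>j<r. P i j * z j)) - (\<Sum>i<r. y i * y i) * ?s / nsq r y"
  proof -
    have "?s = (\<Sum>i<r. y i * ((\<Sum>j<r. P i j * z j) - y i * ?s / nsq r y))"
      using in_rangeD[OF z] by (intro sum.cong) (simp_all add: deflate_apply)
    also have "\<dots> = (\<Sum>i<r. y i * (\<Sum>j<r. P i j * z j)) - (\<Sum>i<r. y i * y i * (?s / nsq r y))"
      unfolding right_diff_distrib sum_subtractf by (simp add: mult_ac)
    also have "(\<Sum>i<r. y i * y i * (?s / nsq r y)) = (\<Sum>i<r. y i * y i) * (?s / nsq r y)"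
      by (rule sum_distrib_right[symmetric])
    finally show ?thesis by simp
  qed
  also have "(\<Sum>i<r. y i * (\<Sum>j<r. P i j * z j)) = ?s"
    unfolding proj_self_adjoint[OF P, symmetric] using in_rangeD[OF y] by simp
  finally show 0: "?s = 0" using nz by (simp add: nsq_def)
  show "in_range r P z"
    using z unfolding in_range_def deflate_apply 0 by simp
qed

text \<open>On the range of \<open>P\<close>, orthogonality to a vector equals orthogonality to its
  projection h. Deflating by h enforces it and costs 1 in trace; if h = 0 the constraint holds
  anyway. With no constraints left, a trace of at least 1 supplies a nonzero column.\<close>

lemma exists_orthogonal:
  assumes "proj r P" "real k + 1 \<le> trace r P"
  shows "\<exists>y. in_range r P y \<and> (\<forall>c<k. (\<Sum>i<r. y i * g c i) = 0) \<and> (\<exists>i<r. y i \<noteq> 0)"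
  using assms
proof (induction k arbitrary: P)
  case 0
  from 0(2) have "\<exists>i<r. P i i \<noteq> 0"
  proof (rule contrapos_pp)
    assume "\<not> (\<exists>i<r. P i i \<noteq> 0)"
    then have "trace r P = 0" unfolding trace_def by (intro sum.neutral) auto
    then show "\<not> real 0 + 1 \<le> trace r P" by simp
  qed
  then show ?case using proj_col_in_range[OF 0(1)] by blast
next
  case (Suc k)
  define h where "h i = (\<Sum>j<r. P i j * g k j)" for i
  have h: "in_range r P h"
    unfolding in_range_def
  proof (intro allI impI)
    fix i assume i: "i < r"
    have "(\<Sum>j<r. P i j * h j) = (\<Sum>l<r. (\<Sum>j<r. P i j * P j l) * g k l)"
      unfolding h_def sum_distrib_left sum_distrib_right by (subst sum.swap) (simp add: mult_ac)
    then show "(\<Sum>j<r. P i j * h j) = h i"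
      using proj_idem[OF Suc.prems(1)] i by (simp add: h_def)
  qed
  have orth: "(\<Sum>i<r. y i * g k i) = (\<Sum>i<r. y i * h i)" if "in_range r P y" for y
  proof -
    have "(\<Sum>i<r. y i * g k i) = (\<Sum>i<r. (\<Sum>j<r. P i j * y j) * g k i)"
      using in_rangeD[OF that] by (intro sum.cong) auto
    then show ?thesis unfolding proj_self_adjoint[OF Suc.prems(1)] h_def .
  qed
  show ?case
  proof (cases "nsq r h = 0")
    case True
    obtain y where y: "in_range r P y" "\<forall>c<k. (\<Sum>i<r. y i * g c i) = 0" "\<exists>i<r. y i \<noteq> 0"
      using Suc.IH[OF Suc.prems(1)] Suc.prems(2) by auto
    have "(\<Sum>i<r. y i * g k i) = 0"
      unfolding orth[OF y(1)] using nsq_eq_0D[OF True] by simp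
    then show ?thesis using y by (intro exI[of _ y]) (auto simp: less_Suc_eq)
  next
    case False
    obtain y where y: "in_range r (deflate r P h) y" "\<forall>c<k. (\<Sum>i<r. y i * g c i) = 0" "\<exists>i<r. y i \<noteq> 0"
      using Suc.IH[OF proj_deflate[OF Suc.prems(1) h False]] Suc.prems(2) trace_deflate[OF False, of P]
      by auto
    note y' = in_range_deflate[OF Suc.prems(1) h False y(1)]
    have "(\<Sum>i<r. y i * g k i) = 0"
      unfolding orth[OF y'(1)] using y'(2) by (simp add: mult.commute)
    then show ?thesis using y y'(1) by (intro exI[of _ y]) (auto simp: less_Suc_eq)
  qed
qed

lemma proj_diag:
  assumes "proj r P" "i < r"
  shows "P i i = nsq r (\<lambda>h. P h i)"
proof -
  have "P i i = (\<Sum>h<r. P i h * P h i)" using proj_idem[OF assms(1)] assms(2) by simp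
  also have "\<dots> = nsq r (\<lambda>h. P h i)"
    unfolding nsq_def using proj_sym[OF assms(1,2)] by (intro sum.cong) auto
  finally show ?thesis .
qed

lemma proj_diag_nonneg: "proj r P \<Longrightarrow> i < r \<Longrightarrow> 0 \<le> P i i"
  using proj_diag[of r P i] by (simp add: nsq_nonneg)

lemma proj_diag_0D: "proj r P \<Longrightarrow> i < r \<Longrightarrow> j < r \<Longrightarrow> P i i = 0 \<Longrightarrow> P j i = 0"
  using proj_diag[of r P i] nsq_eq_0D[of r "\<lambda>h. P h i" j] by simp

text \<open>Makes the sign of \<open>P i i\<close> a test, computable by one comparison, for whether
  position i can carry the entry 1.\<close>

lemma in_range_diag_pos:
  assumes P: "proj r P" and "in_range r P z" "i < r" "z i \<noteq> 0"
  shows "0 < P i i"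
proof -
  have "P i i \<noteq> 0"
  proof
    assume 0: "P i i = 0"
    have "(\<Sum>j<r. P i j * z j) = 0"
      using proj_diag_0D[OF P assms(3) _ 0] proj_sym[OF P assms(3)] by (intro sum.neutral) auto
    then show False using in_rangeD[OF assms(2,3)] assms(4) by simp
  qed
  then show ?thesis using proj_diag_nonneg[OF P assms(3)] by simp
qed

text \<open>For a projection with \<open>P i i\<close> > 0 this is the shortest vector of the range
  with entry 1 at position i.\<close>

definition pivot :: "(nat \<Rightarrow> nat \<Rightarrow> real) \<Rightarrow> nat \<Rightarrow> nat \<Rightarrow> real" where
  "pivot P i l = P l i / P i i"

text \<open>
  As \<open>w\<close> varies, these are exactly the vectors in the range of \<open>P\<close> with entry 1 at
  position \<open>i\<close>: an affine parametrisation, which makes the search for a thin one a regression.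
\<close>

definition candidate :: "nat \<Rightarrow> (nat \<Rightarrow> nat \<Rightarrow> real) \<Rightarrow> nat \<Rightarrow> (nat \<Rightarrow> real) \<Rightarrow> nat \<Rightarrow> real" where
  "candidate r P i w l = pivot P i l + (\<Sum>h<r. deflate r P (pivot P i) l h * w h)"

context
  fixes r P i
  assumes P: "proj r P" and i: "i < r" and pos: "0 < P i i"
begin

lemma pivot_in_range: "in_range r P (pivot P i)"
  using in_range_scale[OF proj_col_in_range[OF P i]] by (simp add: pivot_def[abs_def])

lemma pivot_self: "pivot P i i = 1"
  using pos by (simp add: pivot_def)

lemma nsq_pivot: "nsq r (pivot P i) = 1 / P i i"
proof -
  have "nsq r (pivot P i) = nsq r (\<lambda>h. P h i) / (P i i * P i i)"
    by (simp add: nsq_def pivot_def sum_divide_distrib)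
  then show ?thesis using proj_diag[OF P i] pos by simp
qed

lemma candidate_in_range: "in_range r P (candidate r P i w)"
proof -
  let ?Q = "deflate r P (pivot P i)"
  have Q: "proj r ?Q" and nz: "nsq r (pivot P i) \<noteq> 0"
    using proj_deflate[OF P pivot_in_range] nsq_pivot pos by auto
  have "in_range r ?Q (\<lambda>l. \<Sum>h<r. ?Q l h * w h)"
    unfolding in_range_def
  proof (intro allI impI)
    fix j assume j: "j < r"
    have "(\<Sum>l<r. ?Q j l * (\<Sum>h<r. ?Q l h * w h)) = (\<Sum>h<r. (\<Sum>l<r. ?Q j l * ?Q l h) * w h)"
      unfolding sum_distrib_left sum_distrib_right by (subst sum.swap) (simp add: mult_ac)
    then show "(\<Sum>l<r. ?Q j l * (\<Sum>h<r. ?Q l h * w h)) = (\<Sum>h<r. ?Q j h * w h)"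
      using proj_idem[OF Q] j by simp
  qed
  from in_range_deflate(1)[OF P pivot_in_range nz this] show ?thesis
    unfolding candidate_def[abs_def] by (intro in_range_add pivot_in_range)
qed

text \<open>Deflation by the pivot vector cancels row i of \<open>P\<close>, so the parameter cannot
  move entry i.\<close>

lemma candidate_self: "candidate r P i w i = 1"
proof -
  have "deflate r P (pivot P i) i h = 0" if "h < r" for h
    unfolding deflate_def nsq_pivot pivot_self using pos proj_sym[OF P i that] by (simp add: pivot_def)
  then show ?thesis by (simp add: candidate_def pivot_self)
qed

text \<open>The vector z is its own parameter: its inner product with the pivot vector is 1 /
  \<open>P i i\<close>, the squared norm of that vector, so deflation maps z to z minus the pivot
  vector.\<close>

lemma candidate_complete:
  assumes z: "in_range r P z" "z i = 1" and l: "l < r"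
  shows "candidate r P i z l = z l"
proof -
  have "(\<Sum>j<r. pivot P i j * z j) = (\<Sum>j<r. P i j * z j) / P i i"
    unfolding sum_divide_distrib using proj_sym[OF P i] by (intro sum.cong) (auto simp: pivot_def)
  then have "(\<Sum>j<r. pivot P i j * z j) = 1 / P i i"
    using in_rangeD[OF z(1) i] z(2) by simp
  then show ?thesis
    using in_rangeD[OF z(1) l] pos by (simp add: candidate_def deflate_apply nsq_pivot)
qed

end

section \<open>The error caused by one deflation\<close>

definition rowcomb :: "nat \<Rightarrow> (nat \<Rightarrow> nat \<Rightarrow> real) \<Rightarrow> (nat \<Rightarrow> real) \<Rightarrow> nat \<Rightarrow> real" where
  "rowcomb r X y j = (\<Sum>l<r. y l * X l j)"

definition mprod :: "nat \<Rightarrow> (nat \<Rightarrow> nat \<Rightarrow> real) \<Rightarrow> (nat \<Rightarrow> nat \<Rightarrow> real) \<Rightarrow> nat \<Rightarrow> nat \<Rightarrow> real" where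
  "mprod r U X a j = (\<Sum>l<r. U a l * X l j)"

definition err :: "real \<Rightarrow> nat \<Rightarrow> nat \<Rightarrow> (nat \<Rightarrow> nat \<Rightarrow> real) \<Rightarrow> (nat \<Rightarrow> nat \<Rightarrow> real) \<Rightarrow> real" where
  "err p n m A B = vnorm p ({..<n} \<times> {..<m}) (\<lambda>(a, j). A a j - B a j)"

text \<open>A deflation along y adds at most r times the norm v of \<open>rowcomb r X y\<close>, and
  the best direction has v \<le> 2 r (\<eta> + \<delta>); together this is the summand charged s
  times.\<close>

definition phase2_inv :: "real \<Rightarrow> nat \<Rightarrow> nat \<Rightarrow> nat \<Rightarrow> (nat \<Rightarrow> nat \<Rightarrow> real) \<Rightarrow> (nat \<Rightarrow> nat \<Rightarrow> real) \<Rightarrow>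
    (nat \<Rightarrow> nat \<Rightarrow> real) \<Rightarrow> real \<Rightarrow> real \<Rightarrow> nat \<Rightarrow> (nat \<Rightarrow> nat \<Rightarrow> real) \<Rightarrow> bool" where
  "phase2_inv p n m r A U X \<eta> \<delta> s P \<longleftrightarrow> proj r P \<and> trace r P = real r - real s \<and>
     err p n m A (mprod r U (mprod r P X)) \<le> \<eta> + real s * (2 * (real r)\<^sup>2 * (\<eta> + \<delta>))"

text \<open>The value \<open>-1\<close> stands for the absence of a candidate.\<close>

definition best_upto :: "real \<Rightarrow> nat \<Rightarrow> nat \<Rightarrow> (nat \<Rightarrow> nat \<Rightarrow> real) \<Rightarrow> (nat \<Rightarrow> nat \<Rightarrow> real) \<Rightarrow> nat \<Rightarrow>
    (nat \<Rightarrow> real) \<Rightarrow> real \<Rightarrow> bool" where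
  "best_upto p m r X P i y v \<longleftrightarrow>
     (v = - 1 \<and> (\<forall>i'<i. \<not> 0 < P i' i')) \<or>
     (in_range r P y \<and> (\<exists>l<r. y l = 1) \<and> v = vnorm p {..<m} (rowcomb r X y) \<and>
      (\<forall>i'<i. 0 < P i' i' \<longrightarrow> (\<forall>w. v \<le> vnorm p {..<m} (rowcomb r X (candidate r P i' w)))))"

lemma best_upto_0: "best_upto p m r X P 0 y (- 1)"
  by (simp add: best_upto_def)

lemma best_upto_skip: "best_upto p m r X P i y v \<Longrightarrow> \<not> 0 < P i i \<Longrightarrow> best_upto p m r X P (Suc i) y v"
  unfolding best_upto_def by (auto simp: less_Suc_eq)

lemma best_upto_keep:
  assumes "best_upto p m r X P i y v" "\<And>w. v' \<le> vnorm p {..<m} (rowcomb r X (candidate r P i w))"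
    "\<not> v < 0" "\<not> v' < v"
  shows "best_upto p m r X P (Suc i) y v"
proof -
  have "v \<le> vnorm p {..<m} (rowcomb r X (candidate r P i w))" for w
    using assms(2)[of w] assms(4) by linarith
  then show ?thesis using assms(1,3) unfolding best_upto_def by (auto simp: less_Suc_eq)
qed

lemma best_upto_update:
  assumes P: "proj r P" and i: "i < r" "0 < P i i" and "best_upto p m r X P i y v"
    and v': "\<And>w. v' \<le> vnorm p {..<m} (rowcomb r X (candidate r P i w))"
    and y': "v' = vnorm p {..<m} (rowcomb r X (candidate r P i w))" "\<And>l. l < r \<Longrightarrow> y' l = candidate r P i w l"
    and less: "v < 0 \<or> v' < v"
  shows "best_upto p m r X P (Suc i) y' v'"
proof -
  have "in_range r P y'"
    using candidate_in_range[of r P i w] P i y'(2) by (simp add: in_range_def)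
  moreover have "y' i = 1"
    using candidate_self[of r P i w] P i y'(2) by simp
  moreover have "rowcomb r X y' = rowcomb r X (candidate r P i w)"
    using y'(2) by (simp add: rowcomb_def[abs_def])
  moreover have "v' \<le> vnorm p {..<m} (rowcomb r X (candidate r P i' w'))" if "i' < i" "0 < P i' i'" for i' w'
    using assms(4) unfolding best_upto_def
  proof (elim disjE conjE)
    assume "v = vnorm p {..<m} (rowcomb r X y)"
      and "\<forall>i'<i. 0 < P i' i' \<longrightarrow> (\<forall>w. v \<le> vnorm p {..<m} (rowcomb r X (candidate r P i' w)))"
    then have "0 \<le> v" "v \<le> vnorm p {..<m} (rowcomb r X (candidate r P i' w'))" using that by auto
    then show ?thesis using less by linarith
  qed (use that in auto)
  ultimately show ?thesis
    unfolding best_upto_def using i v' y'(1) by (auto simp: less_Suc_eq)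
qed

context
  fixes p :: real
  assumes p: "1 \<le> p"
begin

lemma err_triangle: "err p n m B C \<le> err p n m A B + err p n m A C"
proof -
  have "err p n m B C = vnorm p ({..<n} \<times> {..<m}) (\<lambda>x. (case x of (a, j) \<Rightarrow> A a j - C a j) - (case x of (a, j) \<Rightarrow> A a j - B a j))"
    unfolding err_def by (intro vnorm_cong) auto
  then show ?thesis
    using vnorm_triangle_diff[OF p, of "{..<n} \<times> {..<m}" "\<lambda>(a, j). A a j - C a j" "\<lambda>(a, j). A a j - B a j"]
    by (simp add: err_def)
qed

text \<open>Applying the dual functionals to the difference of the two approximations shows that
  each row of \<open>X\<close> is within 2 \<epsilon> of a row of a rank k product. A direction
  orthogonal to the left factor sees only the remainders \<open>R\<close>; with entries at most 1 it
  adds up r of them.\<close>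

lemma thin_direction:
  assumes separated: "\<And>i. i < r \<Longrightarrow> separated p n r i U"
    and norm: "\<And>i. i < r \<Longrightarrow> colnorm p n U i = 1 \<or> (\<forall>j<m. X i j = 0)"
    and UX: "err p n m A (mprod r U X) \<le> \<eta>"
    and P: "proj r P" and tr: "real k + 1 \<le> trace r P"
  shows "\<exists>i<r. \<exists>z. in_range r P z \<and> z i = 1 \<and>
     vnorm p {..<m} (rowcomb r X z) \<le> 2 * real r * (\<eta> + err p n m A (mprod k Us Vs))"
proof -
  define dual where "dual i \<phi> \<longleftrightarrow> (\<forall>j<m. (\<Sum>l<r. (\<Sum>a<n. \<phi> a * U a l) * X l j) = X i j) \<and>
        (\<forall>f. \<bar>\<Sum>a<n. \<phi> a * f a\<bar> \<le> 2 * vnorm p {..<n} f)" for i and \<phi> :: "nat \<Rightarrow> real"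
  have "\<exists>\<phi>. dual i \<phi>" if i: "i < r" for i
  proof (cases "colnorm p n U i = 1")
    case True
    obtain \<phi> where \<phi>: "\<forall>j<r. (\<Sum>a<n. \<phi> a * U a j) = (if j = i then 1 else 0)"
       "\<forall>f. \<bar>\<Sum>a<n. \<phi> a * f a\<bar> * colnorm p n U i \<le> 2 * vnorm p {..<n} f"
      using dual_functional[OF p separated[OF i] _ i] True by auto
    have "(\<Sum>l<r. (\<Sum>a<n. \<phi> a * U a l) * X l j) = (\<Sum>l<r. if l = i then X l j else 0)" for j
      using \<phi>(1) by (intro sum.cong) auto
    then show ?thesis using \<phi>(2) True i by (intro exI[of _ \<phi>]) (simp add: dual_def)
  next
    case False
    \<comment> \<open>A zero column has no dual functional, but its row of coefficients is 0, so the
      zero functional serves.\<close>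
    then show ?thesis using norm[OF i] by (intro exI[of _ "\<lambda>a. 0"]) (auto simp: dual_def)
  qed
  then have "\<exists>\<phi>. \<forall>i. i < r \<longrightarrow> dual i (\<phi> i)"
    by (intro choice) blast
  then obtain \<phi> where dual: "\<And>i. i < r \<Longrightarrow> dual i (\<phi> i)" by blast
  have \<phi>: "\<And>i j. i < r \<Longrightarrow> j < m \<Longrightarrow> (\<Sum>l<r. (\<Sum>a<n. \<phi> i a * U a l) * X l j) = X i j"
     "\<And>i f. i < r \<Longrightarrow> \<bar>\<Sum>a<n. \<phi> i a * f a\<bar> \<le> 2 * vnorm p {..<n} f"
    using dual by (simp_all add: dual_def)
  define G where "G i c = (\<Sum>a<n. \<phi> i a * Us a c)" for i c
  define E where "E a j = mprod r U X a j - mprod k Us Vs a j" for a j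
  define R where "R i j = X i j - (\<Sum>c<k. G i c * Vs c j)" for i j
  have R: "R i j = (\<Sum>a<n. \<phi> i a * E a j)" if "i < r" "j < m" for i j
  proof -
    have "(\<Sum>a<n. \<phi> i a * E a j) = (\<Sum>a<n. \<phi> i a * mprod r U X a j) - (\<Sum>a<n. \<phi> i a * mprod k Us Vs a j)"
      by (simp add: E_def right_diff_distrib sum_subtractf)
    also have "(\<Sum>a<n. \<phi> i a * mprod r U X a j) = (\<Sum>l<r. (\<Sum>a<n. \<phi> i a * U a l) * X l j)"
      unfolding mprod_def sum_distrib_left sum_distrib_right by (subst sum.swap) (simp add: mult_ac)
    also have "(\<Sum>a<n. \<phi> i a * mprod k Us Vs a j) = (\<Sum>c<k. G i c * Vs c j)"
      unfolding mprod_def G_def sum_distrib_left sum_distrib_right by (subst sum.swap) (simp add: mult_ac)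
    finally show ?thesis using \<phi>(1) that by (simp add: R_def)
  qed
  define \<epsilon> where "\<epsilon> = \<eta> + err p n m A (mprod k Us Vs)"
  have "err p n m (mprod r U X) (mprod k Us Vs) \<le> \<epsilon>"
    using err_triangle[of n m "mprod r U X" "mprod k Us Vs" A] UX by (simp add: \<epsilon>_def)
  then have E: "vnorm p {..<m} (\<lambda>j. vnorm p {..<n} (\<lambda>a. E a j)) \<le> \<epsilon>"
    unfolding vnorm_pair[OF p, symmetric] by (simp add: err_def E_def)
  have row: "vnorm p {..<m} (R i) \<le> 2 * \<epsilon>" if "i < r" for i
  proof -
    have "vnorm p {..<m} (R i) \<le> vnorm p {..<m} (\<lambda>j. 2 * vnorm p {..<n} (\<lambda>a. E a j))"
      using \<phi>(2)[OF that] R[OF that] by (intro vnorm_mono[OF p]) auto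
    also have "\<dots> \<le> 2 * \<epsilon>" using E by (simp add: vnorm_cmult[OF p])
    finally show ?thesis .
  qed
  \<comment> \<open>Trace at least k + 1 leaves room for orthogonality to the k columns of
    \<open>G\<close>, which kills the rank k part.\<close>
  obtain y where y: "in_range r P y" "\<forall>c<k. (\<Sum>i<r. y i * G i c) = 0" "\<exists>i<r. y i \<noteq> 0"
    using exists_orthogonal[OF P tr, of "\<lambda>c i. G i c"] by blast
  have "\<exists>i\<in>{..<r}. \<forall>l\<in>{..<r}. \<bar>y l\<bar> \<le> \<bar>y i\<bar>"
  proof -
    have "{..<r} \<noteq> {}" using y(3) by auto
    then show ?thesis
      using finite_imageI[of "{..<r}" "\<lambda>l. \<bar>y l\<bar>"] Max_in[of "(\<lambda>l. \<bar>y l\<bar>) ` {..<r}"]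
        Max_ge[of "(\<lambda>l. \<bar>y l\<bar>) ` {..<r}"] by fastforce
  qed
  then obtain i where i: "i < r" and max: "\<And>l. l < r \<Longrightarrow> \<bar>y l\<bar> \<le> \<bar>y i\<bar>" by auto
  have yi: "y i \<noteq> 0" using y(3) max by force
  define z where "z l = y l / y i" for l
  have z1: "\<bar>z l\<bar> \<le> 1" if "l < r" for l
    using max[OF that] yi by (simp add: z_def abs_divide)
  have zX: "rowcomb r X z j = (\<Sum>l<r. z l * R l j)" for j
  proof -
    have "(\<Sum>l<r. z l * (\<Sum>c<k. G l c * Vs c j)) = (\<Sum>c<k. (\<Sum>l<r. y l * G l c) * (Vs c j / y i))"
      unfolding sum_distrib_left sum_distrib_right by (subst sum.swap) (simp add: z_def mult_ac)
    also have "\<dots> = 0" using y(2) by simp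
    finally show ?thesis by (simp add: rowcomb_def R_def right_diff_distrib sum_subtractf)
  qed
  have "0 \<le> \<epsilon>" using E vnorm_nonneg order_trans by blast
  have "vnorm p {..<m} (rowcomb r X z) = vnorm p {..<m} (\<lambda>j. \<Sum>l<r. z l * R l j)"
    by (simp add: zX[abs_def])
  also have "\<dots> \<le> (\<Sum>l<r. vnorm p {..<m} (\<lambda>j. z l * R l j))"
    by (rule vnorm_sum[OF p])
  also have "\<dots> = (\<Sum>l<r. \<bar>z l\<bar> * vnorm p {..<m} (R l))"
    by (simp add: vnorm_cmult[OF p])
  also have "\<dots> \<le> (\<Sum>l<r. 1 * (2 * \<epsilon>))"
    using z1 row by (intro sum_mono mult_mono) auto
  also have "\<dots> = 2 * real r * \<epsilon>" by simp
  finally have "vnorm p {..<m} (rowcomb r X z) \<le> 2 * real r * \<epsilon>" .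
  moreover have "in_range r P z" "z i = 1"
    using in_range_scale[OF y(1), of "y i"] yi by (simp_all add: z_def[abs_def])
  ultimately show ?thesis using i unfolding \<epsilon>_def by blast
qed

text \<open>The change is the outer product of U y and y X, divided by the squared norm of y. A
  direction found by regression has an entry 1, but other entries may be large; the division by the
  squared norm compensates for them.\<close>

lemma deflate_err:
  assumes norm: "\<And>i. i < r \<Longrightarrow> colnorm p n U i \<le> 1" and y: "\<exists>l<r. y l = 1"
  shows "err p n m A (mprod r U (mprod r (deflate r P y) X))
      \<le> err p n m A (mprod r U (mprod r P X)) + real r * vnorm p {..<m} (rowcomb r X y)"
proof -
  obtain l where l: "l < r" "y l = 1" using y by blast
  have N1: "1 \<le> nsq r y" using sq_le_nsq[OF l(1), of y] l(2) by simp
  define u where "u a = (\<Sum>h<r. y h * U a h)" for a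
  \<comment> \<open>An entry is at most 1 or at most its own square; the entry 1 makes the squared
    norm dominate both.\<close>
  have yh: "\<bar>y h\<bar> \<le> nsq r y" if "h < r" for h
  proof (cases "\<bar>y h\<bar> \<le> 1")
    case False
    then have "\<bar>y h\<bar> * 1 \<le> \<bar>y h\<bar> * \<bar>y h\<bar>" by (intro mult_left_mono) auto
    then show ?thesis using sq_le_nsq[OF that, of y] by simp
  qed (use N1 in simp)
  have "vnorm p {..<n} u \<le> (\<Sum>h<r. vnorm p {..<n} (\<lambda>a. y h * U a h))"
    unfolding u_def by (rule vnorm_sum[OF p])
  also have "\<dots> = (\<Sum>h<r. \<bar>y h\<bar> * colnorm p n U h)"
    by (simp add: vnorm_cmult[OF p])
  also have "\<dots> \<le> (\<Sum>h<r. nsq r y * 1)"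
    using yh norm by (intro sum_mono mult_mono) (auto simp: nsq_nonneg)
  finally have u: "vnorm p {..<n} u \<le> real r * nsq r y" by simp
  have inner: "mprod r (deflate r P y) X h j = mprod r P X h j - y h * (rowcomb r X y j / nsq r y)" for h j
    unfolding mprod_def deflate_apply by (simp add: rowcomb_def)
  have "mprod r U (mprod r (deflate r P y) X) a j
      = mprod r U (mprod r P X) a j - u a * (rowcomb r X y j / nsq r y)" for a j
    unfolding mprod_def[of r U] inner right_diff_distrib sum_subtractf u_def sum_distrib_right
    by (simp add: mult_ac)
  then have "err p n m A (mprod r U (mprod r (deflate r P y) X))
      = vnorm p ({..<n} \<times> {..<m}) (\<lambda>x. (case x of (a, j) \<Rightarrow> A a j - mprod r U (mprod r P X) a j)
          + (case x of (a, j) \<Rightarrow> u a * (rowcomb r X y j / nsq r y)))"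
    unfolding err_def by (intro vnorm_cong) auto
  also have "\<dots> \<le> err p n m A (mprod r U (mprod r P X))
      + vnorm p ({..<n} \<times> {..<m}) (\<lambda>(a, j). u a * (rowcomb r X y j / nsq r y))"
    unfolding err_def by (rule vnorm_triangle[OF p])
  also have "vnorm p ({..<n} \<times> {..<m}) (\<lambda>(a, j). u a * (rowcomb r X y j / nsq r y))
      = vnorm p {..<n} u * (vnorm p {..<m} (rowcomb r X y) / nsq r y)"
    unfolding vnorm_outer[OF p] using vnorm_cmult[OF p, of "{..<m}" "1 / nsq r y" "rowcomb r X y"] N1 by simp
  also have "\<dots> \<le> (real r * nsq r y) * (vnorm p {..<m} (rowcomb r X y) / nsq r y)"
    using N1 u by (intro mult_right_mono) auto
  also have "\<dots> = real r * vnorm p {..<m} (rowcomb r X y)"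
    using N1 by simp
  finally show ?thesis by simp
qed

lemma phase2_start:
  assumes "err p n m A (mprod r U X) \<le> \<eta>" "\<And>i j. i < r \<Longrightarrow> j < r \<Longrightarrow> P i j = (if i = j then 1 else 0)"
  shows "phase2_inv p n m r A U X \<eta> \<delta> 0 P"
proof -
  have id: "(\<Sum>h<r. P i h * f h) = f i" if "i < r" for i f
  proof -
    have "(\<Sum>h<r. P i h * f h) = (\<Sum>h<r. if h = i then f h else 0)"
      using assms(2)[OF that] by (intro sum.cong) auto
    then show ?thesis using that by simp
  qed
  have "mprod r U (mprod r P X) = mprod r U X"
    unfolding mprod_def using id by (intro ext sum.cong) auto
  then show ?thesis
    unfolding phase2_inv_def using assms id by (auto simp: proj_def trace_def)
qed

text \<open>\<open>opt\<close> says that \<delta> is at least the infimum of the rank k errors. The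
  estimate is therefore proved against an arbitrary rank k product, and no optimal one has to be
  chosen.\<close>

lemma phase2_step:
  assumes separated: "\<And>i. i < r \<Longrightarrow> separated p n r i U"
    and norm: "\<And>i. i < r \<Longrightarrow> colnorm p n U i = 1 \<or> colnorm p n U i = 0 \<and> (\<forall>j<m. X i j = 0)"
    and UX: "err p n m A (mprod r U X) \<le> \<eta>"
    and opt: "\<And>z. (\<And>Us Vs. z \<le> err p n m A (mprod k Us Vs)) \<Longrightarrow> z \<le> \<delta>"
    and inv: "phase2_inv p n m r A U X \<eta> \<delta> s P" and s: "s < r - k"
    and best: "best_upto p m r X P r y v"
  shows "phase2_inv p n m r A U X \<eta> \<delta> (Suc s) (deflate r P y)"
proof -
  have P: "proj r P" and tr: "trace r P = real r - real s"
    using inv by (auto simp: phase2_inv_def)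
  have tr': "real k + 1 \<le> trace r P" using s by (simp add: tr)
  have norm': "colnorm p n U i = 1 \<or> (\<forall>j<m. X i j = 0)" if "i < r" for i
    using norm[OF that] by blast
  note thin = thin_direction[OF separated norm' UX P tr']
  have y: "in_range r P y" "\<exists>l<r. y l = 1" "v = vnorm p {..<m} (rowcomb r X y)"
    "\<forall>i'<r. 0 < P i' i' \<longrightarrow> (\<forall>w. v \<le> vnorm p {..<m} (rowcomb r X (candidate r P i' w)))"
  proof -
    \<comment> \<open>The zero product is used only to see that some position is admissible, which
      excludes the value -1.\<close>
    obtain i z where "i < r" "in_range r P z" "z i = 1"
      using thin[of "\<lambda>_ _. 0" "\<lambda>_ _. 0"] by blast
    then have "0 < P i i" using in_range_diag_pos[OF P, of z i] by simp
    then show "in_range r P y" "\<exists>l<r. y l = 1" "v = vnorm p {..<m} (rowcomb r X y)"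
      "\<forall>i'<r. 0 < P i' i' \<longrightarrow> (\<forall>w. v \<le> vnorm p {..<m} (rowcomb r X (candidate r P i' w)))"
      using best \<open>i < r\<close> unfolding best_upto_def by blast+
  qed
  have r0: "0 < real r" using s by simp
  have "v / (2 * real r) - \<eta> \<le> \<delta>"
  proof (rule opt)
    fix Us Vs
    obtain i z where i: "i < r" and z: "in_range r P z" "z i = 1"
      and le: "vnorm p {..<m} (rowcomb r X z) \<le> 2 * real r * (\<eta> + err p n m A (mprod k Us Vs))"
      using thin by blast
    have pos: "0 < P i i" using in_range_diag_pos[OF P z(1) i] z(2) by simp
    have "rowcomb r X (candidate r P i z) = rowcomb r X z"
      using candidate_complete[OF P i pos z] by (simp add: rowcomb_def[abs_def])
    then have "v \<le> 2 * real r * (\<eta> + err p n m A (mprod k Us Vs))"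
      using y(4) i pos le by (metis order_trans)
    then have "v / (2 * real r) \<le> \<eta> + err p n m A (mprod k Us Vs)"
      using r0 by (simp add: divide_le_eq mult.commute)
    then show "v / (2 * real r) - \<eta> \<le> err p n m A (mprod k Us Vs)" by simp
  qed
  then have v: "v \<le> 2 * real r * (\<eta> + \<delta>)"
    using r0 by (simp add: field_simps)
  obtain l where "l < r" "y l = 1" using y(2) by blast
  then have nz: "nsq r y \<noteq> 0" using nsq_eq_0D[of r y l] by auto
  have "colnorm p n U i \<le> 1" if "i < r" for i using norm[OF that] by auto
  then have "err p n m A (mprod r U (mprod r (deflate r P y) X))
      \<le> err p n m A (mprod r U (mprod r P X)) + real r * v"
    unfolding y(3) by (rule deflate_err) (use y(2) in auto)
  also have "\<dots> \<le> \<eta> + real s * (2 * (real r)\<^sup>2 * (\<eta> + \<delta>)) + real r * (2 * real r * (\<eta> + \<delta>))"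
    using inv v r0 unfolding phase2_inv_def by (intro add_mono mult_left_mono) auto
  finally show ?thesis
    unfolding phase2_inv_def using proj_deflate[OF P y(1) nz] trace_deflate[OF nz, of P]
    by (simp add: tr power2_eq_square algebra_simps)
qed

end

section \<open>Factoring a projection into rank one pieces\<close>

definition phase3_inv :: "nat \<Rightarrow> nat \<Rightarrow> (nat \<Rightarrow> nat \<Rightarrow> real) \<Rightarrow> (nat \<Rightarrow> nat \<Rightarrow> real) \<Rightarrow> nat \<Rightarrow> nat \<Rightarrow>
    (nat \<Rightarrow> nat \<Rightarrow> real) \<Rightarrow> (nat \<Rightarrow> nat \<Rightarrow> real) \<Rightarrow> bool" where
  "phase3_inv n r U P0 l c P W \<longleftrightarrow> proj r P \<and> (\<forall>i<l. P i i = 0) \<and> trace r P0 = trace r P + real c \<and>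
     (\<forall>a t. c \<le> t \<longrightarrow> W a t = 0) \<and>
     (\<exists>b. (\<forall>i<r. \<forall>j<r. P0 i j = P i j + (\<Sum>t<c. b t i * b t j / nsq r (b t))) \<and>
          (\<forall>a<n. \<forall>t<c. W a t = (\<Sum>h<r. U a h * b t h)))"

lemma phase3_start: "proj r P \<Longrightarrow> phase3_inv n r U P 0 0 P (\<lambda>_ _. 0)"
  by (simp add: phase3_inv_def)

lemma phase3_skip: "phase3_inv n r U P0 l c P W \<Longrightarrow> l < r \<Longrightarrow> \<not> 0 < P l l \<Longrightarrow> phase3_inv n r U P0 (Suc l) c P W"
  unfolding phase3_inv_def using proj_diag_nonneg[of r P l] by (auto simp: less_Suc_eq)

text \<open>Column l of a projection lies in its range and has squared norm \<open>P l l\<close>, so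
  deflating by it clears the diagonal entry l. Earlier zero diagonal entries stay zero, since there
  column l vanishes as well.\<close>

lemma phase3_step:
  assumes inv: "phase3_inv n r U P0 l c P W" and l: "l < r" and pos: "0 < P l l"
    and y: "\<And>h. h < r \<Longrightarrow> y h = P h l"
    and W': "\<And>a t. W' a t = (if a < n \<and> t = c then \<Sum>h<r. U a h * y h else W a t)"
    and P': "\<And>i j. i < r \<Longrightarrow> j < r \<Longrightarrow> P' i j = deflate r P y i j"
  shows "phase3_inv n r U P0 (Suc l) (Suc c) P' W'"
proof -
  have P: "proj r P" and zero: "\<And>i. i < l \<Longrightarrow> P i i = 0" and tr: "trace r P0 = trace r P + real c"
    and W0: "\<And>a t. c \<le> t \<Longrightarrow> W a t = 0"
    using inv by (auto simp: phase3_inv_def)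
  obtain b where b: "\<And>i j. i < r \<Longrightarrow> j < r \<Longrightarrow> P0 i j = P i j + (\<Sum>t<c. b t i * b t j / nsq r (b t))"
      "\<And>a t. a < n \<Longrightarrow> t < c \<Longrightarrow> W a t = (\<Sum>h<r. U a h * b t h)"
    using inv unfolding phase3_inv_def by (elim conjE exE) (rule that; simp)
  have y_range: "in_range r P y"
    using proj_col_in_range[OF P l] y by (simp add: in_range_def)
  have N: "nsq r y = P l l"
    using proj_diag[OF P l] y by (simp add: nsq_def)
  then have nz: "nsq r y \<noteq> 0" using pos by simp
  have proj': "proj r P'"
    using proj_deflate[OF P y_range nz] P' by (rule proj_cong)
  have tr': "trace r P' = trace r P - 1"
    using trace_deflate[OF nz, of P] P' by (simp add: trace_def)
  have zero': "P' i i = 0" if "i < Suc l" for i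
  proof (cases "i = l")
    case True
    then show ?thesis using P' y l N pos by (simp add: deflate_def)
  next
    case False
    then have "i < l" using that by simp
    then have "y i = 0"
      using proj_diag_0D[OF P, of i l] proj_sym[OF P, of i l] zero[of i] y[of i] l by simp
    then show ?thesis using P' zero[of i] \<open>i < l\<close> l by (simp add: deflate_def)
  qed
  define b' where "b' t = (if t = c then y else b t)" for t
  have "P0 i j = P' i j + (\<Sum>t<Suc c. b' t i * b' t j / nsq r (b' t))" if "i < r" "j < r" for i j
  proof -
    have "(\<Sum>t<c. b' t i * b' t j / nsq r (b' t)) = (\<Sum>t<c. b t i * b t j / nsq r (b t))"
      by (intro sum.cong) (auto simp: b'_def)
    then show ?thesis using b(1)[OF that] P'[OF that] by (simp add: deflate_def b'_def)
  qed
  moreover have "W' a t = (\<Sum>h<r. U a h * b' t h)" if "a < n" "t < Suc c" for a t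
    using that b(2) by (auto simp: W' b'_def)
  moreover have "\<forall>a t. Suc c \<le> t \<longrightarrow> W' a t = 0" using W0 by (simp add: W')
  ultimately show ?thesis
    unfolding phase3_inv_def using proj' zero' tr tr' by auto
qed

text \<open>A projection with zero diagonal is zero, so \<open>P0\<close> is the sum of the c
  pieces, and comparing traces gives c \<le> k. The remaining columns of \<open>W\<close> are zero
  and pad the product to k.\<close>

lemma phase3_final:
  assumes inv: "phase3_inv n r U P0 r c P W" and tr: "trace r P0 \<le> real k"
  shows "\<exists>Z. \<forall>a<n. \<forall>j. mprod r U (mprod r P0 X) a j = mprod k W Z a j"
proof -
  have P: "proj r P" and zero: "\<And>i. i < r \<Longrightarrow> P i i = 0" and tr0: "trace r P0 = trace r P + real c"
    and W0: "\<And>a t. c \<le> t \<Longrightarrow> W a t = 0"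
    using inv by (auto simp: phase3_inv_def)
  obtain b where b: "\<And>i j. i < r \<Longrightarrow> j < r \<Longrightarrow> P0 i j = P i j + (\<Sum>t<c. b t i * b t j / nsq r (b t))"
      "\<And>a t. a < n \<Longrightarrow> t < c \<Longrightarrow> W a t = (\<Sum>h<r. U a h * b t h)"
    using inv unfolding phase3_inv_def by (elim conjE exE) (rule that; simp)
  have "trace r P = 0" using zero by (simp add: trace_def)
  then have ck: "c \<le> k" using tr tr0 by simp
  have P0: "P0 i j = (\<Sum>t<c. b t i * b t j / nsq r (b t))" if "i < r" "j < r" for i j
    using b(1)[OF that] proj_diag_0D[OF P that(2,1)] zero[OF that(2)] by simp
  define Z where "Z t j = rowcomb r X (b t) j / nsq r (b t)" for t j
  have "mprod r U (mprod r P0 X) a j = mprod k W Z a j" if a: "a < n" for a j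
  proof -
    have inner: "mprod r P0 X i j = (\<Sum>t<c. b t i * Z t j)" if "i < r" for i
    proof -
      have "mprod r P0 X i j = (\<Sum>l<r. \<Sum>t<c. b t i * b t l / nsq r (b t) * X l j)"
        unfolding mprod_def using P0[OF that] by (simp add: sum_distrib_right)
      also have "\<dots> = (\<Sum>t<c. \<Sum>l<r. b t i * b t l / nsq r (b t) * X l j)"
        by (rule sum.swap)
      also have "\<dots> = (\<Sum>t<c. b t i * Z t j)"
        unfolding Z_def rowcomb_def sum_divide_distrib sum_distrib_left by (simp add: mult_ac)
      finally show ?thesis .
    qed
    have "mprod r U (mprod r P0 X) a j = (\<Sum>i<r. \<Sum>t<c. U a i * (b t i * Z t j))"
      unfolding mprod_def[of r U] using inner by (simp add: sum_distrib_left)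
    also have "\<dots> = (\<Sum>t<c. \<Sum>i<r. U a i * (b t i * Z t j))" by (rule sum.swap)
    also have "\<dots> = (\<Sum>t<c. W a t * Z t j)"
      using b(2)[OF a] by (simp add: sum_distrib_right mult.assoc)
    also have "\<dots> = mprod k W Z a j"
      unfolding mprod_def using ck W0 by (intro sum.mono_neutral_left) auto
    finally show ?thesis .
  qed
  then show ?thesis by blast
qed

section \<open>A program logic with running time\<close>

primrec imods :: "com \<Rightarrow> nat set" where
  "imods Skip = {}"
| "imods (IAssign x e f) = {x}"
| "imods (RAssign x e f a) = {}"
| "imods (Seq P Q) = imods P \<union> imods Q"
| "imods (If b P Q) = imods P \<union> imods Q"
| "imods (While b P) = imods P"
| "imods (Regress x v b d ea ec el) = {}"

primrec rmods :: "com \<Rightarrow> nat set" where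
  "rmods Skip = {}"
| "rmods (IAssign x e f) = {}"
| "rmods (RAssign x e f a) = {x}"
| "rmods (Seq P Q) = rmods P \<union> rmods Q"
| "rmods (If b P Q) = rmods P \<union> rmods Q"
| "rmods (While b P) = rmods P"
| "rmods (Regress x v b d ea ec el) = {x, v}"

definition frame :: "com \<Rightarrow> store \<Rightarrow> store \<Rightarrow> bool" where
  "frame c s s' \<longleftrightarrow> (\<forall>x. x \<notin> imods c \<longrightarrow> ints s' x = ints s x) \<and> (\<forall>x. x \<notin> rmods c \<longrightarrow> reals s' x = reals s x)"

lemma frame_ints: "frame c s s' \<Longrightarrow> x \<notin> imods c \<Longrightarrow> ints s' x = ints s x"
  and frame_reals: "frame c s s' \<Longrightarrow> x \<notin> rmods c \<Longrightarrow> reals s' x = reals s x"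
  by (auto simp: frame_def)

lemma frame_refl: "frame c s s"
  by (simp add: frame_def)

lemma frame_trans: "frame c s s' \<Longrightarrow> frame d s' s'' \<Longrightarrow> imods c \<subseteq> imods d \<Longrightarrow> rmods c \<subseteq> rmods d \<Longrightarrow> frame d s s''"
  unfolding frame_def by (metis subsetD)

lemma ints_set_int [simp]: "ints (set_int x i v s) = (ints s)(x := (ints s x)(i := v))"
  and reals_set_int [simp]: "reals (set_int x i v s) = reals s"
  and ints_set_real [simp]: "ints (set_real x i j w s) = ints s"
  and reals_set_real [simp]: "reals (set_real x i j w s) = (reals s)(x := (reals s x)(i := (reals s x i)(j := w)))"
  and ints_set_mat [simp]: "ints (set_mat x M s) = ints s"
  and reals_set_mat [simp]: "reals (set_mat x M s) = (reals s)(x := (\<lambda>i j.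
     if i < dim_row M \<and> j < dim_col M then M $$ (i, j) else reals s x i j))"
  by (simp_all add: set_int_def set_real_def set_mat_def)

lemma exec_frame: "exec S c s t s' \<Longrightarrow> frame c s s'"
  by (induction rule: exec.induct) (auto simp: frame_def)

text \<open>
  Every loop of the algorithm runs at most \<open>K\<close> times and every regression has dimensions at
  most \<open>K\<close>, so a bound for the running time can be read off the syntax.
\<close>

primrec cost :: "nat \<Rightarrow> com \<Rightarrow> nat" where
  "cost K Skip = 1"
| "cost K (IAssign x e f) = 1"
| "cost K (RAssign x e f a) = 1"
| "cost K (Seq P Q) = cost K P + cost K Q"
| "cost K (If b P Q) = 1 + cost K P + cost K Q"
| "cost K (While b P) = 1 + K * (1 + cost K P)"
| "cost K (Regress x v b d ea ec el) = 1 + 3 * (K * K)"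

text \<open>Functions bounded by some \<open>e * K ^ e\<close> are closed under sums and under
  multiplication by \<open>K\<close>, and \<open>cost\<close> is built from 1 by these
  operations.\<close>

lemma cost_polynomial: "\<exists>e. \<forall>K\<ge>1. cost K c \<le> e * K ^ e"
proof -
  have mono: "a * K ^ a \<le> b * K ^ b" if "a \<le> b" "1 \<le> K" for a b K :: nat
    using that by (intro mult_le_mono power_increasing) auto
  have one: "\<exists>e. \<forall>K\<ge>1. (1 :: nat) \<le> e * K ^ e"
    by (rule exI[of _ 1]) simp
  have plus: "\<exists>e. \<forall>K\<ge>1. f K + g K \<le> e * K ^ e"
    if fg: "\<exists>e. \<forall>K\<ge>1. f K \<le> e * K ^ e" "\<exists>e. \<forall>K\<ge>1. g K \<le> e * K ^ e" for f g :: "nat \<Rightarrow> nat"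
  proof -
    obtain a b where ab: "\<forall>K\<ge>1. f K \<le> a * K ^ a" "\<forall>K\<ge>1. g K \<le> b * K ^ b" using fg by blast
    have "f K + g K \<le> (a + b) * K ^ (a + b)" if K: "K \<ge> 1" for K
    proof -
      have "f K + g K \<le> a * K ^ a + b * K ^ b" using ab K by (intro add_mono) auto
      also have "\<dots> \<le> a * K ^ (a + b) + b * K ^ (a + b)"
        using K by (intro add_mono mult_left_mono power_increasing) auto
      finally show ?thesis by (simp add: distrib_right)
    qed
    then show ?thesis by blast
  qed
  have times: "\<exists>e. \<forall>K\<ge>1. K * f K \<le> e * K ^ e" if f: "\<exists>e. \<forall>K\<ge>1. f K \<le> e * K ^ e" for f :: "nat \<Rightarrow> nat"
  proof -
    obtain a where a: "\<forall>K\<ge>1. f K \<le> a * K ^ a" using f by blast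
    have "K * f K \<le> Suc a * K ^ Suc a" if K: "K \<ge> 1" for K
    proof -
      have "K * f K \<le> K * (a * K ^ a)" using a K by simp
      also have "\<dots> \<le> Suc a * K ^ Suc a" by simp
      finally show ?thesis .
    qed
    then show ?thesis by blast
  qed
  show ?thesis
  proof (induction c)
    case (Regress x v b d ea ec el)
    have "\<exists>e. \<forall>K\<ge>1. 1 + (K * (K * 1) + (K * (K * 1) + K * (K * 1))) \<le> e * K ^ e"
      by (intro plus times one)
    moreover have "1 + (K * (K * 1) + (K * (K * 1) + K * (K * 1))) = cost K (Regress x v b d ea ec el)" for K
      by simp
    ultimately show ?case by (simp only:)
  qed (simp_all only: cost.simps, intro plus times one; assumption?)+
qed

text \<open>Total correctness with a time bound. One terminating run is enough because execution is
  deterministic.\<close>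

definition wp :: "solver \<Rightarrow> nat \<Rightarrow> com \<Rightarrow> (store \<Rightarrow> bool) \<Rightarrow> store \<Rightarrow> bool" where
  "wp S K c Q s \<longleftrightarrow> (\<exists>t s'. exec S c s t s' \<and> t \<le> cost K c \<and> Q s')"

text \<open>The frame comes for free from every execution, so specifications need only mention what
  a program changes.\<close>

lemma wp_conseq:
  assumes "wp S K c Q s" "\<And>s'. Q s' \<Longrightarrow> frame c s s' \<Longrightarrow> Q' s'"
  shows "wp S K c Q' s"
  using assms exec_frame unfolding wp_def by blast

lemma wp_Skip: "Q s \<Longrightarrow> wp S K Skip Q s"
  unfolding wp_def by (rule exI[of _ 1]) (auto intro!: exec.Skip[simplified] exI)

lemma wp_IAssign: "Q (set_int x (ival e s) (ival f s) s) \<Longrightarrow> wp S K (IAssign x e f) Q s"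
  unfolding wp_def by (rule exI[of _ 1]) (auto intro!: exec.IAssign[simplified] exI)

lemma wp_RAssign: "Q (set_real x (ival e s) (ival f s) (rval a s) s) \<Longrightarrow> wp S K (RAssign x e f a) Q s"
  unfolding wp_def by (rule exI[of _ 1]) (auto intro!: exec.RAssign[simplified] exI)

lemma wp_Seq:
  assumes "wp S K P (\<lambda>s'. wp S K R Q s') s"
  shows "wp S K (Seq P R) Q s"
proof -
  obtain t s' t' s'' where "exec S P s t s'" "t \<le> cost K P" "exec S R s' t' s''" "t' \<le> cost K R" "Q s''"
    using assms unfolding wp_def by blast
  then show ?thesis
    unfolding wp_def by (intro exI[of _ "t + t'"] exI[of _ s'']) (auto intro: exec.Seq)
qed

lemma wp_If:
  assumes "bval b s \<Longrightarrow> wp S K P Q s" "\<not> bval b s \<Longrightarrow> wp S K R Q s"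
  shows "wp S K (If b P R) Q s"
proof (cases "bval b s")
  case True
  then obtain t s' where "exec S P s t s'" "t \<le> cost K P" "Q s'"
    using assms(1) unfolding wp_def by blast
  then show ?thesis
    unfolding wp_def using exec.IfTrue[OF True] by (intro exI[of _ "1 + t"] exI[of _ s']) simp
next
  case False
  then obtain t s' where "exec S R s t s'" "t \<le> cost K R" "Q s'"
    using assms(2) unfolding wp_def by blast
  then show ?thesis
    unfolding wp_def using exec.IfFalse[OF False] by (intro exI[of _ "1 + t"] exI[of _ s']) simp
qed

abbreviation iv :: "nat \<Rightarrow> iexp" where
  "iv x \<equiv> IGet x (INum 0)"

definition For :: "nat \<Rightarrow> iexp \<Rightarrow> com \<Rightarrow> com" where
  "For v e c = Seq (IAssign v (INum 0) (INum 0))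
     (While (ILess (iv v) e) (Seq c (IAssign v (INum 0) (IAdd (iv v) (INum 1)))))"

lemma imods_For [simp]: "imods (For v e c) = insert v (imods c)"
  and rmods_For [simp]: "rmods (For v e c) = rmods c"
  by (auto simp: For_def)

text \<open>The bound \<open>e\<close> is evaluated anew before every round, so it must have the
  same value in all stores that respect the frame. The invariant is required after the increment of
  the counter.\<close>

lemma wp_For:
  assumes v: "v \<notin> imods c" and N: "N \<le> K"
    and start: "I 0 (set_int v 0 0 s)"
    and bound: "\<And>s'. frame (For v e c) s s' \<Longrightarrow> ival e s' = N"
    and step: "\<And>i s'. i < N \<Longrightarrow> I i s' \<Longrightarrow> ints s' v 0 = i \<Longrightarrow> frame (For v e c) s s' \<Longrightarrow>
       wp S K c (\<lambda>s''. I (Suc i) (set_int v 0 (Suc i) s'')) s'"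
    and post: "\<And>s'. I N s' \<Longrightarrow> frame (For v e c) s s' \<Longrightarrow> Q s'"
  shows "wp S K (For v e c) Q s"
proof -
  let ?F = "For v e c"
  let ?B = "Seq c (IAssign v (INum 0) (IAdd (iv v) (INum 1)))"
  let ?W = "While (ILess (iv v) e) ?B"
  \<comment> \<open>Induction on the number \<open>d\<close> of rounds still to come.\<close>
  have loop: "\<exists>t s''. exec S ?W s' t s'' \<and> t \<le> 1 + d * (1 + cost K ?B) \<and> I N s'' \<and> frame ?F s s''"
    if "I (N - d) s'" "d \<le> N" "ints s' v 0 = N - d" "frame ?F s s'" for d s'
    using that
  proof (induction d arbitrary: s')
    case 0
    then have "\<not> bval (ILess (iv v) e) s'" using bound by simp
    then have "exec S ?W s' 1 s'" by (rule exec.WhileFalse)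
    then show ?case using 0 by (intro exI[of _ 1] exI[of _ s']) simp
  next
    case (Suc d)
    let ?i = "N - Suc d"
    have i: "?i < N" "Suc ?i = N - d" using Suc.prems by auto
    have b: "bval (ILess (iv v) e) s'" using bound Suc.prems by simp
    obtain t1 s1 where 1: "exec S c s' t1 s1" "t1 \<le> cost K c" "I (Suc ?i) (set_int v 0 (Suc ?i) s1)"
      using step[OF i(1) Suc.prems(1,3,4)] unfolding wp_def by blast
    have "ints s1 v 0 = ?i"
      using exec_frame[OF 1(1)] v Suc.prems(3) by (simp add: frame_ints)
    then have B: "exec S ?B s' (t1 + 1) (set_int v 0 (Suc ?i) s1)"
      using exec.Seq[OF 1(1) exec.IAssign[of S v "INum 0" "IAdd (iv v) (INum 1)"]] by simp
    have "frame ?F s (set_int v 0 (Suc ?i) s1)"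
      using frame_trans[OF Suc.prems(4) exec_frame[OF B]] Suc.prems(4) exec_frame[OF B]
      by (auto simp: frame_def)
    then obtain t2 s2 where 2: "exec S ?W (set_int v 0 (Suc ?i) s1) t2 s2"
        "t2 \<le> 1 + d * (1 + cost K ?B)" "I N s2" "frame ?F s s2"
      using Suc.IH[of "set_int v 0 (Suc ?i) s1"] 1(3) i Suc.prems(2) by auto
    have "exec S ?W s' (1 + (t1 + 1) + t2) s2"
      by (rule exec.WhileTrue[OF b B 2(1)])
    moreover have "1 + (t1 + 1) + t2 \<le> 1 + Suc d * (1 + cost K ?B)"
      using 1(2) 2(2) by simp
    ultimately show ?case using 2(3,4) by blast
  qed
  have "frame ?F s (set_int v 0 0 s)" by (simp add: frame_def)
  then obtain t s' where t: "exec S ?W (set_int v 0 0 s) t s'" "t \<le> 1 + N * (1 + cost K ?B)" "I N s'" "frame ?F s s'"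
    using loop[of N "set_int v 0 0 s"] start by auto
  have "exec S ?F s (1 + t) s'"
    unfolding For_def using exec.Seq[OF exec.IAssign[of S v "INum 0" "INum 0" s]] t(1) by simp
  moreover have "1 + t \<le> cost K ?F"
    using t(2) mult_le_mono1[OF N, of "1 + cost K ?B"] by (simp add: For_def)
  ultimately show ?thesis unfolding wp_def using post[OF t(3,4)] by blast
qed

text \<open>\<open>B\<close> selects the columns that are overwritten: a single one when a vector is
  stored, an initial block when a matrix is.\<close>

lemma wp_For_rows:
  assumes v: "v \<notin> imods c" and N: "N \<le> K"
    and bound: "\<And>s'. frame (For v e c) s s' \<Longrightarrow> ival e s' = N"
    and body: "\<And>i s'. i < N \<Longrightarrow> ints s' v 0 = i \<Longrightarrow> frame (For v e c) s s' \<Longrightarrow>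
       reals s' x = (\<lambda>a b. if a < i \<and> B b then g a b else reals s x a b) \<Longrightarrow>
       wp S K c (\<lambda>s''. reals s'' x = (\<lambda>a b. if a = i \<and> B b then g a b else reals s' x a b)) s'"
    and post: "\<And>s'. frame (For v e c) s s' \<Longrightarrow>
       reals s' x = (\<lambda>a b. if a < N \<and> B b then g a b else reals s x a b) \<Longrightarrow> Q s'"
  shows "wp S K (For v e c) Q s"
proof (rule wp_For[where N = N and I = "\<lambda>i s'. reals s' x = (\<lambda>a b. if a < i \<and> B b then g a b else reals s x a b)"])
  fix i s' assume i: "i < N" "reals s' x = (\<lambda>a b. if a < i \<and> B b then g a b else reals s x a b)"
    "ints s' v 0 = i" "frame (For v e c) s s'"
  show "wp S K c (\<lambda>s''. reals (set_int v 0 (Suc i) s'') x =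
      (\<lambda>a b. if a < Suc i \<and> B b then g a b else reals s x a b)) s'"
    by (rule wp_conseq[OF body[OF i(1,3,4,2)]]) (auto simp: i(2) fun_eq_iff less_Suc_eq)
qed (use assms in auto)

lemma wp_For_cols:
  assumes v: "v \<notin> imods c" and N: "N \<le> K"
    and bound: "\<And>s'. frame (For v e c) s s' \<Longrightarrow> ival e s' = N"
    and body: "\<And>j s'. j < N \<Longrightarrow> ints s' v 0 = j \<Longrightarrow> frame (For v e c) s s' \<Longrightarrow>
       reals s' x = (\<lambda>a b. if a = i \<and> b < j then g b else reals s x a b) \<Longrightarrow>
       wp S K c (\<lambda>s''. reals s'' x = (\<lambda>a b. if a = i \<and> b = j then g b else reals s' x a b)) s'"
    and post: "\<And>s'. frame (For v e c) s s' \<Longrightarrow>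
       reals s' x = (\<lambda>a b. if a = i \<and> b < N then g b else reals s x a b) \<Longrightarrow> Q s'"
  shows "wp S K (For v e c) Q s"
proof (rule wp_For[where N = N and I = "\<lambda>j s'. reals s' x = (\<lambda>a b. if a = i \<and> b < j then g b else reals s x a b)"])
  fix j s' assume j: "j < N" "reals s' x = (\<lambda>a b. if a = i \<and> b < j then g b else reals s x a b)"
    "ints s' v 0 = j" "frame (For v e c) s s'"
  show "wp S K c (\<lambda>s''. reals (set_int v 0 (Suc j) s'') x =
      (\<lambda>a b. if a = i \<and> b < Suc j then g b else reals s x a b)) s'"
    by (rule wp_conseq[OF body[OF j(1,3,4,2)]]) (auto simp: j(2) fun_eq_iff less_Suc_eq)
qed (use assms in auto)

lemma wp_RAssign_entry:
  assumes "ival e s = i" "ival f s = j" "rval a s = w"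
  shows "wp S K (RAssign x e f a) (\<lambda>s'. reals s' x = (\<lambda>a b. if a = i \<and> b = j then w else reals s x a b)) s"
  using assms by (intro wp_RAssign) (auto simp: fun_eq_iff)

definition SumAssign :: "nat \<Rightarrow> iexp \<Rightarrow> iexp \<Rightarrow> rexp \<Rightarrow> nat \<Rightarrow> iexp \<Rightarrow> rexp \<Rightarrow> com" where
  "SumAssign x e f a0 v bnd a = Seq (RAssign x e f a0) (For v bnd (RAssign x e f (RAdd (RGet x e f) a)))"

lemma imods_SumAssign [simp]: "imods (SumAssign x e f a0 v bnd a) = {v}"
  and rmods_SumAssign [simp]: "rmods (SumAssign x e f a0 v bnd a) = {x}"
  by (auto simp: SumAssign_def)

text \<open>The sum accumulates in its target, and the frame leaves array x arbitrary; so the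
  summand must not depend on x, whereas the initial value \<open>a0\<close> may.\<close>

lemma wp_SumAssign:
  assumes N: "N \<le> K"
    and ef: "\<And>s'. frame (SumAssign x e f a0 v bnd a) s s' \<Longrightarrow> ival e s' = i \<and> ival f s' = j \<and> ival bnd s' = N"
    and a0: "rval a0 s = w"
    and a: "\<And>h s'. h < N \<Longrightarrow> ints s' v 0 = h \<Longrightarrow> frame (SumAssign x e f a0 v bnd a) s s' \<Longrightarrow> rval a s' = g h"
  shows "wp S K (SumAssign x e f a0 v bnd a)
    (\<lambda>s'. reals s' x = (\<lambda>a b. if a = i \<and> b = j then w + (\<Sum>h<N. g h) else reals s x a b)) s"
proof -
  let ?c = "SumAssign x e f a0 v bnd a"
  let ?F = "For v bnd (RAssign x e f (RAdd (RGet x e f) a))"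
  let ?s0 = "set_real x i j w s"
  have fr: "frame ?c s s'" if "frame ?F ?s0 s'" for s'
    using that by (auto simp: frame_def)
  have "wp S K ?F (\<lambda>s'. reals s' x = (\<lambda>a b. if a = i \<and> b = j then w + (\<Sum>h<N. g h) else reals s x a b)) ?s0"
  proof (rule wp_For[where N = N and I = "\<lambda>l s'. reals s' x = (\<lambda>a b. if a = i \<and> b = j then w + (\<Sum>h<l. g h) else reals s x a b)"])
    fix l s' assume l: "l < N" "ints s' v 0 = l" "frame ?F ?s0 s'"
      and x: "reals s' x = (\<lambda>a b. if a = i \<and> b = j then w + (\<Sum>h<l. g h) else reals s x a b)"
    have "ival e s' = i" "ival f s' = j" "rval a s' = g l"
      using ef[OF fr[OF l(3)]] a[OF l(1,2) fr[OF l(3)]] by auto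
    then show "wp S K (RAssign x e f (RAdd (RGet x e f) a)) (\<lambda>s''. reals (set_int v 0 (Suc l) s'') x =
        (\<lambda>a b. if a = i \<and> b = j then w + (\<Sum>h<Suc l. g h) else reals s x a b)) s'"
      by (intro wp_RAssign) (auto simp: fun_eq_iff x)
  qed (use N ef fr in \<open>auto simp: fun_eq_iff\<close>)
  moreover have "ival e s = i" "ival f s = j" using ef[OF frame_refl] by auto
  ultimately show ?thesis
    unfolding SumAssign_def by (intro wp_Seq wp_RAssign) (simp add: a0)
qed

lemma index_mult_carrier:
  assumes "B \<in> carrier_mat a c" "X \<in> carrier_mat c l" "i < a" "j < l"
  shows "(B * X) $$ (i, j) = (\<Sum>h<c. B $$ (i, h) * X $$ (h, j))"
  using assms by (auto simp: scalar_prod_def lessThan_atLeast0 intro!: sum.cong)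

lemma lp_norm_residual:
  assumes "X \<in> carrier_mat c l"
  shows "lp_norm p (get_mat s b a c * X - get_mat s d a l)
    = vnorm p ({..<a} \<times> {..<l}) (\<lambda>(i, j). (\<Sum>h<c. reals s b i h * X $$ (h, j)) - reals s d i j)"
proof -
  have C: "get_mat s b a c * X - get_mat s d a l \<in> carrier_mat a l"
    by (auto simp: get_mat_def)
  have B: "get_mat s b a c \<in> carrier_mat a c" by (simp add: get_mat_def)
  have "(get_mat s b a c * X - get_mat s d a l) $$ (i, j)
      = (\<Sum>h<c. reals s b i h * X $$ (h, j)) - reals s d i j" if "i < a" "j < l" for i j
  proof -
    have "(get_mat s b a c * X - get_mat s d a l) $$ (i, j) = (get_mat s b a c * X) $$ (i, j) - reals s d i j"
      using that assms by (simp add: get_mat_def)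
    then show ?thesis
      unfolding index_mult_carrier[OF B assms that] using that by (simp add: get_mat_def)
  qed
  then show ?thesis
    unfolding lp_norm_eq_vnorm[OF C] by (intro vnorm_cong) auto
qed

text \<open>Only the minimality of the value is passed on, not how the solver chooses, so all
  consequences hold for every solver.\<close>

lemma wp_Regress:
  assumes S: "lp_regression_solver p S"
    and dims: "ival ea s = a" "ival ec s = c" "ival el s = l" "a \<le> K" "c \<le> K" "l \<le> K"
    and post: "\<And>X w s'. w = vnorm p ({..<a} \<times> {..<l}) (\<lambda>(i, j). (\<Sum>h<c. reals s b i h * X h j) - reals s d i j) \<Longrightarrow>
      (\<And>Y. w \<le> vnorm p ({..<a} \<times> {..<l}) (\<lambda>(i, j). (\<Sum>h<c. reals s b i h * Y h j) - reals s d i j)) \<Longrightarrow>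
      ints s' = ints s \<Longrightarrow>
      reals s' = (let f = (reals s)(x := (\<lambda>i j. if i < c \<and> j < l then X i j else reals s x i j))
                  in f(v := (f v)(0 := (f v 0)(0 := w)))) \<Longrightarrow>
      Q s'"
  shows "wp S K (Regress x v b d ea ec el) Q s"
proof -
  obtain X w where Xw: "(X, w) = S (get_mat s b a c) (get_mat s d a l)"
    by (metis surj_pair)
  have "get_mat s b a c \<in> carrier_mat a c" "get_mat s d a l \<in> carrier_mat a l"
    by (auto simp: get_mat_def)
  then have sol: "X \<in> carrier_mat c l" "w = lp_norm p (get_mat s b a c * X - get_mat s d a l)"
    "\<forall>Y\<in>carrier_mat c l. w \<le> lp_norm p (get_mat s b a c * Y - get_mat s d a l)"
    using S[unfolded lp_regression_solver_def] Xw by (metis fst_conv snd_conv)+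
  have e: "exec S (Regress x v b d ea ec el) s (1 + a * c + a * l + c * l) (set_real v 0 0 w (set_mat x X s))"
    using exec.Regress[of a ea s c ec l el X w S b d x v] dims Xw by simp
  have "Q (set_real v 0 0 w (set_mat x X s))"
  proof (rule post)
    show "w = vnorm p ({..<a} \<times> {..<l}) (\<lambda>(i, j). (\<Sum>h<c. reals s b i h * X $$ (h, j)) - reals s d i j)"
      unfolding sol(2) lp_norm_residual[OF sol(1)] ..
    fix Y :: "nat \<Rightarrow> nat \<Rightarrow> real"
    have Y: "mat c l (\<lambda>(i, j). Y i j) \<in> carrier_mat c l" by simp
    show "w \<le> vnorm p ({..<a} \<times> {..<l}) (\<lambda>(i, j). (\<Sum>h<c. reals s b i h * Y h j) - reals s d i j)"
      using sol(3)[rule_format, OF Y] unfolding lp_norm_residual[OF Y]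
      by (rule order_trans) (intro eq_refl vnorm_cong, auto)
  qed (use sol(1) in \<open>auto simp: Let_def fun_eq_iff\<close>)
  moreover have "1 + a * c + a * l + c * l \<le> cost K (Regress x v b d ea ec el)"
    using mult_le_mono[OF dims(4,5)] mult_le_mono[OF dims(4,6)] mult_le_mono[OF dims(5,6)] by simp
  ultimately show ?thesis unfolding wp_def using e by blast
qed

lemma vnorm_Times_single: "vnorm p (I \<times> {..<Suc 0}) F = vnorm p I (\<lambda>i. F (i, 0))"
proof -
  have "I \<times> {..<Suc 0} = (\<lambda>i. (i, 0)) ` I" by auto
  then show ?thesis
    unfolding vnorm_def by (simp add: sum.reindex inj_on_def)
qed

section \<open>Conditioning a basis by regression\<close>

declare One_nat_def [simp del] \<comment> \<open>array 1 is addressed by the numeral\<close>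

lemma wp_SeqI:
  assumes "wp S K P Q' s" "\<And>s'. Q' s' \<Longrightarrow> frame P s s' \<Longrightarrow> wp S K R Q s'"
  shows "wp S K (Seq P R) Q s"
  by (rule wp_Seq, rule wp_conseq[OF assms(1)]) (use assms(2) in blast)

lemma wp_Regress_vec:
  assumes S: "lp_regression_solver p S" and "x \<noteq> v" "1 \<le> K"
    and "ival ea s = a" "ival ec s = c" "a \<le> K" "c \<le> K"
  shows "wp S K (Regress x v b d ea ec (INum 1)) (\<lambda>s'.
     reals s' v 0 0 = vnorm p {..<a} (\<lambda>i. (\<Sum>h<c. reals s b i h * reals s' x h 0) - reals s d i 0) \<and>
     (\<forall>Y. reals s' v 0 0 \<le> vnorm p {..<a} (\<lambda>i. (\<Sum>h<c. reals s b i h * Y h) - reals s d i 0))) s"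
proof (rule wp_Regress[OF S, where a = a and c = c and l = 1])
  fix X w s'
  assume w: "w = vnorm p ({..<a} \<times> {..<1}) (\<lambda>(i, j). (\<Sum>h<c. reals s b i h * X h j) - reals s d i j)"
    "\<And>Y. w \<le> vnorm p ({..<a} \<times> {..<1}) (\<lambda>(i, j). (\<Sum>h<c. reals s b i h * Y h j) - reals s d i j)"
    and s': "reals s' = (let f = (reals s)(x := (\<lambda>i j. if i < c \<and> j < 1 then X i j else reals s x i j))
                  in f(v := (f v)(0 := (f v 0)(0 := w))))"
  have "reals s' v 0 0 = w" "reals s' x h 0 = X h 0" if "h < c" for h
    using that \<open>x \<noteq> v\<close> by (auto simp: s' Let_def)
  moreover have "reals s' v 0 0 = w" by (simp add: s' Let_def)
  moreover have "w \<le> vnorm p {..<a} (\<lambda>i. (\<Sum>h<c. reals s b i h * Y h) - reals s d i 0)" for Y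
    using w(2)[of "\<lambda>h j. Y h"] by (simp add: vnorm_Times_single[folded One_nat_def])
  ultimately show "reals s' v 0 0 = vnorm p {..<a} (\<lambda>i. (\<Sum>h<c. reals s b i h * reals s' x h 0) - reals s d i 0) \<and>
     (\<forall>Y. reals s' v 0 0 \<le> vnorm p {..<a} (\<lambda>i. (\<Sum>h<c. reals s b i h * Y h) - reals s d i 0))"
    using w(1) by (simp add: vnorm_Times_single[folded One_nat_def])
qed (use assms in auto)

text \<open>
  Real arrays: 0 holds \<open>A\<close>, 1 the basis \<open>U\<close>, which is modified in place, 3 and 4 the output,
  5 a column or right-hand side, 6 and 7 the solution and value of a regression, 8 a column norm,
  9 the coefficients \<open>X\<close>, 10 the projection \<open>P\<close>, 11 a regression matrix, 12 and 14 the best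
  direction found and its value, 13 a squared norm, 15 a pivot vector, 16 a deflated projection.
  Natural number arrays: 0 holds the sizes, 8 the number of columns written to the output, all
  others are loop counters.
\<close>

abbreviation en :: iexp where "en \<equiv> IGet 0 (INum 0)"
abbreviation em :: iexp where "em \<equiv> IGet 0 (INum 1)"
abbreviation er :: iexp where "er \<equiv> IGet 0 (INum 2)"
abbreviation ek :: iexp where "ek \<equiv> IGet 0 (INum 3)"
abbreviation rv :: "nat \<Rightarrow> rexp" where "rv x \<equiv> RGet x (INum 0) (INum 0)"
abbreviation rcol :: "nat \<Rightarrow> nat \<Rightarrow> rexp" where "rcol x v \<equiv> RGet x (iv v) (INum 0)"
abbreviation rmat :: "nat \<Rightarrow> nat \<Rightarrow> nat \<Rightarrow> rexp" where "rmat x v w \<equiv> RGet x (iv v) (iv w)"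

definition load_col :: com where
  "load_col = For 2 en (RAssign 5 (iv 2) (INum 0) (rmat 1 2 1))"

definition write_col :: "rexp \<Rightarrow> com" where
  "write_col a = For 2 en (RAssign 1 (iv 2) (iv 1) a)"

text \<open>A regression on no columns has only the empty solution; its value is the norm of the
  right-hand side.\<close>

definition col_norm :: com where
  "col_norm = Regress 6 8 1 5 en (INum 0) (INum 1)"

definition subtract_fit :: "iexp \<Rightarrow> com" where
  "subtract_fit ec = For 2 en (SumAssign 5 (iv 2) (INum 0) (rcol 5 2) 3 ec
     (RSub (RNum 0) (RMul (rmat 1 2 3) (rcol 6 3))))"

text \<open>A regression takes an initial block of columns, so column i is excluded by overwriting
  it with 0. Its copy in array 5 is the right-hand side and is written back afterwards, reduced or
  unchanged.\<close>

definition shrink_col :: "iexp \<Rightarrow> com" where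
  "shrink_col ec = Seq load_col (Seq (write_col (RNum 0)) (Seq col_norm
     (Seq (Regress 6 7 1 5 en ec (INum 1))
     (Seq (If (RLess (RMul (RNum 2) (rv 7)) (rv 8)) (subtract_fit ec) Skip)
     (write_col (rcol 5 2))))))"

lemma mods_col [simp]:
  "imods load_col = {2}" "rmods load_col = {5}"
  "imods (write_col a) = {2}" "rmods (write_col a) = {1}"
  "imods col_norm = {}" "rmods col_norm = {6, 8}"
  "imods (subtract_fit ec) = {2, 3}" "rmods (subtract_fit ec) = {5}"
  by (auto simp: load_col_def write_col_def col_norm_def subtract_fit_def)

lemma mods_shrink_col [simp]:
  "imods (shrink_col ec) = {2, 3}" "rmods (shrink_col ec) = {1, 5, 6, 7, 8}"
  by (auto simp: shrink_col_def)

lemma wp_load_col: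
  assumes "n \<le> K" "ints s 0 0 = n" "ints s 1 0 = i"
  shows "wp S K load_col (\<lambda>s'. reals s' 5 = (\<lambda>a b. if a < n \<and> b = 0 then reals s 1 a i else reals s 5 a b)) s"
  unfolding load_col_def
proof (rule wp_For_rows[where N = n and x = 5 and B = "\<lambda>b. b = 0" and g = "\<lambda>a b. reals s 1 a i"])
  fix a s' assume "ints s' 2 0 = a" and fr: "frame (For 2 en (RAssign 5 (iv 2) (INum 0) (rmat 1 2 1))) s s'"
  then show "wp S K (RAssign 5 (iv 2) (INum 0) (rmat 1 2 1))
      (\<lambda>s''. reals s'' 5 = (\<lambda>a' b. if a' = a \<and> b = 0 then reals s 1 a' i else reals s' 5 a' b)) s'"
    using assms by (intro wp_RAssign) (auto simp: fun_eq_iff frame_ints[OF fr] frame_reals[OF fr])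
qed (use assms in \<open>auto simp: frame_ints\<close>)

lemma wp_write_col:
  assumes "n \<le> K" "ints s 0 0 = n" "ints s 1 0 = i"
    and a: "\<And>a' s'. a' < n \<Longrightarrow> ints s' 2 0 = a' \<Longrightarrow> frame (write_col a) s s' \<Longrightarrow> reals s' 1 a' i = reals s 1 a' i \<Longrightarrow> rval a s' = g a'"
  shows "wp S K (write_col a) (\<lambda>s'. reals s' 1 = (\<lambda>a b. if a < n \<and> b = i then g a else reals s 1 a b)) s"
  unfolding write_col_def
proof (rule wp_For_rows[where N = n and x = 1 and B = "\<lambda>b. b = i" and g = "\<lambda>a b. g a"])
  fix a' s' assume a': "a' < n" "ints s' 2 0 = a'" and fr: "frame (For 2 en (RAssign 1 (iv 2) (iv 1) a)) s s'"
    and x: "reals s' 1 = (\<lambda>a b. if a < a' \<and> b = i then g a else reals s 1 a b)"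
  have "rval a s' = g a'"
    using a[OF a'] fr x unfolding write_col_def by simp
  then show "wp S K (RAssign 1 (iv 2) (iv 1) a)
      (\<lambda>s''. reals s'' 1 = (\<lambda>a b. if a = a' \<and> b = i then g a else reals s' 1 a b)) s'"
    using assms(3) a' by (intro wp_RAssign) (auto simp: fun_eq_iff frame_ints[OF fr])
qed (use assms in \<open>auto simp: frame_ints\<close>)

lemma wp_col_norm:
  assumes "lp_regression_solver p S" "n \<le> K" "1 \<le> K" "ints s 0 0 = n"
  shows "wp S K col_norm (\<lambda>s'. reals s' 8 0 0 = vnorm p {..<n} (\<lambda>a. reals s 5 a 0)) s"
  unfolding col_norm_def
  by (rule wp_conseq[OF wp_Regress_vec[OF assms(1), where a = n and c = 0]])
    (use assms in \<open>auto simp: vnorm_minus\<close>)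

lemma wp_subtract_fit:
  assumes "n \<le> K" "c \<le> K" "ints s 0 0 = n"
    and ec: "\<And>s'. ints s' 0 = ints s 0 \<Longrightarrow> ints s' 1 = ints s 1 \<Longrightarrow> ival ec s' = c"
  shows "wp S K (subtract_fit ec) (\<lambda>s'. reals s' 5 = (\<lambda>a b. if a < n \<and> b = 0
     then reals s 5 a 0 - (\<Sum>h<c. reals s 1 a h * reals s 6 h 0) else reals s 5 a b)) s"
  unfolding subtract_fit_def
proof (rule wp_For_rows[where N = n and x = 5 and B = "\<lambda>b. b = 0"
      and g = "\<lambda>a b. reals s 5 a 0 - (\<Sum>h<c. reals s 1 a h * reals s 6 h 0)"])
  let ?b = "SumAssign 5 (iv 2) (INum 0) (rcol 5 2) 3 ec (RSub (RNum 0) (RMul (rmat 1 2 3) (rcol 6 3)))"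
  fix a s' assume a: "a < n" "ints s' 2 0 = a" and fr: "frame (For 2 en ?b) s s'"
    and x: "reals s' 5 = (\<lambda>a' b. if a' < a \<and> b = 0
       then reals s 5 a' 0 - (\<Sum>h<c. reals s 1 a' h * reals s 6 h 0) else reals s 5 a' b)"
  show "wp S K ?b (\<lambda>s''. reals s'' 5 = (\<lambda>a' b. if a' = a \<and> b = 0
       then reals s 5 a' 0 - (\<Sum>h<c. reals s 1 a' h * reals s 6 h 0) else reals s' 5 a' b)) s'"
  proof (rule wp_conseq[OF wp_SumAssign[where N = c and i = a and j = 0 and w = "reals s 5 a 0"
          and g = "\<lambda>h. - (reals s 1 a h * reals s 6 h 0)"]])
    fix s'' assume fr': "frame ?b s' s''"
    show "ival (iv 2) s'' = a \<and> ival (INum 0) s'' = 0 \<and> ival ec s'' = c"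
      using ec[of s''] a by (simp add: frame_ints[OF fr'] frame_ints[OF fr])
  next
    fix h s'' assume "ints s'' 3 0 = h" and fr': "frame ?b s' s''"
    then show "rval (RSub (RNum 0) (RMul (rmat 1 2 3) (rcol 6 3))) s'' = - (reals s 1 a h * reals s 6 h 0)"
      using a by (simp add: frame_ints[OF fr'] frame_reals[OF fr'] frame_ints[OF fr] frame_reals[OF fr])
  qed (use assms a x in \<open>auto simp: sum_negf fun_eq_iff\<close>)
qed (use assms in \<open>auto simp: frame_ints\<close>)

lemma wp_shrink_col:
  assumes S: "lp_regression_solver p S" and "n \<le> K" "c \<le> K" "1 \<le> K"
    and s: "ints s 0 0 = n" "ints s 1 0 = i"
    and ec: "\<And>s'. ints s' 0 = ints s 0 \<Longrightarrow> ints s' 1 = ints s 1 \<Longrightarrow> ival ec s' = c"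
  shows "wp S K (shrink_col ec) (\<lambda>s'. shrunk p n c i (reals s 1) (reals s' 1)) s"
  unfolding shrink_col_def
proof (rule wp_SeqI[OF wp_load_col[OF assms(2) s]], goal_cases)
  case (1 s1)
  note f1 = frame_ints[OF 1(2)] frame_reals[OF 1(2)]
  show ?case
  proof (rule wp_SeqI[OF wp_write_col[where n = n and i = i and g = "\<lambda>_. 0"]], goal_cases)
    case (5 s2)
    note f2 = frame_ints[OF 5(2)] frame_reals[OF 5(2)]
    show ?case
    proof (rule wp_SeqI[OF wp_col_norm[OF S, where n = n]], goal_cases)
      case (4 s3)
      note f3 = frame_ints[OF 4(2)] frame_reals[OF 4(2)]
      show ?case
      proof (rule wp_SeqI[OF wp_Regress_vec[OF S, where a = n and c = c]], goal_cases)
        case (7 s4)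
        note f4 = frame_ints[OF 7(2)] frame_reals[OF 7(2)]
        define U where "U = reals s 1"
        define x where "x h = reals s4 6 h 0" for h
        have D: "reals s4 5 a 0 = U a i" if "a < n" for a
          using that 1(1) by (simp add: f4 f3 f2 U_def)
        have U4: "reals s4 1 a h = (if a < n \<and> h = i then 0 else U a h)" for a h
          using 5(1) by (simp add: f4 f3 f1 U_def)
        have res: "(\<Sum>h<c. reals s4 1 a h * Y h) = (\<Sum>h\<in>{..<c} - {i}. Y h * U a h)" if "a < n" for a Y
          using that by (intro sum.mono_neutral_cong_right) (auto simp: U4)
        have norm: "reals s4 8 0 0 = colnorm p n U i"
          using 4(1) 1(1) by (auto simp: f4 f2 U_def intro!: vnorm_cong)
        have "vnorm p {..<n} (\<lambda>a. (\<Sum>h<c. reals s3 1 a h * Y h) - reals s3 5 a 0) = vnorm p {..<n} (resid c i U Y)" for Y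
        proof (rule vnorm_cong)
          fix a assume a: "a \<in> {..<n}"
          then have "(\<Sum>h<c. reals s3 1 a h * Y h) - reals s3 5 a 0 = - resid c i U Y a"
            using res[of a Y] D[of a] by (simp add: f4 resid_def)
          then show "\<bar>(\<Sum>h<c. reals s3 1 a h * Y h) - reals s3 5 a 0\<bar> = \<bar>resid c i U Y a\<bar>" by simp
        qed
        then have val: "reals s4 7 0 0 = vnorm p {..<n} (resid c i U x)"
          "\<And>Y. reals s4 7 0 0 \<le> vnorm p {..<n} (resid c i U Y)"
          using 7(1) by (auto simp: x_def[abs_def])
        have i4: "ints s4 0 0 = n" "ints s4 1 0 = i" "ints s4 0 = ints s 0" "ints s4 1 = ints s 1"
          using s by (simp_all add: f4 f3 f2 f1)
        show ?case
        proof (rule wp_SeqI[OF wp_If[where Q = "\<lambda>s5. if 2 * reals s4 7 0 0 < colnorm p n U i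
              then \<forall>a<n. reals s5 5 a 0 = resid c i U x a else reals s5 5 = reals s4 5"]], goal_cases)
          case 1
          then have less: "2 * reals s4 7 0 0 < colnorm p n U i" using norm by simp
          show ?case
            by (rule wp_conseq[OF wp_subtract_fit[where n = n and c = c]])
              (use assms i4 ec less res D in \<open>auto simp: resid_def x_def\<close>)
        next
          case 2
          then show ?case using norm by (intro wp_Skip) simp
        next
          case (3 s5)
          note f5 = frame_ints[OF 3(2)] frame_reals[OF 3(2)]
          define g where "g a = reals s5 5 a 0" for a
          show ?case
          proof (rule wp_conseq[OF wp_write_col[where n = n and i = i and g = g]], goal_cases)
            case (4 a' s6)
            then show ?case by (simp add: frame_reals g_def)
          next
            case (5 s6)
            then have U6: "reals s6 1 = (\<lambda>a b. if a < n \<and> b = i then g a else U a b)"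
              by (auto simp: f5 U4 fun_eq_iff)
            show ?case
            proof (cases "2 * reals s4 7 0 0 < colnorm p n U i")
              case True
              then have g: "g a = resid c i U x a" if "a < n" for a
                using 3(1) that by (simp add: g_def)
              then have U6': "reals s6 1 = (\<lambda>a b. if a < n \<and> b = i then resid c i U x a else U a b)"
                using U6 by (auto simp: fun_eq_iff)
              have col: "colnorm p n (reals s6 1) i = reals s4 7 0 0"
                unfolding val(1) by (rule vnorm_cong) (simp add: U6')
              \<comment> \<open>A residual of the new column is a residual of the old one with
                coefficients x + Y, so minimality of x gives this even without the factor 2.\<close>
              have "colnorm p n (reals s6 1) i \<le> 2 * vnorm p {..<n} (resid c i (reals s6 1) Y)" for Y
              proof -
                have "vnorm p {..<n} (resid c i (reals s6 1) Y) = vnorm p {..<n} (resid c i U (\<lambda>h. x h + Y h))"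
                proof (rule vnorm_cong)
                  fix a assume "a \<in> {..<n}"
                  moreover have "(\<Sum>j\<in>{..<c} - {i}. Y j * reals s6 1 a j) = (\<Sum>j\<in>{..<c} - {i}. Y j * U a j)"
                    by (intro sum.cong) (auto simp: U6')
                  ultimately have "resid c i (reals s6 1) Y a = resid c i U (\<lambda>h. x h + Y h) a"
                    unfolding resid_def[of c i "reals s6 1"]
                    by (simp add: U6') (simp add: resid_def distrib_right sum.distrib)
                  then show "\<bar>resid c i (reals s6 1) Y a\<bar> = \<bar>resid c i U (\<lambda>h. x h + Y h) a\<bar>" by simp
                qed
                then show ?thesis using val(2)[of "\<lambda>h. x h + Y h"] col vnorm_nonneg[of p "{..<n}" "resid c i U (\<lambda>h. x h + Y h)"]
                  by linarith
              qed
              then have "separated p n c i (reals s6 1)" by (simp add: separated_def)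
              then show ?thesis
                unfolding shrunk_def U_def[symmetric] using True col U6' by auto
            next
              case False
              then have "g a = U a i" if "a < n" for a
                using 3(1) D that by (simp add: g_def)
              then have "reals s6 1 = U" using U6 by (auto simp: fun_eq_iff)
              moreover have "separated p n c i U"
                unfolding separated_def
              proof
                fix Y
                show "colnorm p n U i \<le> 2 * vnorm p {..<n} (resid c i U Y)"
                  using val(2)[of Y] False by linarith
              qed
              ultimately show ?thesis unfolding shrunk_def U_def[symmetric] by blast
            qed
          qed (use assms i4 in \<open>auto simp: f5\<close>)
        qed
      qed (use assms ec[of s3] in \<open>auto simp: f3 f2 f1\<close>)
    qed (use assms in \<open>auto simp: f2 f1\<close>)
  qed (use assms in \<open>auto simp: f1\<close>)
qed

definition phase0 :: com where
  "phase0 = For 1 er (shrink_col (iv 1))"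

text \<open>Indices cannot be multiplied, so two nested loops of 2 r + 1 rounds provide the more
  than 3 r^2 sweeps.\<close>

definition phase1 :: com where
  "phase1 = (let e = IAdd er (IAdd er (INum 1)) in For 5 e (For 6 e (For 1 er (shrink_col er))))"

lemma mods_phase01 [simp]:
  "imods phase0 = {1, 2, 3}" "rmods phase0 = {1, 5, 6, 7, 8}"
  "imods phase1 = {1, 2, 3, 5, 6}" "rmods phase1 = {1, 5, 6, 7, 8}"
  by (auto simp: phase0_def phase1_def Let_def)

lemma wp_phase0:
  assumes S: "lp_regression_solver p S" and K: "n \<le> K" "r \<le> K" "1 \<le> K"
    and s: "ints s 0 0 = n" "ints s 0 2 = r"
  shows "wp S K phase0 (\<lambda>s'. (\<forall>i<r. separated p n i i (reals s' 1)) \<and> cols_in_span n r (reals s 1) (reals s' 1)) s"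
  unfolding phase0_def
proof (rule wp_For[where N = r and I = "\<lambda>i s'. (\<forall>i'<i. separated p n i' i' (reals s' 1)) \<and> cols_in_span n r (reals s 1) (reals s' 1)"])
  fix i and s' :: store
  assume i: "i < r" and I: "(\<forall>i'<i. separated p n i' i' (reals s' 1)) \<and> cols_in_span n r (reals s 1) (reals s' 1)"
    and v: "ints s' 1 0 = i" and fr: "frame (For 1 er (shrink_col (iv 1))) s s'"
  show "wp S K (shrink_col (iv 1)) (\<lambda>s''. (\<forall>i'<Suc i. separated p n i' i' (reals (set_int 1 0 (Suc i) s'') 1)) \<and>
      cols_in_span n r (reals s 1) (reals (set_int 1 0 (Suc i) s'') 1)) s'"
  proof (rule wp_conseq[OF wp_shrink_col[OF S, where n = n and c = i and i = i]])
    fix s'' :: store assume sh: "shrunk p n i i (reals s' 1) (reals s'' 1)"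
    have "separated p n i' i' (reals s'' 1)" if "i' < Suc i" for i'
      by (rule shrunk_triangular[OF sh]) (use I that in auto)
    moreover have "cols_in_span n r (reals s 1) (reals s'' 1)"
      using I shrunk_cols_in_span[OF sh i] i by (auto intro: cols_in_span_trans)
    ultimately show "(\<forall>i'<Suc i. separated p n i' i' (reals (set_int 1 0 (Suc i) s'') 1)) \<and>
      cols_in_span n r (reals s 1) (reals (set_int 1 0 (Suc i) s'') 1)" by simp
  qed (use K i s v in \<open>auto simp: frame_ints[OF fr]\<close>)
qed (use K s in \<open>auto simp: frame_ints cols_in_span_refl\<close>)

lemma wp_phase1:
  assumes p: "1 \<le> p" and S: "lp_regression_solver p S" and K: "n \<le> K" "r \<le> K" "2 * r + 1 \<le> K"
    and s: "ints s 0 0 = n" "ints s 0 2 = r"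
    and tri: "\<And>i. i < r \<Longrightarrow> separated p n i i (reals s 1)"
  shows "wp S K phase1 (\<lambda>s'. (\<forall>i<r. separated p n r i (reals s' 1)) \<and> cols_in_span n r (reals s 1) (reals s' 1)) s"
proof -
  define U0 where "U0 = reals s 1"
  define I where "I t i s' \<longleftrightarrow> sweep_inv p n r U0 t i (reals s' 1) \<and> cols_in_span n r U0 (reals s' 1)" for t i and s' :: store
  let ?e = "IAdd er (IAdd er (INum 1))"
  let ?q = "2 * r + 1"
  let ?sw = "For 1 er (shrink_col er)"
  have sweep: "wp S K ?sw (\<lambda>s'. I (Suc t) 0 s') s1"
    if I0: "I t 0 s1" and s1: "ints s1 0 = ints s 0" for t and s1 :: store
  proof (rule wp_For[where N = r and I = "I t"])
    fix i s' assume i: "i < r" "ints s' 1 0 = i" and Ii: "I t i s'" and fr: "frame ?sw s1 s'"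
    show "wp S K (shrink_col er) (\<lambda>s''. I t (Suc i) (set_int 1 0 (Suc i) s'')) s'"
    proof (rule wp_conseq[OF wp_shrink_col[OF S, where n = n and c = r and i = i]])
      fix s'' :: store assume sh: "shrunk p n r i (reals s' 1) (reals s'' 1)"
      show "I t (Suc i) (set_int 1 0 (Suc i) s'')"
        using Ii sweep_inv_step[OF p _ i(1) sh] shrunk_cols_in_span[OF sh i(1)]
        unfolding I_def by (auto intro: cols_in_span_trans)
    qed (use K i s s1 in \<open>auto simp: frame_ints[OF fr]\<close>)
  qed (use K I0 s s1 sweep_inv_next[OF p] in \<open>auto simp: frame_ints I_def\<close>)
  have "wp S K (For 5 ?e (For 6 ?e ?sw)) (\<lambda>s'. I (?q * ?q) 0 s') s"
  proof (rule wp_For[where N = ?q and I = "\<lambda>t. I (t * ?q) 0"])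
    fix t s' assume t: "t < ?q" "I (t * ?q) 0 s'" and fr: "frame (For 5 ?e (For 6 ?e ?sw)) s s'"
    show "wp S K (For 6 ?e ?sw) (\<lambda>s''. I (Suc t * ?q) 0 (set_int 5 0 (Suc t) s'')) s'"
    proof (rule wp_For[where N = ?q and I = "\<lambda>t'. I (t * ?q + t') 0"])
      fix t' s'' assume t': "I (t * ?q + t') 0 s''" and fr': "frame (For 6 ?e ?sw) s' s''"
      have "ints s'' 0 = ints s 0" by (simp add: frame_ints[OF fr'] frame_ints[OF fr])
      from sweep[OF t' this]
      show "wp S K ?sw (\<lambda>s3. I (t * ?q + Suc t') 0 (set_int 6 0 (Suc t') s3)) s''"
        by (simp add: I_def)
    qed (use K s t in \<open>auto simp: frame_ints frame_ints[OF fr] I_def algebra_simps\<close>)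
  qed (use K s in \<open>auto simp: frame_ints I_def sweep_inv_start[OF p] cols_in_span_refl U0_def\<close>)
  then show ?thesis
    unfolding phase1_def Let_def
  proof (rule wp_conseq)
    fix s' assume I: "I (?q * ?q) 0 s'"
    then have inv: "sweep_inv p n r U0 (?q * ?q) 0 (reals s' 1)" by (simp add: I_def)
    have tri': "separated p n i i U0" if "i < r" for i using tri[OF that] by (simp add: U0_def)
    have "3 * r * r < ?q * ?q" by (auto simp: algebra_simps)
    note sweep_inv_final[OF p tri' inv this]
    then show "(\<forall>i<r. separated p n r i (reals s' 1)) \<and> cols_in_span n r (reals s 1) (reals s' 1)"
      using I by (simp add: I_def U0_def)
  qed
qed

section \<open>Rank reduction\<close>

text \<open>The coefficients were computed for the unscaled columns; multiplying them by the norms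
  keeps the product U X.\<close>

definition scale_col :: com where
  "scale_col = Seq load_col (Seq col_norm (Seq (write_col (RDiv (rmat 1 2 1) (rv 8)))
     (For 3 em (RAssign 9 (iv 1) (iv 3) (RMul (rv 8) (rmat 9 1 3))))))"

text \<open>
  A vanishing column has norm 0: division by zero leaves it as it is, and the arbitrary
  coefficients that the solver returned for it are multiplied by 0.
\<close>

definition normalise :: com where
  "normalise = Seq (Regress 9 7 1 0 en er em) (For 1 er scale_col)"

lemma mods_normalise [simp]:
  "imods scale_col = {2, 3}" "rmods scale_col = {1, 5, 6, 8, 9}"
  "imods normalise = {1, 2, 3}" "rmods normalise = {1, 5, 6, 7, 8, 9}"
  by (auto simp: scale_col_def normalise_def)

lemma wp_scale_col:
  assumes S: "lp_regression_solver p S" and K: "n \<le> K" "m \<le> K" "1 \<le> K"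
    and s: "ints s 0 0 = n" "ints s 0 1 = m" "ints s 1 0 = i"
  shows "wp S K scale_col (\<lambda>s'.
     reals s' 1 = (\<lambda>a b. if a < n \<and> b = i then reals s 1 a b / colnorm p n (reals s 1) b else reals s 1 a b) \<and>
     reals s' 9 = (\<lambda>a b. if a = i \<and> b < m then colnorm p n (reals s 1) a * reals s 9 a b else reals s 9 a b)) s"
  unfolding scale_col_def
proof (rule wp_SeqI[OF wp_load_col[OF K(1) s(1,3)]], goal_cases)
  case (1 s1)
  note f1 = frame_ints[OF 1(2)] frame_reals[OF 1(2)]
  define w where "w = colnorm p n (reals s 1) i"
  show ?case
  proof (rule wp_SeqI[OF wp_col_norm[OF S, where n = n]], goal_cases)
    case (4 s2)
    note f2 = frame_ints[OF 4(2)] frame_reals[OF 4(2)]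
    have w: "reals s2 8 0 0 = w"
      using 4(1) 1(1) by (auto simp: w_def intro!: vnorm_cong)
    show ?case
    proof (rule wp_SeqI[OF wp_write_col[where n = n and i = i and g = "\<lambda>a. reals s 1 a i / w"]], goal_cases)
      case (4 a s')
      then show ?case using w s by (simp add: frame_reals frame_ints f1 f2)
    next
      case (5 s3)
      note f3 = frame_ints[OF 5(2)] frame_reals[OF 5(2)]
      show ?case
      proof (rule wp_For_cols[where N = m and x = 9 and i = i and g = "\<lambda>b. w * reals s 9 i b"], goal_cases)
        case (4 j s')
        note f4 = frame_ints[OF 4(3)] frame_reals[OF 4(3)]
        show ?case
          by (rule wp_RAssign) (use 4 s w in \<open>auto simp: fun_eq_iff f4 f3 f2 f1\<close>)
      next
        case (5 s')
        then show ?case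
          using \<open>reals s3 1 = _\<close> by (auto simp: frame_reals f3 f2 f1 w_def fun_eq_iff)
      qed (use K s in \<open>auto simp: frame_ints f3 f2 f1\<close>)
    qed (use K s in \<open>auto simp: f2 f1\<close>)
  qed (use K s in \<open>auto simp: f1\<close>)
qed

text \<open>Rescaling the columns only rescales the coefficients of a residual, by
  \<open>w i / w j\<close>. For a zero column both sides vanish, as division by 0 yields 0.\<close>

lemma separated_scale:
  assumes p: "1 \<le> p" and separated: "\<And>i. i < r \<Longrightarrow> separated p n r i U"
    and U': "\<And>a b. a < n \<Longrightarrow> b < r \<Longrightarrow> U' a b = U a b / colnorm p n U b" and i: "i < r"
  shows "separated p n r i U'" "colnorm p n U' i = (if colnorm p n U i = 0 then 0 else 1)"
proof -
  define w where "w b = colnorm p n U b" for b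
  have w: "0 \<le> w b" for b by (simp add: w_def)
  have col: "colnorm p n U' i = w i / w i"
  proof -
    have "colnorm p n U' i = vnorm p {..<n} (\<lambda>a. (1 / w i) * U a i)"
      using U' i by (intro vnorm_cong) (simp add: w_def)
    also have "\<dots> = \<bar>1 / w i\<bar> * w i"
      unfolding vnorm_cmult[OF p] by (simp add: w_def)
    finally show ?thesis using w[of i] by simp
  qed
  then show "colnorm p n U' i = (if colnorm p n U i = 0 then 0 else 1)"
    by (simp add: w_def)
  show "separated p n r i U'"
  proof (cases "w i = 0")
    case True
    then show ?thesis using col by (simp add: separated_def)
  next
    case False
    then have wi: "0 < w i" using w[of i] by simp
    show ?thesis
      unfolding separated_def
    proof
      fix x
      have "vnorm p {..<n} (resid r i U' x) = vnorm p {..<n} (\<lambda>a. (1 / w i) * resid r i U (\<lambda>j. x j * w i / w j) a)"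
      proof (rule vnorm_cong)
        fix a assume a: "a \<in> {..<n}"
        have "(\<Sum>j\<in>{..<r} - {i}. x j * U' a j) = (1 / w i) * (\<Sum>j\<in>{..<r} - {i}. x j * w i / w j * U a j)"
          unfolding sum_distrib_left using U' a wi by (intro sum.cong) (auto simp: w_def)
        then show "\<bar>resid r i U' x a\<bar> = \<bar>(1 / w i) * resid r i U (\<lambda>j. x j * w i / w j) a\<bar>"
          using U' a i by (simp add: resid_def right_diff_distrib w_def)
      qed
      also have "\<dots> = vnorm p {..<n} (resid r i U (\<lambda>j. x j * w i / w j)) / w i"
        unfolding vnorm_cmult[OF p] using wi by simp
      finally have eq: "vnorm p {..<n} (resid r i U' x) = vnorm p {..<n} (resid r i U (\<lambda>j. x j * w i / w j)) / w i" .
      have "w i \<le> 2 * vnorm p {..<n} (resid r i U (\<lambda>j. x j * w i / w j))"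
        using separated[OF i] unfolding separated_def w_def by blast
      then show "colnorm p n U' i \<le> 2 * vnorm p {..<n} (resid r i U' x)"
        unfolding col eq using wi by (simp add: field_simps)
    qed
  qed
qed

lemma vnorm_err_flip:
  "vnorm p ({..<n} \<times> {..<m}) (\<lambda>(i, j). (\<Sum>h<c. B i h * Y h j) - D i j) = err p n m D (mprod c B Y)"
  unfolding err_def by (intro vnorm_cong) (auto simp: mprod_def)

lemma wp_normalise:
  assumes p: "1 \<le> p" and S: "lp_regression_solver p S" and K: "n \<le> K" "m \<le> K" "r \<le> K" "1 \<le> K"
    and s: "ints s 0 0 = n" "ints s 0 1 = m" "ints s 0 2 = r"
    and separated: "\<And>i. i < r \<Longrightarrow> separated p n r i (reals s 1)"
  shows "wp S K normalise (\<lambda>s'. (\<forall>i<r. separated p n r i (reals s' 1)) \<and>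
     (\<forall>i<r. colnorm p n (reals s' 1) i = 1 \<or> colnorm p n (reals s' 1) i = 0 \<and> (\<forall>j<m. reals s' 9 i j = 0)) \<and>
     (\<forall>Y. err p n m (reals s 0) (mprod r (reals s' 1) (reals s' 9)) \<le> err p n m (reals s 0) (mprod r (reals s 1) Y))) s"
  unfolding normalise_def
proof (rule wp_Seq, rule wp_Regress[OF S, where a = n and c = r and l = m], goal_cases)
  case (7 X w s1)
  define U where "U = reals s 1"
  define X1 where "X1 = reals s1 9"
  define W where "W = colnorm p n U"
  have s1: "reals s1 1 = U" "ints s1 = ints s" "\<And>h j. h < r \<Longrightarrow> j < m \<Longrightarrow> X1 h j = X h j"
    using 7(3,4) by (auto simp: U_def X1_def Let_def)
  have opt: "err p n m (reals s 0) (mprod r U X1) \<le> err p n m (reals s 0) (mprod r U Y)" for Y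
  proof -
    have "err p n m (reals s 0) (mprod r U X1) = err p n m (reals s 0) (mprod r U X)"
      unfolding err_def mprod_def using s1(3) by (intro vnorm_cong) auto
    also have "\<dots> = w" using 7(1) by (simp add: vnorm_err_flip U_def)
    also have "w \<le> err p n m (reals s 0) (mprod r U Y)"
      using 7(2)[of Y] by (simp add: vnorm_err_flip U_def)
    finally show ?thesis .
  qed
  let ?I = "\<lambda>i s'. reals s' 1 = (\<lambda>a b. if a < n \<and> b < i then U a b / W b else U a b) \<and>
      reals s' 9 = (\<lambda>a b. if a < i \<and> b < m then W a * X1 a b else X1 a b)"
  show ?case
  proof (rule wp_For[where N = r and I = ?I], goal_cases)
    case (5 i s')
    note fr = frame_ints[OF 5(4)]
    have Wi: "colnorm p n (reals s' 1) i = W i"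
      using 5(2) by (auto simp: W_def intro!: vnorm_cong)
    show ?case
    proof (rule wp_conseq[OF wp_scale_col[OF S, where n = n and m = m and i = i]], goal_cases)
      case (7 s'')
      then have "reals s'' 1 = (\<lambda>a b. if a < n \<and> b = i then reals s' 1 a b / W i else reals s' 1 a b)"
        "reals s'' 9 = (\<lambda>a b. if a = i \<and> b < m then W i * reals s' 9 a b else reals s' 9 a b)"
        using Wi by (auto simp: fun_eq_iff)
      then show ?case
        using 5(2) by (auto simp: fun_eq_iff less_Suc_eq)
    qed (use K s 5 in \<open>auto simp: fr s1\<close>)
  next
    case (6 s')
    let ?U' = "reals s' 1" and ?X' = "reals s' 9"
    have U': "?U' a b = U a b / colnorm p n U b" if "a < n" "b < r" for a b
      using 6(1) that by (simp add: W_def)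
    have X': "?X' a b = W a * X1 a b" if "a < r" "b < m" for a b
      using 6(1) that by simp
    have g: "\<And>i. i < r \<Longrightarrow> separated p n r i U" using separated by (simp add: U_def)
    note sc = separated_scale[OF p g U']
    have "mprod r ?U' ?X' a j = mprod r U X1 a j" if "a < n" "j < m" for a j
      unfolding mprod_def
    proof (rule sum.cong, simp)
      fix l assume "l \<in> {..<r}"
      then have "?U' a l * ?X' l j = (U a l / W l) * (W l * X1 l j)"
        using U' X' that by (simp add: W_def)
      also have "\<dots> = U a l * X1 l j"
      proof (cases "W l = 0")
        case True
        then show ?thesis using vnorm_eq_0D[OF p, of "{..<n}" "\<lambda>a. U a l" a] that by (simp add: W_def)
      qed simp
      finally show "?U' a l * ?X' l j = U a l * X1 l j" .
    qed
    then have "err p n m (reals s 0) (mprod r ?U' ?X') = err p n m (reals s 0) (mprod r U X1)"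
      unfolding err_def by (intro vnorm_cong) auto
    then show ?case
      using sc opt X' by (auto simp: U_def W_def)
  qed (use K s in \<open>auto simp: frame_ints s1 X1_def\<close>)
qed (use K s in auto)

section \<open>Programs for the search and the deflation\<close>

definition deflate_com :: "nat \<Rightarrow> nat \<Rightarrow> nat \<Rightarrow> com" where
  "deflate_com x b y = Seq (SumAssign 13 (INum 0) (INum 0) (RNum 0) 3 er (RMul (rcol y 3) (rcol y 3)))
     (For 3 er (For 4 er (RAssign x (iv 3) (iv 4)
       (RSub (rmat b 3 4) (RDiv (RMul (rcol y 3) (rcol y 4)) (rv 13))))))"

lemma mods_deflate_com [simp]: "imods (deflate_com x b y) = {3, 4}" "rmods (deflate_com x b y) = {13, x}"
  by (auto simp: deflate_com_def)

lemma wp_deflate_com: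
  assumes K: "r \<le> K" and s: "ints s 0 2 = r" and xy: "x \<noteq> y" "x \<noteq> 13" "b \<noteq> 13" "y \<noteq> 13"
  shows "wp S K (deflate_com x b y) (\<lambda>s'. reals s' x = (\<lambda>i j. if i < r \<and> j < r
     then deflate r (reals s b) (\<lambda>h. reals s y h 0) i j else reals s x i j)) s"
  unfolding deflate_com_def
proof (rule wp_SeqI[OF wp_SumAssign[where N = r and i = 0 and j = 0 and w = 0
        and g = "\<lambda>h. reals s y h 0 * reals s y h 0"]], goal_cases)
  case (5 s1)
  note f1 = frame_ints[OF 5(2)] frame_reals[OF 5(2)]
  let ?D = "deflate r (reals s b) (\<lambda>h. reals s y h 0)"
  have N: "reals s1 13 0 0 = nsq r (\<lambda>h. reals s y h 0)"
    using 5(1) by (simp add: nsq_def)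
  let ?as = "RAssign x (iv 3) (iv 4) (RSub (rmat b 3 4) (RDiv (RMul (rcol y 3) (rcol y 4)) (rv 13)))"
  show ?case
  proof (rule wp_For_rows[where N = r and x = x and B = "\<lambda>j. j < r" and g = ?D], goal_cases)
    case (4 i s2)
    note f2 = frame_ints[OF 4(3)] frame_reals[OF 4(3)]
    show ?case
    proof (rule wp_conseq[OF wp_For_cols[where N = r and x = x and i = i and g = "?D i"
          and Q = "\<lambda>s''. reals s'' x = (\<lambda>a b. if a = i \<and> b < r then ?D i b else reals s2 x a b)"]], goal_cases)
      case (4 j s3)
      note f3 = frame_ints[OF 4(3)] frame_reals[OF 4(3)]
      \<comment> \<open>Deflation in place is sound: the entry at (i, j) of array b is read only to
        compute its own successor, hence before it is overwritten.\<close>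
      have "reals s3 b i j = reals s b i j"
      proof (cases "b = x")
        case True
        then show ?thesis using 4(4) \<open>reals s2 x = _\<close> xy by (simp add: f1)
      next
        case False
        then show ?thesis using xy by (simp add: f3 f2 f1)
      qed
      moreover have "reals s3 y = reals s y" "reals s3 13 = reals s1 13"
        using xy by (simp_all add: f3 f2 f1)
      moreover have "ints s3 3 0 = i" using \<open>ints s2 3 0 = i\<close> by (simp add: f3)
      ultimately show ?case
        using 4(2) by (intro wp_RAssign) (auto simp: fun_eq_iff deflate_def N)
    qed (use K s in \<open>auto simp: frame_ints f2 f1 fun_eq_iff\<close>)
  next
    case (5 s2)
    then show ?case using xy by (auto simp: f1 fun_eq_iff)
  qed (use K s in \<open>auto simp: frame_ints f1\<close>)
next
  case (4 h s')
  then show ?case using xy by (simp add: frame_reals)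
qed (use K s in \<open>auto simp: frame_ints\<close>)

text \<open>With y the pivot vector and Q the deflated projection, array 11 receives X^T Q and array
  5 receives - X^T y. The residual at w is then X^T (y + Q w), the row combination given by the
  candidate with parameter w.\<close>

definition candidate_com :: com where
  "candidate_com = Seq (For 3 er (RAssign 15 (iv 3) (INum 0) (RDiv (rmat 10 3 1) (rmat 10 1 1))))
     (Seq (deflate_com 16 10 15)
     (Seq (For 2 em (SumAssign 5 (iv 2) (INum 0) (RNum 0) 3 er (RSub (RNum 0) (RMul (rmat 9 3 2) (rcol 15 3)))))
     (Seq (For 2 em (For 4 er (SumAssign 11 (iv 2) (iv 4) (RNum 0) 3 er (RMul (rmat 9 3 2) (rmat 16 3 4)))))
     (Regress 6 7 11 5 em er (INum 1)))))"

definition update_com :: com where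
  "update_com = Seq (RAssign 14 (INum 0) (INum 0) (rv 7))
     (For 3 er (SumAssign 12 (iv 3) (INum 0) (rcol 15 3) 4 er (RMul (rmat 16 3 4) (rcol 6 4))))"

definition thin_com :: com where
  "thin_com = Seq (RAssign 14 (INum 0) (INum 0) (RNum (- 1)))
     (Seq (For 1 er (If (RLess (RNum 0) (rmat 10 1 1))
        (Seq candidate_com (If (BAnd (BNot (RLess (rv 14) (RNum 0))) (BNot (RLess (rv 7) (rv 14)))) Skip update_com)) Skip))
     (deflate_com 10 10 12))"

text \<open>Array 10 is zero initially, so writing the diagonal produces the identity. For r \<le> k
  the truncated difference is 0 and nothing is deflated.\<close>

definition phase2 :: com where
  "phase2 = Seq (For 1 er (RAssign 10 (iv 1) (iv 1) (RNum 1))) (For 7 (ISub er ek) thin_com)"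

lemma mods_phase2 [simp]:
  "imods candidate_com = {2, 3, 4}" "rmods candidate_com = {5, 6, 7, 11, 13, 15, 16}"
  "imods update_com = {3, 4}" "rmods update_com = {12, 14}"
  "imods thin_com = {1, 2, 3, 4}" "rmods thin_com = {5, 6, 7, 10, 11, 12, 13, 14, 15, 16}"
  "imods phase2 = {1, 2, 3, 4, 7}" "rmods phase2 = {5, 6, 7, 10, 11, 12, 13, 14, 15, 16}"
  by (auto simp: candidate_com_def update_com_def thin_com_def phase2_def)

lemma wp_cand_com:
  assumes S: "lp_regression_solver p S" and K: "m \<le> K" "r \<le> K" "1 \<le> K"
    and s: "ints s 0 1 = m" "ints s 0 2 = r" "ints s 1 0 = i" and i: "i < r"
  shows "wp S K candidate_com (\<lambda>s'.
     (\<forall>l<r. reals s' 15 l 0 = pivot (reals s 10) i l) \<and>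
     (\<forall>l<r. \<forall>h<r. reals s' 16 l h = deflate r (reals s 10) (pivot (reals s 10) i) l h) \<and>
     reals s' 7 0 0 = vnorm p {..<m} (rowcomb r (reals s 9) (candidate r (reals s 10) i (\<lambda>h. reals s' 6 h 0))) \<and>
     (\<forall>w. reals s' 7 0 0 \<le> vnorm p {..<m} (rowcomb r (reals s 9) (candidate r (reals s 10) i w)))) s"
  unfolding candidate_com_def
proof (rule wp_SeqI[OF wp_For_rows[where N = r and x = 15 and B = "\<lambda>b. b = 0" and g = "\<lambda>l b. pivot (reals s 10) i l"
      and Q = "\<lambda>s'. \<forall>l<r. reals s' 15 l 0 = pivot (reals s 10) i l"]], goal_cases)
  case (4 l s')
  note fr = frame_ints[OF 4(3)] frame_reals[OF 4(3)]
  show ?case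
    by (rule wp_RAssign) (use 4 s in \<open>auto simp: fr fun_eq_iff pivot_def\<close>)
next
  case (6 s1)
  note f1 = frame_ints[OF 6(2)] frame_reals[OF 6(2)]
  define P where "P = reals s 10"
  define X where "X = reals s 9"
  define y0 where "y0 = pivot P i"
  define Q where "Q = deflate r P y0"
  have y0: "reals s1 15 l 0 = y0 l" if "l < r" for l
    using 6(1) that by (simp add: y0_def P_def)
  have defl: "deflate r (reals s1 10) (\<lambda>h. reals s1 15 h 0) l h = Q l h" if "l < r" "h < r" for l h
    using y0 that by (simp add: deflate_def Q_def nsq_def f1 P_def)
  show ?case
  proof (rule wp_SeqI[OF wp_deflate_com[where r = r]], goal_cases)
    case (7 s2)
    note f2 = frame_ints[OF 7(2)] frame_reals[OF 7(2)]
    have Q2: "reals s2 16 l h = Q l h" if "l < r" "h < r" for l h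
      using 7(1) defl that by simp
    let ?d = "\<lambda>j. \<Sum>h<r. - (X h j * y0 h)"
    show ?case
    proof (rule wp_SeqI[OF wp_For_rows[where N = m and x = 5 and B = "\<lambda>b. b = 0" and g = "\<lambda>j b. ?d j"
        and Q = "\<lambda>s'. \<forall>j<m. reals s' 5 j 0 = ?d j"]], goal_cases)
      case (4 j s')
      note fr = frame_ints[OF 4(3)] frame_reals[OF 4(3)]
      show ?case
      proof (rule wp_conseq[OF wp_SumAssign[where N = r and i = j and j = 0 and w = 0 and g = "\<lambda>h. - (X h j * y0 h)"]], goal_cases)
        case (4 h s'')
        then show ?case using \<open>ints s' 2 0 = j\<close> y0 by (simp add: frame_reals frame_ints fr f2 f1 X_def)
      qed (use K s 4 in \<open>auto simp: frame_ints fr f2 f1 fun_eq_iff\<close>)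
    next
      case (6 s3)
      note f3 = frame_ints[OF 6(2)] frame_reals[OF 6(2)]
      let ?B = "\<lambda>j l. \<Sum>h<r. X h j * Q h l"
      show ?case
      proof (rule wp_SeqI[OF wp_For_rows[where N = m and x = 11 and B = "\<lambda>l. l < r" and g = ?B
          and Q = "\<lambda>s'. \<forall>j<m. \<forall>l<r. reals s' 11 j l = ?B j l"]], goal_cases)
        case (4 j s')
        note fr = frame_ints[OF 4(3)] frame_reals[OF 4(3)]
        show ?case
        proof (rule wp_For_cols[where N = r and x = 11 and i = j and g = "?B j"], goal_cases)
          case (4 l s'')
          note fr' = frame_ints[OF 4(3)] frame_reals[OF 4(3)]
          show ?case
          proof (rule wp_conseq[OF wp_SumAssign[where N = r and i = j and j = l and w = 0 and g = "\<lambda>h. X h j * Q h l"]], goal_cases)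
            case (4 h s4)
            then show ?case using \<open>ints s' 2 0 = j\<close> \<open>ints s'' 4 0 = l\<close> \<open>l < r\<close> Q2
              by (simp add: frame_reals frame_ints fr' fr f3 f2 f1 X_def)
          qed (use K s 4 \<open>ints s' 2 0 = j\<close> in \<open>auto simp: frame_ints fr' fr f3 f2 f1 fun_eq_iff\<close>)
        qed (use K s 4 in \<open>auto simp: frame_ints fr f3 f2 f1 fun_eq_iff\<close>)
      next
        case (6 s4)
        note f4 = frame_ints[OF 6(2)] frame_reals[OF 6(2)]
        have fit: "vnorm p {..<m} (\<lambda>j. (\<Sum>h<r. reals s4 11 j h * w h) - reals s4 5 j 0)
            = vnorm p {..<m} (rowcomb r X (candidate r P i w))" for w
        proof (rule vnorm_cong)
          fix j assume "j \<in> {..<m}"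
          then have j: "j < m" by simp
          have "(\<Sum>h<r. reals s4 11 j h * w h) = (\<Sum>h<r. (\<Sum>l<r. X l j * Q l h) * w h)"
            using 6(1) j by simp
          also have "\<dots> = (\<Sum>l<r. (\<Sum>h<r. Q l h * w h) * X l j)"
            unfolding sum_distrib_right by (subst sum.swap) (simp add: mult_ac)
          finally have "(\<Sum>h<r. reals s4 11 j h * w h) - reals s4 5 j 0
              = (\<Sum>l<r. (\<Sum>h<r. Q l h * w h) * X l j) + (\<Sum>l<r. y0 l * X l j)"
            using \<open>\<forall>j<m. reals s3 5 j 0 = _ j\<close> j by (simp add: f4 sum_negf mult.commute)
          also have "\<dots> = rowcomb r X (candidate r P i w) j"
            by (simp add: rowcomb_def candidate_def Q_def y0_def distrib_right sum.distrib)
          finally show "\<bar>(\<Sum>h<r. reals s4 11 j h * w h) - reals s4 5 j 0\<bar> = \<bar>rowcomb r X (candidate r P i w) j\<bar>"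
            by simp
        qed
        show ?case
        proof (rule wp_conseq[OF wp_Regress_vec[OF S, where a = m and c = r]], goal_cases)
          case (7 s5)
          note fitted = 7(1)[unfolded fit]
          show ?case
            using fitted 7(2) y0 Q2 by (auto simp: frame_reals f4 f3 f2 P_def X_def y0_def Q_def)
        qed (use K s in \<open>auto simp: f4 f3 f2 f1\<close>)
      qed (use K s in \<open>auto simp: frame_ints f3 f2 f1\<close>)
    qed (use K s in \<open>auto simp: frame_ints f2 f1\<close>)
  qed (use K s in \<open>auto simp: f1\<close>)
qed (use K s in \<open>auto simp: frame_ints\<close>)

lemma wp_update_com:
  assumes K: "r \<le> K" and s: "ints s 0 2 = r"
  shows "wp S K update_com (\<lambda>s'. reals s' 14 0 0 = reals s 7 0 0 \<and>
     (\<forall>l<r. reals s' 12 l 0 = reals s 15 l 0 + (\<Sum>h<r. reals s 16 l h * reals s 6 h 0))) s"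
  unfolding update_com_def
proof (rule wp_SeqI[OF wp_RAssign_entry[OF refl refl refl]], goal_cases)
  case (1 s1)
  note f1 = frame_ints[OF 1(2)] frame_reals[OF 1(2)]
  let ?y = "\<lambda>l. reals s 15 l 0 + (\<Sum>h<r. reals s 16 l h * reals s 6 h 0)"
  show ?case
  proof (rule wp_For_rows[where N = r and x = 12 and B = "\<lambda>b. b = 0" and g = "\<lambda>l b. ?y l"], goal_cases)
    case (4 l s')
    note fr = frame_ints[OF 4(3)] frame_reals[OF 4(3)]
    show ?case
    proof (rule wp_conseq[OF wp_SumAssign[where N = r and i = l and j = 0 and w = "reals s 15 l 0"
            and g = "\<lambda>h. reals s 16 l h * reals s 6 h 0"]], goal_cases)
      case (4 h s'')
      then show ?case using \<open>ints s' 3 0 = l\<close> by (simp add: frame_reals frame_ints fr f1)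
    qed (use K s 4 in \<open>auto simp: frame_ints fr f1 fun_eq_iff\<close>)
  next
    case (5 s')
    then show ?case using 1(1) by (simp add: frame_reals)
  qed (use K s in \<open>auto simp: frame_ints f1\<close>)
qed

lemma phase2_inv_cong:
  assumes "phase2_inv p n m r A U X \<eta> \<delta> t P" "\<And>i j. i < r \<Longrightarrow> j < r \<Longrightarrow> P' i j = P i j"
  shows "phase2_inv p n m r A U X \<eta> \<delta> t P'"
proof -
  have "trace r P' = trace r P" using assms(2) by (simp add: trace_def)
  moreover have "mprod r U (mprod r P' X) = mprod r U (mprod r P X)"
    unfolding mprod_def using assms(2) by (intro ext sum.cong) auto
  moreover have "proj r P" using assms(1) by (simp add: phase2_inv_def)
  ultimately show ?thesis
    using assms unfolding phase2_inv_def by (auto intro: proj_cong)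
qed

lemma wp_thin_com:
  assumes p: "1 \<le> p" and S: "lp_regression_solver p S" and K: "m \<le> K" "r \<le> K" "1 \<le> K"
    and s: "ints s 0 1 = m" "ints s 0 2 = r"
    and separated: "\<And>i. i < r \<Longrightarrow> separated p n r i U"
    and norm: "\<And>i. i < r \<Longrightarrow> colnorm p n U i = 1 \<or> colnorm p n U i = 0 \<and> (\<forall>j<m. X i j = 0)"
    and X: "X = reals s 9"
    and UX: "err p n m A (mprod r U X) \<le> \<eta>"
    and opt: "\<And>z. (\<And>Us Vs. z \<le> err p n m A (mprod k Us Vs)) \<Longrightarrow> z \<le> \<delta>"
    and inv: "phase2_inv p n m r A U X \<eta> \<delta> t (reals s 10)" and t: "t < r - k"
  shows "wp S K thin_com (\<lambda>s'. phase2_inv p n m r A U X \<eta> \<delta> (Suc t) (reals s' 10)) s"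
  unfolding thin_com_def
proof (rule wp_SeqI[OF wp_RAssign_entry[OF refl refl refl]], goal_cases)
  case (1 s1)
  note f1 = frame_ints[OF 1(2)] frame_reals[OF 1(2)]
  define P where "P = reals s 10"
  have P: "proj r P" using inv by (simp add: phase2_inv_def P_def)
  let ?best = "\<lambda>i s'. best_upto p m r X P i (\<lambda>l. reals s' 12 l 0) (reals s' 14 0 0)"
  let ?b = "If (RLess (RNum 0) (rmat 10 1 1))
        (Seq candidate_com (If (BAnd (BNot (RLess (rv 14) (RNum 0))) (BNot (RLess (rv 7) (rv 14)))) Skip update_com)) Skip"
  show ?case
  proof (rule wp_SeqI[OF wp_For[where N = r and I = ?best and Q = "?best r"]], goal_cases)
    case (5 i s2)
    note f2 = frame_ints[OF 5(4)] frame_reals[OF 5(4)]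
    have P2: "reals s2 10 = P" "reals s2 9 = X" by (simp_all add: f2 f1 P_def X)
    show ?case
    proof (rule wp_If)
      assume "\<not> bval (RLess (RNum 0) (rmat 10 1 1)) s2"
      then have "\<not> 0 < P i i" using 5(3) P2 by simp
      then show "wp S K Skip (\<lambda>s''. ?best (Suc i) (set_int 1 0 (Suc i) s'')) s2"
        using best_upto_skip[OF 5(2)] by (intro wp_Skip) simp
    next
      assume "bval (RLess (RNum 0) (rmat 10 1 1)) s2"
      then have pos: "0 < P i i" using 5(3) P2 by simp
      show "wp S K (Seq candidate_com (If (BAnd (BNot (RLess (rv 14) (RNum 0))) (BNot (RLess (rv 7) (rv 14)))) Skip update_com))
         (\<lambda>s''. ?best (Suc i) (set_int 1 0 (Suc i) s'')) s2"
      proof (rule wp_SeqI[OF wp_cand_com[OF S, where m = m and r = r and i = i]], goal_cases)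
        case (8 s3)
        note f3 = frame_ints[OF 8(2)] frame_reals[OF 8(2)]
        have v: "reals s3 7 0 0 = vnorm p {..<m} (rowcomb r X (candidate r P i (\<lambda>h. reals s3 6 h 0)))"
          "\<And>w. reals s3 7 0 0 \<le> vnorm p {..<m} (rowcomb r X (candidate r P i w))"
          using 8(1) P2 by auto
        have y: "reals s3 15 l 0 + (\<Sum>h<r. reals s3 16 l h * reals s3 6 h 0) = candidate r P i (\<lambda>h. reals s3 6 h 0) l"
          if "l < r" for l
          using 8(1) P2 that by (simp add: candidate_def)
        have best: "?best i s3" using 5(2) by (simp add: f3)
        show ?case
        proof (rule wp_If)
          assume "bval (BAnd (BNot (RLess (rv 14) (RNum 0))) (BNot (RLess (rv 7) (rv 14)))) s3"
          then show "wp S K Skip (\<lambda>s''. ?best (Suc i) (set_int 1 0 (Suc i) s'')) s3"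
            using best_upto_keep[OF best v(2)] by (intro wp_Skip) simp
        next
          assume "\<not> bval (BAnd (BNot (RLess (rv 14) (RNum 0))) (BNot (RLess (rv 7) (rv 14)))) s3"
          then have less: "reals s3 14 0 0 < 0 \<or> reals s3 7 0 0 < reals s3 14 0 0" by auto
          show "wp S K update_com (\<lambda>s''. ?best (Suc i) (set_int 1 0 (Suc i) s'')) s3"
          proof (rule wp_conseq[OF wp_update_com[where r = r]], goal_cases)
            case (3 s4)
            then show ?case
              using best_upto_update[OF P 5(1) pos best v(2) v(1) _ less, of "\<lambda>l. reals s4 12 l 0"] y by simp
          qed (use K s in \<open>auto simp: f3 f2 f1\<close>)
        qed
      qed (use K s 5 in \<open>auto simp: f2 f1\<close>)
    qed
  next
    case (7 s2)
    note f2 = frame_ints[OF 7(2)] frame_reals[OF 7(2)]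
    show ?case
    proof (rule wp_conseq[OF wp_deflate_com[where r = r]], goal_cases)
      case (7 s3)
      have "phase2_inv p n m r A U X \<eta> \<delta> (Suc t) (deflate r P (\<lambda>l. reals s2 12 l 0))"
        by (rule phase2_step[OF p separated norm UX opt inv[folded P_def] t]) (use \<open>?best r s2\<close> in auto)
      then show ?case
        by (rule phase2_inv_cong) (use 7(1) in \<open>auto simp: f2 f1 P_def\<close>)
    qed (use K s in \<open>auto simp: f2 f1\<close>)
  qed (use K s 1 best_upto_0 in \<open>auto simp: frame_ints f1\<close>)
qed

lemma wp_phase2:
  assumes p: "1 \<le> p" and S: "lp_regression_solver p S" and K: "m \<le> K" "r \<le> K" "1 \<le> K"
    and s: "ints s 0 1 = m" "ints s 0 2 = r" "ints s 0 3 = k" "reals s 10 = (\<lambda>_ _. 0)"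
    and separated: "\<And>i. i < r \<Longrightarrow> separated p n r i U"
    and norm: "\<And>i. i < r \<Longrightarrow> colnorm p n U i = 1 \<or> colnorm p n U i = 0 \<and> (\<forall>j<m. X i j = 0)"
    and X: "X = reals s 9"
    and UX: "err p n m A (mprod r U X) \<le> \<eta>"
    and opt: "\<And>z. (\<And>Us Vs. z \<le> err p n m A (mprod k Us Vs)) \<Longrightarrow> z \<le> \<delta>"
  shows "wp S K phase2 (\<lambda>s'. phase2_inv p n m r A U X \<eta> \<delta> (r - k) (reals s' 10)) s"
  unfolding phase2_def
proof (rule wp_SeqI[OF wp_For[where N = r
        and I = "\<lambda>i s'. reals s' 10 = (\<lambda>a b. if a = b \<and> a < i then 1 else 0)"
        and Q = "\<lambda>s'. reals s' 10 = (\<lambda>a b. if a = b \<and> a < r then 1 else 0)"]], goal_cases)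
  case (5 i s')
  then show ?case by (intro wp_RAssign) (auto simp: fun_eq_iff less_Suc_eq)
next
  case (7 s1)
  note f1 = frame_ints[OF 7(2)] frame_reals[OF 7(2)]
  show ?case
  proof (rule wp_For[where N = "r - k" and I = "\<lambda>t s'. phase2_inv p n m r A U X \<eta> \<delta> t (reals s' 10)"], goal_cases)
    case 3
    then show ?case using 7(1) by (auto intro!: phase2_start[OF p UX])
  next
    case (5 t s')
    note fr = frame_ints[OF 5(4)] frame_reals[OF 5(4)]
    show ?case
      by (rule wp_conseq[OF wp_thin_com[OF p S K, where t = t and n = n and U = U and X = X and A = A and \<eta> = \<eta> and \<delta> = \<delta> and k = k]])
        (use separated norm X UX opt 5 s in \<open>auto simp: fr f1\<close>)
  qed (use K s in \<open>auto simp: frame_ints f1\<close>)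
qed (use K s in \<open>auto simp: frame_ints\<close>)

text \<open>Column l is copied to array 15 first because the deflation of array 10 overwrites it.
  The column counter starts from the zero of the input store and advances only for positive diagonal
  entries.\<close>

definition phase3 :: com where
  "phase3 = For 1 er (If (RLess (RNum 0) (rmat 10 1 1))
     (Seq (For 3 er (RAssign 15 (iv 3) (INum 0) (rmat 10 3 1)))
     (Seq (For 2 en (SumAssign 3 (iv 2) (iv 8) (RNum 0) 3 er (RMul (rmat 1 2 3) (rcol 15 3))))
     (Seq (deflate_com 10 10 15) (IAssign 8 (INum 0) (IAdd (iv 8) (INum 1)))))) Skip)"

lemma mods_phase3 [simp]: "imods phase3 = {1, 2, 3, 4, 8}" "rmods phase3 = {3, 10, 13, 15}"
  by (auto simp: phase3_def)

lemma wp_phase3: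
  assumes K: "n \<le> K" "r \<le> K"
    and s: "ints s 0 0 = n" "ints s 0 2 = r" "ints s 8 0 = 0" "reals s 3 = (\<lambda>_ _. 0)"
    and P: "proj r (reals s 10)"
  shows "wp S K phase3 (\<lambda>s'. \<exists>c P. phase3_inv n r (reals s 1) (reals s 10) r c P (reals s' 3)) s"
  unfolding phase3_def
proof (rule wp_For[where N = r and I = "\<lambda>l s'. phase3_inv n r (reals s 1) (reals s 10) l (ints s' 8 0) (reals s' 10) (reals s' 3)"], goal_cases)
  case (5 l s0)
  note f0 = frame_ints[OF 5(4)] frame_reals[OF 5(4)]
  define U where "U = reals s 1"
  let ?I = "\<lambda>l s'. phase3_inv n r (reals s 1) (reals s 10) l (ints s' 8 0) (reals s' 10) (reals s' 3)"
  show ?case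
  proof (rule wp_If)
    assume "\<not> bval (RLess (RNum 0) (rmat 10 1 1)) s0"
    then show "wp S K Skip (\<lambda>s''. ?I (Suc l) (set_int 1 0 (Suc l) s'')) s0"
      using phase3_skip[OF 5(2,1)] 5(3) by (intro wp_Skip) simp
  next
    assume "bval (RLess (RNum 0) (rmat 10 1 1)) s0"
    then have pos: "0 < reals s0 10 l l" using 5(3) by simp
    show "wp S K (Seq (For 3 er (RAssign 15 (iv 3) (INum 0) (rmat 10 3 1)))
     (Seq (For 2 en (SumAssign 3 (iv 2) (iv 8) (RNum 0) 3 er (RMul (rmat 1 2 3) (rcol 15 3))))
     (Seq (deflate_com 10 10 15) (IAssign 8 (INum 0) (IAdd (iv 8) (INum 1))))))
       (\<lambda>s''. ?I (Suc l) (set_int 1 0 (Suc l) s'')) s0"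
    proof (rule wp_SeqI[OF wp_For_rows[where N = r and x = 15 and B = "\<lambda>b. b = 0" and g = "\<lambda>h b. reals s0 10 h l"
        and Q = "\<lambda>s'. \<forall>h<r. reals s' 15 h 0 = reals s0 10 h l"]], goal_cases)
      case (4 h s')
      note fr = frame_ints[OF 4(3)] frame_reals[OF 4(3)]
      show ?case
        by (rule wp_RAssign) (use 4 5(3) in \<open>auto simp: fr fun_eq_iff\<close>)
    next
      case (6 s1)
      note f1 = frame_ints[OF 6(2)] frame_reals[OF 6(2)]
      let ?c = "ints s0 8 0"
      let ?w = "\<lambda>a. \<Sum>h<r. U a h * reals s1 15 h 0"
      show ?case
      proof (rule wp_SeqI[OF wp_For_rows[where N = n and x = 3 and B = "\<lambda>b. b = ?c" and g = "\<lambda>a b. ?w a"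
          and Q = "\<lambda>s'. reals s' 3 = (\<lambda>a b. if a < n \<and> b = ?c then ?w a else reals s0 3 a b)"]], goal_cases)
        case (4 a s')
        note fr = frame_ints[OF 4(3)] frame_reals[OF 4(3)]
        show ?case
        proof (rule wp_conseq[OF wp_SumAssign[where N = r and i = a and j = "?c" and w = 0
              and g = "\<lambda>h. U a h * reals s1 15 h 0"]], goal_cases)
          case (4 h s'')
          then show ?case using \<open>ints s' 2 0 = a\<close> by (simp add: frame_reals frame_ints fr f1 f0 U_def)
        qed (use K s 4 in \<open>auto simp: frame_ints fr f1 f0 fun_eq_iff\<close>)
      next
        case (6 s2)
        note f2 = frame_ints[OF 6(2)] frame_reals[OF 6(2)]
        show ?case
        proof (rule wp_SeqI[OF wp_deflate_com[where r = r]], goal_cases)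
          case (7 s3)
          note f3 = frame_ints[OF 7(2)] frame_reals[OF 7(2)]
          have "phase3_inv n r (reals s 1) (reals s 10) (Suc l) (Suc ?c) (reals s3 10) (reals s3 3)"
          proof (rule phase3_step[OF 5(2,1) pos, where y = "\<lambda>h. reals s1 15 h 0"])
            show "reals s1 15 h 0 = reals s0 10 h l" if "h < r" for h
              using \<open>\<forall>h<r. reals s1 15 h 0 = _ h\<close> that by simp
            show "reals s3 3 a t = (if a < n \<and> t = ?c then \<Sum>h<r. reals s 1 a h * reals s1 15 h 0 else reals s0 3 a t)" for a t
              using 6(1) by (simp add: f3 U_def)
            show "reals s3 10 i j = deflate r (reals s0 10) (\<lambda>h. reals s1 15 h 0) i j" if "i < r" "j < r" for i j
              using 7(1) that by (simp add: f2 f1)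
          qed
          then show ?case
            by (intro wp_IAssign) (simp add: f3 f2 f1 One_nat_def)
        qed (use K s in \<open>auto simp: f2 f1 f0\<close>)
      qed (use K s in \<open>auto simp: frame_ints f1 f0 fun_eq_iff\<close>)
    qed (use K s in \<open>auto simp: frame_ints f0\<close>)
  qed
qed (use K s phase3_start[OF P] in \<open>auto simp: frame_ints\<close>)

definition algorithm :: com where
  "algorithm = Seq phase0 (Seq phase1 (Seq normalise (Seq phase2 (Seq phase3 (Regress 4 7 3 0 en ek em)))))"

lemma wp_algorithm:
  assumes p: "1 \<le> p" and S: "lp_regression_solver p S"
    and K: "n \<le> K" "m \<le> K" "2 * r + 1 \<le> K" "k \<le> K"
    and s: "ints s 0 0 = n" "ints s 0 1 = m" "ints s 0 2 = r" "ints s 0 3 = k" "ints s 8 0 = 0"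
      "reals s 3 = (\<lambda>_ _. 0)" "reals s 10 = (\<lambda>_ _. 0)"
    and UV: "err p n m (reals s 0) (mprod r (reals s 1) (reals s 2)) \<le> \<eta>"
    and opt: "\<And>z. (\<And>Us Vs. z \<le> err p n m (reals s 0) (mprod k Us Vs)) \<Longrightarrow> z \<le> \<delta>"
  shows "wp S K algorithm (\<lambda>s'. err p n m (reals s 0) (mprod k (reals s' 3) (reals s' 4))
     \<le> \<eta> + real (r - k) * (2 * (real r)\<^sup>2 * (\<eta> + \<delta>))) s"
proof -
  define A where "A = reals s 0"
  have K': "r \<le> K" "1 \<le> K" using K(3) by auto
  show ?thesis
    unfolding algorithm_def
  proof (rule wp_SeqI[OF wp_phase0[OF S K(1) K' s(1,3)]], goal_cases)
    case (1 s1)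
    note f1 = frame_ints[OF 1(2)] frame_reals[OF 1(2)]
    show ?case
    proof (rule wp_SeqI[OF wp_phase1[OF p S K(1) K'(1) K(3)]], goal_cases)
      case (4 s2)
      note f2 = frame_ints[OF 4(2)] frame_reals[OF 4(2)]
      have span: "cols_in_span n r (reals s 1) (reals s2 1)"
        using 1(1) 4(1) cols_in_span_trans by blast
      \<comment> \<open>The span was preserved, so the given approximation has coefficients in the
        conditioned basis, and the regression in \<open>normalise\<close> is at least as
        good.\<close>
      have "\<exists>Y. \<forall>j. \<forall>a<n. mprod r (reals s 1) (reals s 2) a j = mprod r (reals s2 1) Y a j"
      proof -
        have "\<exists>z. \<forall>a<n. mprod r (reals s 1) (reals s 2) a j = (\<Sum>l<r. reals s2 1 a l * z l)" for j
          unfolding mprod_def by (rule span[unfolded cols_in_span_def, THEN spec])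
        then have "\<exists>Z. \<forall>j. \<forall>a<n. mprod r (reals s 1) (reals s 2) a j = (\<Sum>l<r. reals s2 1 a l * Z j l)"
          by (intro choice) blast
        then obtain Z where "\<forall>j. \<forall>a<n. mprod r (reals s 1) (reals s 2) a j = (\<Sum>l<r. reals s2 1 a l * Z j l)" ..
        then show ?thesis by (intro exI[of _ "\<lambda>l j. Z j l"]) (simp add: mprod_def)
      qed
      then obtain Y where Y: "\<And>j a. a < n \<Longrightarrow> mprod r (reals s 1) (reals s 2) a j = mprod r (reals s2 1) Y a j"
        by blast
      have Y_err: "err p n m A (mprod r (reals s2 1) Y) \<le> \<eta>"
      proof -
        have "err p n m A (mprod r (reals s2 1) Y) = err p n m A (mprod r (reals s 1) (reals s 2))"
          unfolding err_def using Y by (intro vnorm_cong) auto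
        then show ?thesis using UV by (simp add: A_def)
      qed
      show ?case
      proof (rule wp_SeqI[OF wp_normalise[OF p S K(1,2) K']], goal_cases)
        case (5 s3)
        note f3 = frame_ints[OF 5(2)] frame_reals[OF 5(2)]
        have A2: "reals s2 0 = A" by (simp add: f2 f1 A_def)
        have UX: "err p n m A (mprod r (reals s3 1) (reals s3 9)) \<le> \<eta>"
          using 5(1) Y_err A2 order_trans by blast
        show ?case
        proof (rule wp_SeqI[OF wp_phase2[OF p S K(2) K', where n = n and A = A and U = "reals s3 1" and X = "reals s3 9"
              and k = k and \<eta> = \<eta> and \<delta> = \<delta>]], goal_cases)
          case (10 s4)
          note f4 = frame_ints[OF 10(2)] frame_reals[OF 10(2)]
          define P where "P = reals s4 10"
          have inv: "phase2_inv p n m r A (reals s3 1) (reals s3 9) \<eta> \<delta> (r - k) P"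
            using 10(1) by (simp add: P_def)
          then have P: "proj r P" "trace r P \<le> real k"
            unfolding phase2_inv_def by auto
          show ?case
          proof (rule wp_SeqI[OF wp_phase3[OF K(1) K'(1)]], goal_cases)
            case (6 s5)
            note f5 = frame_ints[OF 6(2)] frame_reals[OF 6(2)]
            obtain c P' where "phase3_inv n r (reals s3 1) P r c P' (reals s5 3)"
              using 6(1) by (auto simp: P_def f4)
            from phase3_final[OF this P(2), of "reals s3 9"]
            \<comment> \<open>This factor is only known to exist; the last regression computes one
              that is no worse.\<close>
            obtain Z where Z: "\<forall>a<n. \<forall>j. mprod r (reals s3 1) (mprod r P (reals s3 9)) a j = mprod k (reals s5 3) Z a j" ..
            have "err p n m A (mprod k (reals s5 3) Z) = err p n m A (mprod r (reals s3 1) (mprod r P (reals s3 9)))"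
              unfolding err_def using Z by (intro vnorm_cong) auto
            then have Z_err: "err p n m A (mprod k (reals s5 3) Z) \<le> \<eta> + real (r - k) * (2 * (real r)\<^sup>2 * (\<eta> + \<delta>))"
              using inv by (simp add: phase2_inv_def)
            have A5: "reals s5 0 = A" by (simp add: f5 f4 f3 A2)
            show ?case
            proof (rule wp_Regress[OF S, where a = n and c = k and l = m], goal_cases)
              case (7 X w s6)
              have "reals s6 3 = reals s5 3" "\<And>h j. h < k \<Longrightarrow> j < m \<Longrightarrow> reals s6 4 h j = X h j"
                using 7(4) by (auto simp: Let_def)
              then have "err p n m A (mprod k (reals s6 3) (reals s6 4)) = err p n m A (mprod k (reals s5 3) X)"
                unfolding err_def mprod_def by (intro vnorm_cong) auto
              also have "\<dots> = w" using 7(1) by (simp add: vnorm_err_flip A5)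
              also have "w \<le> err p n m A (mprod k (reals s5 3) Z)"
                using 7(2)[of Z] by (simp add: vnorm_err_flip A5)
              finally show ?case using Z_err by (simp add: A_def)
            qed (use K s in \<open>auto simp: f5 f4 f3 f2 f1\<close>)
          qed (use s P in \<open>auto simp: f4 f3 f2 f1 P_def\<close>)
        next
          case (9 z)
          then show ?case using opt by (simp add: A_def)
        qed (use s 5 UX in \<open>auto simp: f3 f2 f1\<close>)
      qed (use s 4 in \<open>auto simp: f2 f1\<close>)
    qed (use s 1 in \<open>auto simp: f1\<close>)
  qed
qed

section \<open>The approximation guarantee\<close>

lemma klog_ge_2: "2 \<le> klog k m"
  by (simp add: klog_def)

text \<open>For m \<le> 2 the lower bound 2 built into \<open>klog\<close> suffices; for m \<ge> 3
  the logarithm is at least 1, since e \<le> 3.\<close>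

lemma le_klog:
  assumes "1 \<le> k" "k \<le> m"
  shows "real k \<le> klog k m"
proof (cases "m \<le> 2")
  case True
  then show ?thesis using assms by (simp add: klog_def)
next
  case False
  then have "exp 1 \<le> real m" using exp_le by linarith
  then have "1 \<le> ln (real m)" using False by (subst ln_ge_iff) auto
  then have "real k * 1 \<le> real k * ln (real m)" by (intro mult_left_mono) auto
  then show ?thesis by (simp add: klog_def)
qed

lemma klog_le:
  assumes "1 \<le> k" "k \<le> m"
  shows "klog k m \<le> 2 * real (m * m)"
proof -
  have "real k * ln (real m) \<le> real m * real m"
    using assms ln_le_minus_one[of "real m"] by (intro mult_mono) auto
  moreover have "1 * 1 \<le> real m * real m"
    using assms by (intro mult_mono) auto
  ultimately show ?thesis unfolding klog_def by simp
qed

text \<open>A constant factor moves into the exponent because \<open>klog\<close> is at least 2: C =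
  2 powr (log 2 C).\<close>

lemma power_le_klog_powr:
  assumes "1 \<le> C"
  shows "(C * klog k m) ^ d \<le> klog k m powr (real d * (1 + log 2 C))"
proof -
  let ?\<kappa> = "klog k m"
  have \<kappa>: "2 \<le> ?\<kappa>" by (rule klog_ge_2)
  have "C = 2 powr (log 2 C)" using assms by simp
  also have "\<dots> \<le> ?\<kappa> powr (log 2 C)"
    using \<kappa> assms by (intro powr_mono2) auto
  finally have "C * ?\<kappa> \<le> ?\<kappa> powr (log 2 C) * ?\<kappa>"
    using \<kappa> by (intro mult_right_mono) auto
  also have "\<dots> = ?\<kappa> powr (1 + log 2 C)"
    using \<kappa> by (simp add: powr_add)
  finally have "(C * ?\<kappa>) ^ d \<le> (?\<kappa> powr (1 + log 2 C)) ^ d"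
    using \<kappa> assms by (intro power_mono) auto
  also have "\<dots> = ?\<kappa> powr (real d * (1 + log 2 C))"
    using \<kappa> by (simp add: powr_powr powr_realpow[symmetric] mult.commute)
  finally show ?thesis .
qed

lemma err_lp_norm:
  assumes "A \<in> carrier_mat n m" "U \<in> carrier_mat n r" "V \<in> carrier_mat r m"
  shows "lp_norm p (A - U * V)
    = err p n m (\<lambda>i j. A $$ (i, j)) (mprod r (\<lambda>i j. U $$ (i, j)) (\<lambda>i j. V $$ (i, j)))"
proof -
  have C: "A - U * V \<in> carrier_mat n m" using assms by auto
  show ?thesis
    unfolding lp_norm_eq_vnorm[OF C] err_def
    using assms by (intro vnorm_cong) (auto simp: mprod_def index_mult_carrier[OF assms(2,3)] simp del: index_mult_mat(1))
qed

lemma err_cong: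
  assumes "\<And>i j. i < n \<Longrightarrow> j < m \<Longrightarrow> A i j = A' i j" "\<And>i l. i < n \<Longrightarrow> l < r \<Longrightarrow> U i l = U' i l"
    "\<And>l j. l < r \<Longrightarrow> j < m \<Longrightarrow> V l j = V' l j"
  shows "err p n m A (mprod r U V) = err p n m A' (mprod r U' V')"
  unfolding err_def
proof (rule vnorm_cong, clarsimp)
  fix i j assume "i < n" "j < m"
  then have "mprod r U V i j = mprod r U' V' i j"
    unfolding mprod_def using assms by (intro sum.cong) auto
  then show "\<bar>A i j - mprod r U V i j\<bar> = \<bar>A' i j - mprod r U' V' i j\<bar>"
    using assms(1) \<open>i < n\<close> \<open>j < m\<close> by simp
qed

lemma le_opt:
  assumes "A \<in> carrier_mat n m" "\<And>U V. z \<le> err p n m (\<lambda>i j. A $$ (i, j)) (mprod k U V)"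
  shows "z \<le> opt k p A"
  unfolding opt_def
proof (rule cInf_greatest)
  show "{lp_norm p (A - U * V) |U V. U \<in> carrier_mat (dim_row A) k \<and> V \<in> carrier_mat k (dim_col A)} \<noteq> {}"
    by (auto intro: zero_carrier_mat)
  fix x assume "x \<in> {lp_norm p (A - U * V) |U V. U \<in> carrier_mat (dim_row A) k \<and> V \<in> carrier_mat k (dim_col A)}"
  then show "z \<le> x"
    using assms by (auto simp: err_lp_norm[OF assms(1)])
qed

lemma input_store_simps:
  assumes "A \<in> carrier_mat n m" "U \<in> carrier_mat n r" "V \<in> carrier_mat r m"
  shows "ints (input_store n m r k A U V) 0 0 = n" "ints (input_store n m r k A U V) 0 1 = m"
    "ints (input_store n m r k A U V) 0 2 = r" "ints (input_store n m r k A U V) 0 3 = k"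
    "x \<noteq> 0 \<Longrightarrow> ints (input_store n m r k A U V) x i = 0"
    "3 \<le> x \<Longrightarrow> reals (input_store n m r k A U V) x = (\<lambda>_ _. 0)"
    "i < n \<Longrightarrow> j < m \<Longrightarrow> reals (input_store n m r k A U V) 0 i j = A $$ (i, j)"
    "i < n \<Longrightarrow> j < r \<Longrightarrow> reals (input_store n m r k A U V) 1 i j = U $$ (i, j)"
    "i < r \<Longrightarrow> j < m \<Longrightarrow> reals (input_store n m r k A U V) 2 i j = V $$ (i, j)"
proof -
  have i: "ints (input_store n m r k A U V) = (\<lambda>x i. if x = 0 then
      if i = 0 then n else if i = 1 then m else if i = 2 then r else if i = 3 then k else 0 else 0)"
    unfolding input_store_def by (simp add: fun_eq_iff)
  have r: "reals (input_store n m r k A U V) = (\<lambda>x i j.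
      if x = 0 then if i < n \<and> j < m then A $$ (i, j) else 0
      else if x = 1 then if i < n \<and> j < r then U $$ (i, j) else 0
      else if x = 2 then if i < r \<and> j < m then V $$ (i, j) else 0 else 0)"
    unfolding input_store_def using assms by (simp add: fun_eq_iff)
  show "ints (input_store n m r k A U V) 0 0 = n" "ints (input_store n m r k A U V) 0 1 = m"
    "ints (input_store n m r k A U V) 0 2 = r" "ints (input_store n m r k A U V) 0 3 = k"
    "x \<noteq> 0 \<Longrightarrow> ints (input_store n m r k A U V) x i = 0"
    unfolding i by simp_all
  show "3 \<le> x \<Longrightarrow> reals (input_store n m r k A U V) x = (\<lambda>_ _. 0)"
    "i < n \<Longrightarrow> j < m \<Longrightarrow> reals (input_store n m r k A U V) 0 i j = A $$ (i, j)"
    "i < n \<Longrightarrow> j < r \<Longrightarrow> reals (input_store n m r k A U V) 1 i j = U $$ (i, j)"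
    "i < r \<Longrightarrow> j < m \<Longrightarrow> reals (input_store n m r k A U V) 2 i j = V $$ (i, j)"
    unfolding r by simp_all
qed

text \<open>With M = C \<kappa> \<ge> 2 the sum is at most (M + 2 M^3 (M + 1)) \<delta>, hence at
  most 5 M^4 \<delta>, and 5 \<le> 2^3 \<le> M^3 leads to the exponent 7.\<close>

lemma algorithm_error_bound:
  fixes C \<kappa> \<delta> \<rho> k :: real
  assumes "1 \<le> C" "2 \<le> \<kappa>" "0 \<le> k" "k \<le> \<kappa>" "0 \<le> \<delta>" "0 \<le> \<rho>" "\<rho> \<le> C * \<kappa>" "0 \<le> t" "t \<le> \<rho>"
  shows "C * k * \<delta> + t * (2 * \<rho>\<^sup>2 * (C * k * \<delta> + \<delta>)) \<le> (C * \<kappa>) ^ 7 * \<delta>"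
proof -
  define M where "M = C * \<kappa>"
  have M2: "2 \<le> M" using mult_mono[OF assms(1,2)] assms by (simp add: M_def)
  have k: "C * k \<le> M" "0 \<le> C * k"
    using assms by (auto simp: M_def intro: mult_left_mono)
  have \<eta>: "C * k * \<delta> \<le> M * \<delta>" "0 \<le> C * k * \<delta>"
    using mult_right_mono[OF k(1) assms(5)] k(2) assms(5) by auto
  have "t * (2 * \<rho>\<^sup>2 * (C * k * \<delta> + \<delta>)) \<le> M * (2 * M\<^sup>2 * (M * \<delta> + \<delta>))"
  proof (intro mult_mono)
    show "t \<le> M" "\<rho>\<^sup>2 \<le> M\<^sup>2" using assms power_mono[of \<rho> M 2] by (auto simp: M_def)
  qed (use M2 \<eta> assms in auto)
  then have "C * k * \<delta> + t * (2 * \<rho>\<^sup>2 * (C * k * \<delta> + \<delta>)) \<le> (M + 2 * M ^ 3 * (M + 1)) * \<delta>"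
    using \<eta> by (simp add: algebra_simps power2_eq_square power3_eq_cube)
  also have "\<dots> \<le> M ^ 7 * \<delta>"
  proof (intro mult_right_mono assms(5))
    have "M \<le> M ^ 4" using M2 by (intro self_le_power) auto
    moreover have "2 * M ^ 3 * (M + 1) \<le> 2 * M ^ 3 * (2 * M)"
      using M2 by (intro mult_left_mono) auto
    moreover have "2 * M ^ 3 * (2 * M) = 4 * M ^ 4"
      using power_add[of M 3 1] by simp
    ultimately have "M + 2 * M ^ 3 * (M + 1) \<le> M ^ 4 + 4 * M ^ 4"
      by (metis add_mono)
    also have "\<dots> \<le> 2 ^ 3 * M ^ 4" by simp
    also have "\<dots> \<le> M ^ 3 * M ^ 4"
      using M2 by (intro mult_right_mono power_mono) auto
    also have "\<dots> = M ^ 7" by (simp add: power_add[symmetric])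
    finally show "M + 2 * M ^ 3 * (M + 1) \<le> M ^ 7" .
  qed
  finally show ?thesis by (simp add: M_def)
qed

text \<open>Loop bounds involve r, for which only a multiple of \<open>klog\<close> is given; as
  \<open>klog\<close> is at most 2 m^2, they remain polynomial in m n.\<close>

lemma size_bound:
  assumes C: "0 < C" and k: "1 \<le> k" "k \<le> m" "m \<le> n" and r: "real r \<le> C * klog k m"
  shows "n + m + k + 2 * r + 1 \<le> (4 + nat \<lceil>4 * C\<rceil>) * (m * n)\<^sup>2"
proof -
  have mn: "1 \<le> m" "1 \<le> n" "1 \<le> m * n"
    using k mult_le_mono[of 1 m 1 n] by auto
  have "real r \<le> C * (2 * real (m * m))"
    using r klog_le[OF k(1,2)] C mult_left_mono order_trans by (metis less_imp_le)
  also have "\<dots> \<le> C * (2 * real ((m * n)\<^sup>2))"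
  proof -
    have "m * m \<le> m * n" using k(3) by simp
    also have "\<dots> \<le> (m * n)\<^sup>2" by (rule self_le_power) (use mn in auto)
    finally have "real (m * m) \<le> real ((m * n)\<^sup>2)" by (rule of_nat_mono)
    then show ?thesis using C by (intro mult_left_mono) auto
  qed
  finally have "real (2 * r) \<le> 4 * C * real ((m * n)\<^sup>2)" by simp
  also have "\<dots> \<le> real (nat \<lceil>4 * C\<rceil>) * real ((m * n)\<^sup>2)"
    using C by (intro mult_right_mono) auto
  finally have 1: "2 * r \<le> nat \<lceil>4 * C\<rceil> * (m * n)\<^sup>2"
    using of_nat_le_iff[where 'a = real] by (metis of_nat_mult)
  have sq: "x \<le> (m * n)\<^sup>2" if "x \<le> m * n" for x
    using that self_le_power[of "m * n" 2] mn by (auto intro: order_trans)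
  have "n \<le> m * n" "m \<le> m * n" "k \<le> m * n" "1 \<le> m * n"
    using mn k by (auto intro: order_trans)
  then have "n + m + k + 1 \<le> 4 * (m * n)\<^sup>2"
    using sq[of n] sq[of m] sq[of k] sq[of 1] by linarith
  then show ?thesis using 1 by (simp add: distrib_right)
qed

lemma algorithm_correct:
  fixes n m k r :: nat and A U V :: "real mat"
  assumes p: "1 \<le> p" and S: "lp_regression_solver p S"
    and k: "1 \<le> k" "k \<le> m" and C: "1 \<le> C"
    and A: "A \<in> carrier_mat n m" and U: "U \<in> carrier_mat n r" and V: "V \<in> carrier_mat r m"
    and r: "real r \<le> C * klog k m"
    and UV: "lp_norm p (A - U * V) \<le> C * real k * opt k p A"
  shows "\<exists>t s. exec S algorithm (input_store n m r k A U V) t s \<and>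
     t \<le> cost (n + m + k + 2 * r + 1) algorithm \<and>
     lp_norm p (A - get_mat s 3 n k * get_mat s 4 k m) \<le> (C * klog k m) ^ 7 * opt k p A"
proof -
  let ?s = "input_store n m r k A U V"
  let ?K = "n + m + k + 2 * r + 1"
  define \<delta> where "\<delta> = opt k p A"
  define \<eta> where "\<eta> = C * real k * \<delta>"
  define A' where "A' = (\<lambda>i j. A $$ (i, j))"
  note st = input_store_simps[OF A U V, where k = k]
  have A_eq: "err p n m (reals ?s 0) (mprod k X Y) = err p n m A' (mprod k X Y)" for k X Y
    unfolding A'_def by (rule err_cong) (auto simp: st)
  have "0 \<le> \<delta>" unfolding \<delta>_def by (rule le_opt[OF A]) (simp add: err_def)
  have "wp S ?K algorithm (\<lambda>s'. err p n m (reals ?s 0) (mprod k (reals s' 3) (reals s' 4))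
     \<le> \<eta> + real (r - k) * (2 * (real r)\<^sup>2 * (\<eta> + \<delta>))) ?s"
  proof (rule wp_algorithm[OF p S])
    have "err p n m (reals ?s 0) (mprod r (reals ?s 1) (reals ?s 2))
        = err p n m A' (mprod r (\<lambda>i j. U $$ (i, j)) (\<lambda>i j. V $$ (i, j)))"
      unfolding A'_def by (rule err_cong) (auto simp: st)
    also have "\<dots> = lp_norm p (A - U * V)"
      unfolding A'_def err_lp_norm[OF A U V] ..
    finally show "err p n m (reals ?s 0) (mprod r (reals ?s 1) (reals ?s 2)) \<le> \<eta>"
      using UV by (simp add: \<eta>_def \<delta>_def)
    fix z assume "\<And>Us Vs. z \<le> err p n m (reals ?s 0) (mprod k Us Vs)"
    then show "z \<le> \<delta>"
      unfolding \<delta>_def A_eq A'_def by (intro le_opt[OF A])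
  qed (auto simp: st)
  then obtain t s where ts: "exec S algorithm ?s t s" "t \<le> cost ?K algorithm"
    and le: "err p n m A' (mprod k (reals s 3) (reals s 4)) \<le> \<eta> + real (r - k) * (2 * (real r)\<^sup>2 * (\<eta> + \<delta>))"
    unfolding wp_def A_eq by blast
  have W: "get_mat s 3 n k \<in> carrier_mat n k" and Z: "get_mat s 4 k m \<in> carrier_mat k m"
    by (auto simp: get_mat_def)
  have "lp_norm p (A - get_mat s 3 n k * get_mat s 4 k m) = err p n m A' (mprod k (reals s 3) (reals s 4))"
    unfolding err_lp_norm[OF A W Z] A'_def by (rule err_cong) (auto simp: get_mat_def)
  also have "\<dots> \<le> (C * klog k m) ^ 7 * \<delta>"
    using le algorithm_error_bound[OF C klog_ge_2, of "real k" k m \<delta> "real r" "real (r - k)"]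
      r le_klog[OF k] \<open>0 \<le> \<delta>\<close> by (simp add: \<eta>_def)
  finally show ?thesis using ts unfolding \<delta>_def by blast
qed

theorem theorem14:
  "\<exists>prog :: real \<Rightarrow> com. \<forall>C::real. C > 0 \<longrightarrow> (\<exists>c::real. \<forall>p::real. p \<ge> 1 \<longrightarrow> (\<exists>e::nat.
     \<forall>(n::nat) (m::nat) (k::nat) (r::nat) (A::real mat) (U::real mat) (V::real mat) (S::solver).
       lp_regression_solver p S \<longrightarrow>
       m \<le> n \<longrightarrow> 1 \<le> k \<longrightarrow> k \<le> min m n \<longrightarrow>
       A \<in> carrier_mat n m \<longrightarrow> U \<in> carrier_mat n r \<longrightarrow> V \<in> carrier_mat r m \<longrightarrow>
       real r \<le> C * klog k m \<longrightarrow>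
       lp_norm p (A - U * V) \<le> C * real k * opt k p A \<longrightarrow>
       (\<exists>t s W Z. exec S (prog p) (input_store n m r k A U V) t s \<and>
          t \<le> e * (m * n) ^ e \<and>
          W = get_mat s 3 n k \<and> Z = get_mat s 4 k m \<and>
          lp_norm p (A - W * Z) \<le> klog k m powr (c * p) * opt k p A)))"
\<comment> \<open>One program serves every p, which enters only through the solver.\<close>
proof (rule exI[of _ "\<lambda>_. algorithm"], intro allI impI)
  fix C :: real assume C: "0 < C"
  obtain e0 where e0: "\<And>K. 1 \<le> K \<Longrightarrow> cost K algorithm \<le> e0 * K ^ e0"
    using cost_polynomial[of algorithm] by blast
  \<comment> \<open>Raised to at least 1 so that its logarithm, and with it the exponent, is
    nonnegative.\<close>
  define C' where "C' = max 1 C"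
  define c where "c = 7 * (1 + log 2 C')"
  define D where "D = 4 + nat \<lceil>4 * C\<rceil>"
  \<comment> \<open>Chosen to dominate both the coefficient \<open>e0 * D ^ e0\<close> and the
    exponent \<open>2 * e0\<close> that the size bound produces.\<close>
  define e where "e = e0 * D ^ e0 + 2 * e0"
  have C': "1 \<le> C'" "C \<le> C'" by (auto simp: C'_def)
  have c0: "0 \<le> c" using C' by (simp add: c_def)
  show "\<exists>c. \<forall>p\<ge>1. \<exists>e. \<forall>n m k r A U V S. lp_regression_solver p S \<longrightarrow>
       m \<le> n \<longrightarrow> 1 \<le> k \<longrightarrow> k \<le> min m n \<longrightarrow>
       A \<in> carrier_mat n m \<longrightarrow> U \<in> carrier_mat n r \<longrightarrow> V \<in> carrier_mat r m \<longrightarrow>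
       real r \<le> C * klog k m \<longrightarrow>
       lp_norm p (A - U * V) \<le> C * real k * opt k p A \<longrightarrow>
       (\<exists>t s W Z. exec S algorithm (input_store n m r k A U V) t s \<and>
          t \<le> e * (m * n) ^ e \<and>
          W = get_mat s 3 n k \<and> Z = get_mat s 4 k m \<and>
          lp_norm p (A - W * Z) \<le> klog k m powr (c * p) * opt k p A)"
  proof (rule exI[of _ c], intro allI impI, rule exI[of _ e], intro allI impI)
    fix p :: real and n m k r :: nat and A U V :: "real mat" and S :: solver
    assume p: "1 \<le> p" and S: "lp_regression_solver p S"
      and mn: "m \<le> n" and k: "1 \<le> k" "k \<le> min m n"
      and A: "A \<in> carrier_mat n m" and U: "U \<in> carrier_mat n r" and V: "V \<in> carrier_mat r m"
      and r: "real r \<le> C * klog k m" and UV: "lp_norm p (A - U * V) \<le> C * real k * opt k p A"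
    have opt0: "0 \<le> opt k p A" by (rule le_opt[OF A]) (simp add: err_def)
    have km: "k \<le> m" using k by simp
    have "C * klog k m \<le> C' * klog k m"
      using C' klog_ge_2[of k m] by (intro mult_right_mono) auto
    then have r': "real r \<le> C' * klog k m" using r by simp
    have "C * real k * opt k p A \<le> C' * real k * opt k p A"
      using C' opt0 by (intro mult_right_mono) auto
    then have UV': "lp_norm p (A - U * V) \<le> C' * real k * opt k p A" using UV by simp
    obtain t s where ts: "exec S algorithm (input_store n m r k A U V) t s"
      "t \<le> cost (n + m + k + 2 * r + 1) algorithm"
      and le: "lp_norm p (A - get_mat s 3 n k * get_mat s 4 k m) \<le> (C' * klog k m) ^ 7 * opt k p A"
      using algorithm_correct[OF p S k(1) km C'(1) A U V r' UV'] by blast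
    have "(C' * klog k m) ^ 7 \<le> klog k m powr c"
      using power_le_klog_powr[OF C'(1), of k m 7] by (simp add: c_def)
    \<comment> \<open>The exponent c is independent of p; since p \<ge> 1 and c \<ge> 0, it may be
      relaxed to c p.\<close>
    also have "\<dots> \<le> klog k m powr (c * p)"
      using klog_ge_2[of k m] p c0 mult_left_mono[OF p c0] by (intro powr_mono) auto
    finally have approx: "lp_norm p (A - get_mat s 3 n k * get_mat s 4 k m) \<le> klog k m powr (c * p) * opt k p A"
      using le opt0 mult_right_mono order_trans by blast
    have mn1: "1 \<le> m * n" using mult_le_mono[of 1 m 1 n] k mn by simp
    have "t \<le> e0 * (n + m + k + 2 * r + 1) ^ e0"
      using ts(2) e0[of "n + m + k + 2 * r + 1"] by simp
    also have "\<dots> \<le> e0 * (D * (m * n)\<^sup>2) ^ e0"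
      using size_bound[OF C k(1) km mn r] by (intro mult_left_mono power_mono) (auto simp: D_def)
    also have "\<dots> = e0 * D ^ e0 * (m * n) ^ (2 * e0)"
      by (simp only: power_mult_distrib power_mult[symmetric] mult.assoc)
    also have "\<dots> \<le> e * (m * n) ^ e"
      using mn1 by (intro mult_le_mono power_increasing) (auto simp: e_def)
    finally have "t \<le> e * (m * n) ^ e" .
    then show "\<exists>t s W Z. exec S algorithm (input_store n m r k A U V) t s \<and> t \<le> e * (m * n) ^ e \<and>
          W = get_mat s 3 n k \<and> Z = get_mat s 4 k m \<and>
          lp_norm p (A - W * Z) \<le> klog k m powr (c * p) * opt k p A"
      using ts(1) approx by blast
  qed
qed

end
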